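(* Let $\mathbf{x}$ be a point in $\mathbb{R}^2$ with irrational slope $\xi$. (i) We have $$\mu(\mathbf{x},\mathbf{0})=1\quad\text{and}\quad\hat\mu(\mathbf{x},\mathbf{0})=\frac{1}{\omega(\xi)}.$$ (ii) Let $\mathbf{y}=\begin{pmatrix} y_1 \\ y_2 \end{pmatrix}\in\mathbb{R}^2\setminus\{\mathbf{0}\}$. Assume that either the slope $y=y_1/y_2$ is rational or that $y_2=0$. Then $$\mu(\mathbf{x},\mathbf{y})=\frac{\omega(\xi)}{\omega(\xi)+1}\ge\frac12\quad\text{and}\quad\hat\mu(\mathbf{x},\mathbf{y})=\frac{1}{\omega(\xi)+1}.$$ (iii) Let $\mathbf{y}=\begin{pmatrix} y_1 \\ y_2 \end{pmatrix}\in\mathbb{R}^2$ be a point whose slope $y=y_1/y_2$ is an irrational number. Then $$\mu(\mathbf{x},\mathbf{y})\ge\frac13\quad\text{and}\quad\hat\mu(\mathbf{x},\mathbf{y})\ge\frac{\omega(y)+1}{2(2\omega(y)+1)\,\omega(\xi)}\ge\frac{1}{4\,\omega(\xi)}.$$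
   Context: $\Gamma=\mathrm{SL}(2,\mathbb{Z})$ acts on column vectors of $\mathbb{R}^2$ by left multiplication. For $\mathbf{z}=\begin{pmatrix} z_1 \\ z_2 \end{pmatrix}$, $|\mathbf{z}|=\max(|z_1|,|z_2|)$, and the slope of $\mathbf{z}$ is $z_1/z_2$ (when $z_2\neq0$). For a matrix $\gamma$, $|\gamma|$ is the maximum of the absolute values of its entries. Irrationality measure: for an irrational real number $\alpha$, $\omega(\alpha)\in[1,+\infty]$ is the supremum of the real numbers $\omega$ such that $|v\alpha+u|\le|v|^{-\omega}$ has infinitely many solutions in integers $(v,u)$ with $v\neq0$. Exponents: for $\mathbf{x},\mathbf{y}\in\mathbb{R}^2$, $\mu(\mathbf{x},\mathbf{y})$ is the supremum of the real numbers $\mu$ for which there exist infinitely many $\gamma\in\Gamma$ with $|\gamma\mathbf{x}-\mathbf{y}|\le|\gamma|^{-\mu}$; and $\hat\mu(\mathbf{x},\mathbf{y})$ is the supremum of the real numbers $\mu$ such that for every sufficiently large positive real number $T$ there exists $\gamma\in\Gamma$ with $|\gamma|\le T$ and $|\gamma\mathbf{x}-\mathbf{y}|\le T^{-\mu}$. These suprema may be $+\infty$. Conventions for infinite values: if $\omega(\xi)=+\infty$, then $1/\omega(\xi)$, $1/(\omega(\xi)+1)$ and every bound with $\omega(\xi)$ only in the denominator are read as $0$, and $\omega(\xi)/(\omega(\xi)+1)$ is read as $1$; if $\omega(y)=+\infty$, then $(\omega(y)+1)/(2\omega(y)+1)$ is read as $1/2$. *)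

theory Defs
  imports "HOL-Analysis.Analysis"
begin

definition SL2Z :: "(int^2^2) set" where
  "SL2Z = {\<gamma>. det \<gamma> = 1}"

definition mat_act :: "int^2^2 \<Rightarrow> real^2 \<Rightarrow> real^2" where
  "mat_act \<gamma> z = map_matrix real_of_int \<gamma> *v z"

definition mat_height :: "int^2^2 \<Rightarrow> real" where
  "mat_height \<gamma> = real_of_int (Max {\<bar>\<gamma> $ i $ j\<bar> |i j. True})"

text \<open>
  The norm on the plane is the library's \<open>infnorm\<close>, which on \<open>real^2\<close> is
  \<open>max \<bar>z $ 1\<bar> \<bar>z $ 2\<bar>\<close> (lemma \<open>infnorm_2\<close>).
  The slope is only meaningful when \<open>z $ 2 \<noteq> 0\<close>; its junk value for \<open>z $ 2 = 0\<close> is \<open>0\<close>,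
  so uses of it are guarded explicitly.
\<close>

definition slope :: "real^2 \<Rightarrow> real" where
  "slope z = z $ 1 / z $ 2"

text \<open>
  The exponents are suprema in \<open>ereal\<close>, so that an unbounded set of real exponents yields \<open>\<infinity>\<close>.
\<close>

definition irr_measure :: "real \<Rightarrow> ereal" where
  "irr_measure \<alpha> = Sup {ereal w |w. infinite {(v :: int, u :: int).
      v \<noteq> 0 \<and> \<bar>of_int v * \<alpha> + of_int u\<bar> \<le> \<bar>of_int v\<bar> powr (- w)}}"

definition approx_exp :: "real^2 \<Rightarrow> real^2 \<Rightarrow> ereal" where
  "approx_exp x y = Sup {ereal m |m. infinite {\<gamma> \<in> SL2Z.
      infnorm (mat_act \<gamma> x - y) \<le> mat_height \<gamma> powr (- m)}}"

definition unif_approx_exp :: "real^2 \<Rightarrow> real^2 \<Rightarrow> ereal" where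
  "unif_approx_exp x y = Sup {ereal m |m. \<forall>\<^sub>F T :: real in at_top.
      \<exists>\<gamma>\<in>SL2Z. mat_height \<gamma> \<le> T \<and> infnorm (mat_act \<gamma> x - y) \<le> T powr (- m)}"

text \<open>
  In \<open>ereal\<close> the quotient \<open>\<infinity> / \<infinity>\<close> is \<open>0\<close>, so the two quotients below take their limit
  as value at \<open>\<infinity>\<close>. Quotients with a finite numerator and infinite denominator are \<open>0\<close>
  in \<open>ereal\<close> already.
\<close>

definition quot_succ :: "ereal \<Rightarrow> ereal" where
  "quot_succ w = (if w = \<infinity> then 1 else w / (w + 1))"

definition succ_quot_double :: "ereal \<Rightarrow> ereal" where
  "succ_quot_double w = (if w = \<infinity> then 1 / 2 else (w + 1) / (2 * w + 1))"

end

(*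
  Write e(v,u) = v*xi + u. For a matrix with rows (v1,u1), (v2,u2) of determinant 1 one has
  v1 e(v2,u2) - v2 e(v1,u1) = 1. Comparing the rows with a good approximation (V,U) of xi through
  such determinants gives the upper bounds in (i) and (ii). For the lower bounds, a primitive
  vector (v,u) with small e(v,u) is completed to a unimodular matrix; adding multiples of (v,u) to
  the other row moves the image of x along the first axis in steps of e(v,u), and a second
  unimodular matrix carries that axis to the line through a primitive integer vector (p,q).
  In (iii) this line is chosen close to y, with p/q approximating the slope of y. No continued
  fractions are used: Dirichlet's theorem and extremal choices replace them.
*)
theory Submission
  imports Defs "HOL-Real_Asymp.Real_Asymp"
begin

section \<open>Matrices and exponents\<close>

text \<open>The exponents come from counting steps. Write e for the absolute value of the form of
  (v,u). A completing row has form value at most about 1/v + e, so reaching 0 takes about 1/(v e)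
  steps and, as each step adds (v,u), costs height about 1/e; reaching a nonzero target takes about
  1/e steps and costs v/e. With e near v^(-w) the error e meets height v^w or v^(w+1): hence 1
  against w/(w+1), and in the uniform setting 1/w against 1/(w+1).

  For irrational slope eta of y the direction must vary with the precision. If (q,p) has form value
  f at eta, the multiple of the integer vector is y_2/q; the height becomes (v+q)/e and the error q
  e + f/q. The obstacle is that good approximations to xi and to eta are unrelated. The ordinary
  exponent needs a pair suited to each other, found by maximising one under a constraint from the
  other; the uniform one restricts q to a fixed power of the bound on v.

  Suprema need not be attained, constants accumulate and the irrationality measure may be infinite.
  So estimates are proved for a real w strictly on one side of the measure, and slack in the
  exponent absorbs constants.\<close>

abbreviation lform :: "real \<Rightarrow> int \<Rightarrow> int \<Rightarrow> real" where
  "lform \<xi> v u \<equiv> of_int v * \<xi> + of_int u"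

definition mat2 :: "int \<Rightarrow> int \<Rightarrow> int \<Rightarrow> int \<Rightarrow> int^2^2" where
  "mat2 a b c d = vector [vector [a, b], vector [c, d]]"

lemma mat2_nth [simp]:
  "mat2 a b c d $ 1 $ 1 = a" "mat2 a b c d $ 1 $ 2 = b"
  "mat2 a b c d $ 2 $ 1 = c" "mat2 a b c d $ 2 $ 2 = d"
  by (simp_all add: mat2_def)

lemma mat2_eta: "mat2 (\<gamma> $ 1 $ 1) (\<gamma> $ 1 $ 2) (\<gamma> $ 2 $ 1) (\<gamma> $ 2 $ 2) = \<gamma>"
  by (simp add: vec_eq_iff forall_2)

lemma SL2Z_iff: "\<gamma> \<in> SL2Z \<longleftrightarrow> \<gamma> $ 1 $ 1 * \<gamma> $ 2 $ 2 - \<gamma> $ 1 $ 2 * \<gamma> $ 2 $ 1 = 1"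
  by (simp add: SL2Z_def det_2)

lemma mat_height_le_iff:
  "mat_height \<gamma> \<le> r \<longleftrightarrow> \<bar>of_int (\<gamma> $ 1 $ 1)\<bar> \<le> r \<and> \<bar>of_int (\<gamma> $ 1 $ 2)\<bar> \<le> r
     \<and> \<bar>of_int (\<gamma> $ 2 $ 1)\<bar> \<le> r \<and> \<bar>of_int (\<gamma> $ 2 $ 2)\<bar> \<le> r"
proof -
  have "{\<bar>\<gamma> $ i $ j\<bar> |i j. True} = (\<Union>i. \<Union>j. {\<bar>\<gamma> $ i $ j\<bar>})"
    by auto
  also have "\<dots> =
      {\<bar>\<gamma> $ 1 $ 1\<bar>, \<bar>\<gamma> $ 1 $ 2\<bar>, \<bar>\<gamma> $ 2 $ 1\<bar>, \<bar>\<gamma> $ 2 $ 2\<bar>}"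
    unfolding UNIV_2 by auto
  finally have *: "{\<bar>\<gamma> $ i $ j\<bar> |i j. True} =
      {\<bar>\<gamma> $ 1 $ 1\<bar>, \<bar>\<gamma> $ 1 $ 2\<bar>, \<bar>\<gamma> $ 2 $ 1\<bar>, \<bar>\<gamma> $ 2 $ 2\<bar>}" .
  then show ?thesis
    unfolding mat_height_def * by (simp add: of_int_max)
qed

lemma abs_entry_le_height:
  "\<bar>of_int (\<gamma> $ 1 $ 1)\<bar> \<le> mat_height \<gamma>" "\<bar>of_int (\<gamma> $ 1 $ 2)\<bar> \<le> mat_height \<gamma>"
  "\<bar>of_int (\<gamma> $ 2 $ 1)\<bar> \<le> mat_height \<gamma>" "\<bar>of_int (\<gamma> $ 2 $ 2)\<bar> \<le> mat_height \<gamma>"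
  using mat_height_le_iff[of \<gamma> "mat_height \<gamma>"] by auto

lemma mat_height_ge_1:
  assumes "\<gamma> \<in> SL2Z"
  shows "1 \<le> mat_height \<gamma>"
proof (rule ccontr)
  assume "\<not> ?thesis"
  with abs_entry_le_height[of \<gamma>] have "\<bar>real_of_int (\<gamma> $ 1 $ 1)\<bar> < 1" "\<bar>real_of_int (\<gamma> $ 1 $ 2)\<bar> < 1"
    by linarith+
  then have "\<gamma> $ 1 $ 1 = 0" "\<gamma> $ 1 $ 2 = 0"
    by linarith+
  with assms show False
    by (simp add: SL2Z_iff)
qed

lemma finite_bounded_height: "finite {\<gamma>. mat_height \<gamma> \<le> r}"
proof (rule finite_subset)
  let ?I = "{- \<lfloor>r\<rfloor>..\<lfloor>r\<rfloor>}"
  show "{\<gamma>. mat_height \<gamma> \<le> r} \<subseteq> (\<lambda>(a, b, c, d). mat2 a b c d) ` (?I \<times> ?I \<times> ?I \<times> ?I)"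
  proof
    fix \<gamma> assume "\<gamma> \<in> {\<gamma>. mat_height \<gamma> \<le> r}"
    then have "\<gamma> $ 1 $ 1 \<in> ?I" "\<gamma> $ 1 $ 2 \<in> ?I" "\<gamma> $ 2 $ 1 \<in> ?I" "\<gamma> $ 2 $ 2 \<in> ?I"
      by (simp_all add: mat_height_le_iff; linarith)+
    then show "\<gamma> \<in> (\<lambda>(a, b, c, d). mat2 a b c d) ` (?I \<times> ?I \<times> ?I \<times> ?I)"
      by (intro image_eqI[of _ _ "(\<gamma> $ 1 $ 1, \<gamma> $ 1 $ 2, \<gamma> $ 2 $ 1, \<gamma> $ 2 $ 2)"])
        (simp_all add: mat2_eta)
  qed
qed simp

lemma mat_act_nth:
  assumes "x $ 2 \<noteq> 0"
  shows "mat_act \<gamma> x $ 1 = x $ 2 * lform (slope x) (\<gamma> $ 1 $ 1) (\<gamma> $ 1 $ 2)"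
    and "mat_act \<gamma> x $ 2 = x $ 2 * lform (slope x) (\<gamma> $ 2 $ 1) (\<gamma> $ 2 $ 2)"
  using assms
  by (simp_all add: mat_act_def matrix_vector_mult_def map_matrix_def sum_2 slope_def distrib_left)

lemma infnorm_2': "infnorm (z :: real^2) = max \<bar>z $ 1\<bar> \<bar>z $ 2\<bar>"
  using infnorm_2[of z] by simp

section \<open>From estimates with constants to exponents\<close>

lemma powr_dominates:
  fixes C D c b :: real
  assumes "c < b" "0 < D" "0 < C"
  shows "\<forall>\<^sub>F B in at_top. C * B powr (- b) \<le> D * B powr (- c)"
  using assms by real_asymp

text \<open>The upper bounds for \<open>approx_exp x 0\<close> and for both uniform exponents end
  here: along arbitrarily large \<open>A\<close> no constant compensates a larger exponent.\<close>

lemma powr_le_unbounded_imp_le: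
  fixes m k C :: real
  assumes "\<And>R. \<exists>A\<ge>R. A powr m \<le> C * A powr k"
  shows "m \<le> k"
proof (rule ccontr)
  assume "\<not> m \<le> k"
  then have "k < m" by simp
  define D where "D = max C 1"
  have "D > 0" "C \<le> D" by (auto simp: D_def)
  have "\<forall>\<^sub>F A in at_top. D * A powr k < A powr m"
    using \<open>D > 0\<close> \<open>k < m\<close> by real_asymp
  then obtain R where "\<And>A. A \<ge> R \<Longrightarrow> D * A powr k < A powr m"
    by (auto simp: eventually_at_top_linorder)
  moreover obtain A where "A \<ge> R" "A powr m \<le> C * A powr k"
    using assms by blast
  moreover have "C * A powr k \<le> D * A powr k"
    using \<open>C \<le> D\<close> by (intro mult_right_mono) auto
  ultimately show False
    by (smt (verit))
qed

text \<open>The bound \<open>l\<close> only provides room below \<open>m\<close>, so that the values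
  tested may be taken, for example, positive.\<close>

lemma ereal_le_densely:
  fixes S :: ereal
  assumes "l < m" "\<And>m'. l < m' \<Longrightarrow> m' < m \<Longrightarrow> ereal m' \<le> S"
  shows "ereal m \<le> S"
proof (rule dense_le_bounded[of "ereal l"])
  show "ereal l < ereal m" using assms by simp
  fix w assume "ereal l < w" "w < ereal m"
  then show "w \<le> S" using assms(2) by (cases w) auto
qed

text \<open>Infinitely many matrices are required, and the clause
  \<open>mat_act \<gamma> x \<noteq> y\<close> supplies them: a finite set has its nonzero errors
  bounded below, while the errors here are nonzero and tend to 0. Any \<open>m < b / a\<close>
  leaves slack to absorb \<open>C\<close>.\<close>

lemma approx_exp_ge:
  assumes "0 < a" "0 < b" "0 < C"
    and "\<And>R. \<exists>B\<ge>R. \<exists>\<gamma>\<in>SL2Z. mat_act \<gamma> x \<noteq> y \<and> mat_height \<gamma> \<le> C * B powr a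
           \<and> infnorm (mat_act \<gamma> x - y) \<le> C * B powr (- b)"
  shows "approx_exp x y \<ge> ereal (b / a)"
proof (rule ereal_le_densely[of 0])
  show "0 < b / a" using assms by simp
  fix m assume m: "0 < m" "m < b / a"
  define S where "S = {\<gamma> \<in> SL2Z. infnorm (mat_act \<gamma> x - y) \<le> mat_height \<gamma> powr (- m)}"
  have "infinite S"
  proof
    assume "finite S"
    \<comment> \<open>Least nonzero error in \<open>S\<close>; inserting 1 keeps the set
      nonempty.\<close>
    define \<delta> where "\<delta> = Min (insert 1 {infnorm (mat_act \<gamma> x - y) |\<gamma>. \<gamma> \<in> S \<and> mat_act \<gamma> x \<noteq> y})"
    have fin: "finite {infnorm (mat_act \<gamma> x - y) |\<gamma>. \<gamma> \<in> S \<and> mat_act \<gamma> x \<noteq> y}"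
      using \<open>finite S\<close> by simp
    have "\<delta> > 0"
      unfolding \<delta>_def using fin by (subst Min_gr_iff) (auto simp: infnorm_pos_lt)
    have \<delta>: "\<delta> \<le> infnorm (mat_act \<gamma> x - y)" if "\<gamma> \<in> S" "mat_act \<gamma> x \<noteq> y" for \<gamma>
      unfolding \<delta>_def using fin that by (intro Min_le) auto
    have "a * m < b" using m assms by (simp add: field_simps)
    have "\<forall>\<^sub>F B in at_top. C * B powr (- b) \<le> C powr (- m) * B powr (- (a * m))"
      using assms \<open>a * m < b\<close> by (intro powr_dominates) auto
    moreover have "\<forall>\<^sub>F B in at_top. C * B powr (- b) < \<delta>"
      using \<open>0 < b\<close> \<open>\<delta> > 0\<close> \<open>0 < C\<close> by real_asymp
    ultimately have "\<forall>\<^sub>F B in at_top. C * B powr (- b) \<le> C powr (- m) * B powr (- (a * m))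
        \<and> C * B powr (- b) < \<delta>"
      by eventually_elim auto
    then obtain R where R: "\<And>B. B \<ge> R \<Longrightarrow> C * B powr (- b) \<le> C powr (- m) * B powr (- (a * m))
        \<and> C * B powr (- b) < \<delta>"
      by (auto simp: eventually_at_top_linorder)
    obtain B \<gamma> where B: "B \<ge> R" "\<gamma> \<in> SL2Z" "mat_act \<gamma> x \<noteq> y" "mat_height \<gamma> \<le> C * B powr a"
        "infnorm (mat_act \<gamma> x - y) \<le> C * B powr (- b)"
      using assms(4) by blast
    have h1: "1 \<le> mat_height \<gamma>" by (rule mat_height_ge_1) fact
    have "C powr (- m) * B powr (- (a * m)) = (C * B powr a) powr (- m)"
      using \<open>0 < C\<close> by (simp add: powr_mult powr_powr)
    also have "\<dots> \<le> mat_height \<gamma> powr (- m)"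
      using B h1 m by (intro powr_mono2') auto
    finally have "\<gamma> \<in> S"
      using B R[OF B(1)] unfolding S_def by auto
    with \<delta> B R[OF B(1)] show False by fastforce
  qed
  then show "ereal m \<le> approx_exp x y"
    unfolding approx_exp_def S_def by (intro Sup_upper) auto
qed

text \<open>A reparametrisation: the natural parameter \<open>Q\<close> of a construction is
  replaced by the height bound \<open>T\<close>. No sign is imposed on \<open>b\<close>, which is 0
  in one application.\<close>

lemma unif_approx_exp_ge:
  assumes "0 < a" "0 < C"
    and ev: "\<forall>\<^sub>F Q in at_top. \<exists>\<gamma>\<in>SL2Z. mat_height \<gamma> \<le> C * Q powr a
           \<and> infnorm (mat_act \<gamma> x - y) \<le> C * Q powr (- b)"
  shows "unif_approx_exp x y \<ge> ereal (b / a)"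
proof (rule ereal_le_densely[of "b / a - 1"])
  show "b / a - 1 < b / a" by simp
  fix m assume m: "b / a - 1 < m" "m < b / a"
  \<comment> \<open>The substitution Q = (T/C)^(1/a) turns the height bound C Q^a into exactly
    T.\<close>
  have "filterlim (\<lambda>T. (T / C) powr (1 / a)) at_top at_top"
    using assms(1,2) by real_asymp
  then have 1: "\<forall>\<^sub>F T in at_top. \<exists>\<gamma>\<in>SL2Z. mat_height \<gamma> \<le> C * ((T / C) powr (1 / a)) powr a
           \<and> infnorm (mat_act \<gamma> x - y) \<le> C * ((T / C) powr (1 / a)) powr (- b)"
    using eventually_compose_filterlim[OF ev] by blast
  have 2: "\<forall>\<^sub>F T in at_top. (C * C powr (b / a)) * T powr (- (b / a)) \<le> 1 * T powr (- m)"
    using assms m by (intro powr_dominates) auto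
  have "\<forall>\<^sub>F T in at_top. \<exists>\<gamma>\<in>SL2Z. mat_height \<gamma> \<le> T \<and> infnorm (mat_act \<gamma> x - y) \<le> T powr (- m)"
    using 1 2 eventually_gt_at_top[of 0]
  proof eventually_elim
    case (elim T)
    have "C * ((T / C) powr (1 / a)) powr a = T"
      using assms elim by (simp add: powr_powr)
    moreover have "C * ((T / C) powr (1 / a)) powr (- b) = (C * C powr (b / a)) * T powr (- (b / a))"
      using assms elim by (simp add: powr_powr powr_divide powr_minus field_simps)
    ultimately show ?case using elim by fastforce
  qed
  then show "ereal m \<le> unif_approx_exp x y"
    unfolding unif_approx_exp_def by (intro Sup_upper) auto
qed

section \<open>Linear forms and the irrationality measure\<close>

lemma lform_nonzero:
  assumes "\<xi> \<notin> \<rat>" "v \<noteq> 0"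
  shows "lform \<xi> v u \<noteq> 0"
proof
  assume "lform \<xi> v u = 0"
  then have "\<xi> = - of_int u / of_int v"
    using assms(2) by (simp add: field_simps add_eq_0_iff)
  then have "\<xi> \<in> \<rat>"
    by (metis Rats_divide Rats_minus_iff Rats_of_int)
  with assms show False by simp
qed

lemma finite_bounded_lform:
  fixes R :: real
  shows "finite {(v, u). \<bar>of_int v\<bar> \<le> R \<and> \<bar>lform \<xi> v u\<bar> \<le> M}"
proof (rule finite_subset)
  let ?I = "\<lambda>r::real. {- \<lfloor>r\<rfloor>..\<lfloor>r\<rfloor>}"
  show "{(v, u). \<bar>of_int v\<bar> \<le> R \<and> \<bar>lform \<xi> v u\<bar> \<le> M} \<subseteq> ?I R \<times> ?I (M + R * \<bar>\<xi>\<bar>)"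
  proof clarify
    fix v u :: int
    assume *: "\<bar>of_int v\<bar> \<le> R" "\<bar>lform \<xi> v u\<bar> \<le> M"
    have "\<bar>of_int v * \<xi>\<bar> \<le> R * \<bar>\<xi>\<bar>"
      using * by (auto simp: abs_mult intro: mult_right_mono)
    with * have u: "\<bar>of_int u\<bar> \<le> M + R * \<bar>\<xi>\<bar>" by linarith
    have "\<bar>v\<bar> \<le> \<lfloor>R\<rfloor>" "\<bar>u\<bar> \<le> \<lfloor>M + R * \<bar>\<xi>\<bar>\<rfloor>"
      using *(1) u by (simp_all add: le_floor_iff)
    then show "v \<in> ?I R \<and> u \<in> ?I (M + R * \<bar>\<xi>\<bar>)"
      by auto
  qed
qed auto

text \<open>Bounding both \<open>v\<close> and the form leaves finitely many pairs, and
  irrationality keeps their values away from 0. Used contrapositively: a small form forces a large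
  \<open>v\<close>.\<close>

lemma lform_bounded_away:
  fixes R :: real
  assumes "\<xi> \<notin> \<rat>"
  shows "\<exists>\<delta>>0. \<forall>v u. v \<noteq> 0 \<longrightarrow> \<bar>of_int v\<bar> \<le> R \<longrightarrow> \<delta> \<le> \<bar>lform \<xi> v u\<bar>"
proof -
  define S where "S = {(v, u). v \<noteq> 0 \<and> \<bar>of_int v\<bar> \<le> R \<and> \<bar>lform \<xi> v u\<bar> \<le> 1}"
  have "finite S"
    by (rule finite_subset[OF _ finite_bounded_lform[of R \<xi> 1]]) (auto simp: S_def)
  define A where "A = insert 1 ((\<lambda>(v, u). \<bar>lform \<xi> v u\<bar>) ` S)"
  have "finite A" using \<open>finite S\<close> by (simp add: A_def)
  then have "Min A > 0"
    using lform_nonzero[OF assms] by (subst Min_gr_iff) (auto simp: A_def S_def)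
  moreover have "Min A \<le> \<bar>lform \<xi> v u\<bar>" if "v \<noteq> 0" "\<bar>of_int v\<bar> \<le> R" for v u
  proof (cases "\<bar>lform \<xi> v u\<bar> \<le> 1")
    case True
    with that \<open>finite A\<close> show ?thesis
      by (intro Min_le) (auto simp: A_def S_def intro!: image_eqI[of _ _ "(v, u)"])
  next
    case False
    moreover have "Min A \<le> 1"
      using \<open>finite A\<close> by (intro Min_le) (auto simp: A_def)
    ultimately show ?thesis by linarith
  qed
  ultimately show ?thesis by blast
qed

lemma Dirichlet_lform:
  assumes "N > 0"
  obtains v u where "coprime v u" "0 < v" "v \<le> int N" "\<bar>lform \<xi> v u\<bar> < 1 / N"
proof -
  obtain h k where "coprime h k" "0 < k" "k \<le> int N" "\<bar>of_int k * \<xi> - of_int h\<bar> < 1 / N"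
    using Dirichlet_approx_coprime[OF assms] by metis
  then show ?thesis
    by (intro that[of k "- h"]) (auto simp: coprime_commute)
qed

text \<open>Rounding \<open>Q\<close> down to an integer \<open>N\<close> with Q <= 2N costs the
  factor 2; the product bound is N * (1/N).\<close>

lemma Dirichlet_lform_real:
  assumes "Q \<ge> 1"
  obtains v u where "coprime v u" "0 < v" "of_int v \<le> Q" "\<bar>lform \<xi> v u\<bar> \<le> 2 / Q"
    "of_int v * \<bar>lform \<xi> v u\<bar> \<le> 1"
proof -
  define N where "N = nat \<lfloor>Q\<rfloor>"
  have N: "N > 0" "real N \<le> Q" "Q \<le> 2 * real N"
  proof -
    have "1 \<le> \<lfloor>Q\<rfloor>" "real N = of_int \<lfloor>Q\<rfloor>"
      using assms by (simp_all add: N_def)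
    then show "N > 0" "real N \<le> Q" "Q \<le> 2 * real N"
      by linarith+
  qed
  obtain v u where vu: "coprime v u" "0 < v" "v \<le> int N" "\<bar>lform \<xi> v u\<bar> < 1 / N"
    using Dirichlet_lform[OF \<open>N > 0\<close>] by metis
  have "1 / real N \<le> 2 / Q"
    using N assms by (simp add: field_simps)
  moreover have "of_int v * \<bar>lform \<xi> v u\<bar> \<le> real N * (1 / real N)"
    using vu by (intro mult_mono) auto
  ultimately show ?thesis
    using vu N by (intro that[of v u]) auto
qed

lemma irr_measure_ge:
  fixes w C :: real
  assumes "\<And>R::real. \<exists>v u. R \<le> \<bar>of_int v\<bar> \<and> \<bar>lform \<xi> v u\<bar> \<le> C * \<bar>of_int v\<bar> powr (- w)"
  shows "ereal w \<le> irr_measure \<xi>"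
proof (rule ereal_le_densely[of "w - 1"])
  fix w' assume w': "w - 1 < w'" "w' < w"
  define D where "D = max C 1"
  have D: "D > 0" "C \<le> D" by (auto simp: D_def)
  define S where "S = {(v :: int, u :: int). v \<noteq> 0 \<and> \<bar>lform \<xi> v u\<bar> \<le> \<bar>of_int v\<bar> powr (- w')}"
  have "\<forall>\<^sub>F B in at_top. D * B powr (- w) \<le> 1 * B powr (- w')"
    using w' D by (intro powr_dominates) auto
  then obtain R0 where R0: "\<And>B. B \<ge> R0 \<Longrightarrow> D * B powr (- w) \<le> B powr (- w')"
    by (auto simp: eventually_at_top_linorder)
  have ex: "\<exists>(v, u)\<in>S. R \<le> \<bar>v\<bar>" for R
  proof -
    obtain v u where vu: "max (max R0 1) (of_int R) \<le> \<bar>of_int v\<bar>"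
        "\<bar>lform \<xi> v u\<bar> \<le> C * \<bar>of_int v\<bar> powr (- w)"
      using assms by blast
    have "C * \<bar>of_int v\<bar> powr (- w) \<le> D * \<bar>of_int v\<bar> powr (- w)"
      using D by (intro mult_right_mono) auto
    moreover have "R \<le> \<bar>v\<bar>" using vu by linarith
    ultimately show ?thesis
      using vu R0[of "\<bar>of_int v\<bar>"] by (intro bexI[of _ "(v, u)"]) (auto simp: S_def)
  qed
  have "infinite S"
  proof
    assume "finite S"
    define M where "M = Max ((\<lambda>p. \<bar>fst p\<bar>) ` S)"
    obtain p where p: "p \<in> S" "of_int (M + 1) \<le> \<bar>fst p\<bar>"
      using ex[of "M + 1"] by auto
    have "\<bar>fst p\<bar> \<le> M"
      unfolding M_def using \<open>finite S\<close> p(1) by (intro Max_ge) auto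
    with p(2) show False by simp
  qed
  then show "ereal w' \<le> irr_measure \<xi>"
    unfolding irr_measure_def S_def by (blast intro: Sup_upper)
qed simp

text \<open>Dirichlet gives a form below 1/N <= 1/v; taking 1/N below the minimum over small
  coefficients makes \<open>v\<close> exceed any bound.\<close>

lemma irr_measure_ge_1:
  assumes "\<xi> \<notin> \<rat>"
  shows "1 \<le> irr_measure \<xi>"
proof -
  have "\<exists>v u. R \<le> \<bar>of_int v\<bar> \<and> \<bar>lform \<xi> v u\<bar> \<le> 1 * \<bar>of_int v\<bar> powr (- 1)" for R :: real
  proof -
    obtain \<delta> where \<delta>: "\<delta> > 0" "\<And>v u. v \<noteq> 0 \<Longrightarrow> \<bar>of_int v\<bar> \<le> R \<Longrightarrow> \<delta> \<le> \<bar>lform \<xi> v u\<bar>"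
      using lform_bounded_away[OF assms, of R] by (elim exE conjE) blast
    obtain n where n: "1 / real (Suc n) < \<delta>"
      using nat_approx_posE[OF \<delta>(1)] by blast
    define N where "N = Suc n"
    have N: "N > 0" "1 / real N < \<delta>" using n by (simp_all add: N_def)
    obtain v u where vu: "0 < v" "v \<le> int N" "\<bar>lform \<xi> v u\<bar> < 1 / N"
      using Dirichlet_lform[OF \<open>N > 0\<close>] by metis
    have "R \<le> \<bar>of_int v\<bar>"
      using \<delta>(2)[of v u] vu N by linarith
    moreover have "1 / real N \<le> 1 / of_int v"
      using vu by (intro divide_left_mono) auto
    ultimately show ?thesis
      using vu by (intro exI[of _ v] exI[of _ u]) (auto simp: powr_minus inverse_eq_divide)
  qed
  from irr_measure_ge[OF this] show ?thesis by (simp add: one_ereal_def)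
qed

text \<open>Only finitely many pairs violate the bound with constant 1, and each has a nonzero form;
  \<open>c\<close> is the least constant they need, capped at 1.\<close>

lemma irr_measure_less_imp:
  assumes "\<xi> \<notin> \<rat>" "irr_measure \<xi> < ereal w"
  shows "\<exists>c>0. \<forall>v u. v \<noteq> 0 \<longrightarrow> c * \<bar>of_int v\<bar> powr (- w) \<le> \<bar>lform \<xi> v u\<bar>"
proof -
  define S where "S = {(v :: int, u :: int). v \<noteq> 0 \<and> \<bar>lform \<xi> v u\<bar> \<le> \<bar>of_int v\<bar> powr (- w)}"
  have "finite S"
  proof (rule ccontr)
    assume "infinite S"
    then have "ereal w \<le> irr_measure \<xi>"
      unfolding irr_measure_def S_def by (blast intro: Sup_upper)
    with assms show False by simp
  qed
  define A where "A = insert 1 ((\<lambda>(v, u). \<bar>lform \<xi> v u\<bar> * \<bar>of_int v\<bar> powr w) ` S)"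
  have "finite A" using \<open>finite S\<close> by (simp add: A_def)
  then have "Min A > 0"
    using lform_nonzero[OF assms(1)] by (subst Min_gr_iff) (auto simp: A_def S_def)
  moreover have "Min A * \<bar>of_int v\<bar> powr (- w) \<le> \<bar>lform \<xi> v u\<bar>" if "v \<noteq> 0" for v u
  proof (cases "(v, u) \<in> S")
    case True
    then have "Min A \<le> \<bar>lform \<xi> v u\<bar> * \<bar>of_int v\<bar> powr w"
      using \<open>finite A\<close> by (intro Min_le) (auto simp: A_def intro!: image_eqI[of _ _ "(v, u)"])
    then show ?thesis
      using that by (simp add: powr_minus field_simps)
  next
    case False
    have "Min A \<le> 1"
      using \<open>finite A\<close> by (intro Min_le) (auto simp: A_def)
    then have "Min A * \<bar>of_int v\<bar> powr (- w) \<le> 1 * \<bar>of_int v\<bar> powr (- w)"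
      by (intro mult_right_mono) auto
    moreover have "\<bar>of_int v\<bar> powr (- w) < \<bar>lform \<xi> v u\<bar>"
      using False that by (auto simp: S_def)
    ultimately show ?thesis by linarith
  qed
  ultimately show ?thesis by blast
qed

text \<open>Primitive solutions are needed for completion to a unimodular matrix. Dividing by the
  gcd shrinks both the form and the coefficient, and for positive \<open>w\<close> the inequality
  survives.\<close>

lemma less_irr_measure_imp:
  fixes R :: real
  assumes "\<xi> \<notin> \<rat>" "0 < w" "ereal w < irr_measure \<xi>"
  shows "\<exists>v u. coprime v u \<and> 0 < v \<and> R \<le> of_int v \<and> \<bar>lform \<xi> v u\<bar> \<le> of_int v powr (- w)"
proof -
  obtain w' where "ereal w < ereal w'" and
      inf: "infinite {(v :: int, u :: int). v \<noteq> 0 \<and> \<bar>lform \<xi> v u\<bar> \<le> \<bar>of_int v\<bar> powr (- w')}" (is "infinite ?S")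
    using assms(3) unfolding irr_measure_def less_Sup_iff by blast
  then have w': "w < w'" by simp
  obtain \<delta> where \<delta>: "\<delta> > 0" "\<And>v u. v \<noteq> 0 \<Longrightarrow> \<bar>of_int v\<bar> \<le> R \<Longrightarrow> \<delta> \<le> \<bar>lform \<xi> v u\<bar>"
    using lform_bounded_away[OF assms(1), of R] by (elim exE conjE) blast
  have "0 < w'" using assms(2) w' by simp
  have "\<forall>\<^sub>F B in at_top. B powr (- w') < \<delta>"
    using \<open>\<delta> > 0\<close> \<open>0 < w'\<close> by real_asymp
  then obtain M where M: "\<And>B. B \<ge> M \<Longrightarrow> B powr (- w') < \<delta>"
    by (auto simp: eventually_at_top_linorder)
  \<comment> \<open>An infinite set leaves every finite box; since its forms stay at most 1, the
    coefficient is what leaves.\<close>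
  have "\<not> ?S \<subseteq> {(v, u). \<bar>of_int v\<bar> \<le> M \<and> \<bar>lform \<xi> v u\<bar> \<le> 1}"
  proof
    assume "?S \<subseteq> {(v, u). \<bar>of_int v\<bar> \<le> M \<and> \<bar>lform \<xi> v u\<bar> \<le> 1}"
    from finite_subset[OF this finite_bounded_lform] inf show False by contradiction
  qed
  then obtain v u where vu: "v \<noteq> 0" "\<bar>lform \<xi> v u\<bar> \<le> \<bar>of_int v\<bar> powr (- w')"
      "\<not> (\<bar>of_int v\<bar> \<le> M \<and> \<bar>lform \<xi> v u\<bar> \<le> 1)"
    by auto
  have le1: "\<bar>of_int v\<bar> powr (- w') \<le> 1 powr (- w')"
    using w' assms vu by (intro powr_mono2') auto
  then have "M < \<bar>of_int v\<bar>" using vu by auto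
  \<comment> \<open>The sign makes the quotient \<open>a\<close> positive.\<close>
  define g where "g = sgn v * gcd v u"
  have g: "g \<noteq> 0" "g dvd v" "g dvd u" using vu by (auto simp: g_def sgn_if)
  then obtain a b where ab: "v = g * a" "u = g * b" by (auto elim!: dvdE)
  have "0 < a"
  proof -
    have "0 < \<bar>v\<bar>" using vu by simp
    also have "\<bar>v\<bar> = gcd v u * a"
      using ab(1) vu by (auto simp: g_def abs_if sgn_if)
    finally have "0 < gcd v u * a" .
    moreover have "0 < gcd v u" using vu by simp
    ultimately show ?thesis by (simp only: zero_less_mult_pos)
  qed
  have "coprime a b"
  proof -
    have "\<bar>g\<bar> = gcd v u" using vu by (auto simp: g_def abs_mult sgn_if)
    moreover have "gcd v u = \<bar>g\<bar> * gcd a b" unfolding ab by (simp add: gcd_mult_distrib_int)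
    ultimately have "gcd a b = 1" using g by auto
    then show ?thesis by (simp add: coprime_iff_gcd_eq_1)
  qed
  have le: "\<bar>lform \<xi> a b\<bar> \<le> \<bar>lform \<xi> v u\<bar>"
  proof -
    have "lform \<xi> v u = of_int g * lform \<xi> a b" by (simp add: ab algebra_simps)
    then have "\<bar>lform \<xi> v u\<bar> = of_int \<bar>g\<bar> * \<bar>lform \<xi> a b\<bar>" by (simp add: abs_mult)
    moreover have "real_of_int \<bar>g\<bar> \<ge> 1" using g by linarith
    ultimately show ?thesis by (simp add: mult_le_cancel_right1)
  qed
  have av: "a \<le> \<bar>v\<bar>" using ab g \<open>0 < a\<close> by (simp add: abs_mult)
  have v1: "1 \<le> \<bar>real_of_int v\<bar>" using vu(1) by linarith
  have av': "real_of_int a \<le> \<bar>real_of_int v\<bar>" using av by linarith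
  \<comment> \<open>The quotient by the gcd could be small although \<open>v\<close> is large; the
    size of \<open>a\<close> is recovered from the smallness of its form.\<close>
  have "\<bar>of_int v\<bar> powr (- w') < \<delta>" using M \<open>M < \<bar>of_int v\<bar>\<close> by simp
  with le vu have "\<bar>lform \<xi> a b\<bar> < \<delta>" by linarith
  with \<delta>(2)[of a b] \<open>0 < a\<close> have "R \<le> of_int a" by fastforce
  have "\<bar>of_int v\<bar> powr (- w') \<le> \<bar>of_int v\<bar> powr (- w)"
    using v1 w' by (intro powr_mono) auto
  also have "\<dots> \<le> of_int a powr (- w)"
    using av' \<open>0 < a\<close> assms by (intro powr_mono2') auto
  finally have "\<bar>lform \<xi> a b\<bar> \<le> of_int a powr (- w)" using le vu by linarith
  with \<open>coprime a b\<close> \<open>0 < a\<close> \<open>R \<le> of_int a\<close> show ?thesis by blast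
qed

section \<open>Lower bounds from primitive completions\<close>

text \<open>Bezout cofactors are determined modulo the row, so one of them can be reduced modulo the
  larger entry, and the determinant then bounds the other. The bound keeps later constants
  independent of the row.\<close>

lemma primitive_row_completion:
  fixes a b :: int
  assumes "coprime a b"
  obtains r s where "a * s - b * r = 1" "\<bar>r\<bar> \<le> max \<bar>a\<bar> \<bar>b\<bar>" "\<bar>s\<bar> \<le> max \<bar>a\<bar> \<bar>b\<bar>"
proof -
  have main: "\<exists>r s. a * s - b * r = 1 \<and> \<bar>r\<bar> \<le> \<bar>b\<bar> \<and> \<bar>s\<bar> \<le> \<bar>b\<bar>"
    if "coprime a b" "\<bar>a\<bar> \<le> \<bar>b\<bar>" for a b :: int
  proof -
    have "b \<noteq> 0" using that by auto
    obtain k l where kl: "k * a + l * b = 1"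
      using bezout_int[of a b] coprime_imp_gcd_eq_1[OF \<open>coprime a b\<close>] by metis
    define s where "s = k mod \<bar>b\<bar>"
    have s: "0 \<le> s" "s < \<bar>b\<bar>" using \<open>b \<noteq> 0\<close> by (simp_all add: s_def)
    have "k - s = \<bar>b\<bar> * (k div \<bar>b\<bar>)"
      unfolding s_def by (simp add: minus_mod_eq_mult_div)
    then have "b dvd k - s" by simp
    moreover have "a * s - 1 = - (a * (k - s)) - l * b"
      using kl by (simp add: algebra_simps)
    ultimately have "b dvd a * s - 1" by simp
    then obtain r where r: "a * s - 1 = b * r" by (elim dvdE)
    have "\<bar>b\<bar> * \<bar>r\<bar> = \<bar>a * s - 1\<bar>" using r by (simp add: abs_mult)
    also have "\<dots> \<le> \<bar>a\<bar> * s + 1" using s by (simp add: abs_mult abs_triangle_ineq4[THEN order_trans])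
    also have "\<dots> \<le> \<bar>b\<bar> * (\<bar>b\<bar> - 1) + 1"
      using that s by (intro add_mono mult_mono) auto
    also have "\<dots> \<le> \<bar>b\<bar> * \<bar>b\<bar>" using \<open>b \<noteq> 0\<close> by (simp add: algebra_simps)
    finally have "\<bar>r\<bar> \<le> \<bar>b\<bar>" by (rule mult_left_le_imp_le) (use \<open>b \<noteq> 0\<close> in auto)
    then show ?thesis using r s by (intro exI[of _ r] exI[of _ s]) auto
  qed
  show ?thesis
  proof (cases "\<bar>a\<bar> \<le> \<bar>b\<bar>")
    case True
    from main[OF assms True] obtain r s where "a * s - b * r = 1" "\<bar>r\<bar> \<le> \<bar>b\<bar>" "\<bar>s\<bar> \<le> \<bar>b\<bar>" by blast
    then show ?thesis using that[of s r] by simp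
  next
    case False
    \<comment> \<open>Swapping and negating the entries exchanges the two cofactors and preserves
      the determinant.\<close>
    have "coprime (- b) (- a)" using assms by (simp add: coprime_commute)
    from main[OF this] False obtain r s where "- b * s - - a * r = 1" "\<bar>r\<bar> \<le> \<bar>a\<bar>" "\<bar>s\<bar> \<le> \<bar>a\<bar>"
      by auto
    then show ?thesis using that[of r s] by simp
  qed
qed

lemma abs_lincomb_le:
  fixes a b c d S M :: real
  assumes "\<bar>a\<bar> \<le> S" "\<bar>b\<bar> \<le> M" "\<bar>c\<bar> \<le> S" "\<bar>d\<bar> \<le> M"
  shows "\<bar>a * b + c * d\<bar> \<le> 2 * (S * M)"
proof -
  have "0 \<le> S" "0 \<le> M" using assms by linarith+
  then have "\<bar>a * b\<bar> \<le> S * M" "\<bar>c * d\<bar> \<le> S * M"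
    using assms by (auto simp: abs_mult intro!: mult_mono)
  then show ?thesis by linarith
qed

text \<open>
  The matrix is \<open>N ** G\<close>, where \<open>N\<close> has first column \<open>(p, q)\<close> and \<open>G\<close> has second row \<open>(v, u)\<close>;
  the first row of \<open>G\<close> is determined modulo \<open>(v, u)\<close>, so the first coordinate of \<open>G x\<close> can be
  brought within \<open>\<bar>v \<xi> + u\<bar>\<close> of any target. Two consecutive choices are available, hence \<open>y0\<close>
  can be avoided.
\<close>

lemma exists_approx_of_primitive_multiple:
  fixes x :: "real^2"
  assumes x: "x $ 2 \<noteq> 0" "slope x \<notin> \<rat>"
  shows "\<exists>C>0. \<forall>p q v u l y0. coprime p q \<longrightarrow> coprime v u \<longrightarrow> 0 < v \<longrightarrow>
    \<bar>lform (slope x) v u\<bar> \<le> 1 \<longrightarrow>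
    (\<exists>\<gamma>\<in>SL2Z. mat_act \<gamma> x \<noteq> y0
      \<and> mat_height \<gamma> \<le> C * (of_int (max \<bar>p\<bar> \<bar>q\<bar>) *
          (of_int v + \<bar>l\<bar> * of_int v / \<bar>lform (slope x) v u\<bar> + 1 / \<bar>lform (slope x) v u\<bar>))
      \<and> infnorm (mat_act \<gamma> x - vector [l * of_int p, l * of_int q])
          \<le> C * (of_int (max \<bar>p\<bar> \<bar>q\<bar>) * \<bar>lform (slope x) v u\<bar>))"
proof -
  define \<xi> where "\<xi> = slope x"
  define X where "X = \<bar>x $ 2\<bar>"
  \<comment> \<open>\<open>D * v\<close> bounds |u|, because u differs from -v xi by at most 1. The
    constants depend on \<open>x\<close> alone; uniformity in p, q and l is needed when the
    direction varies.\<close>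
  define D where "D = \<bar>\<xi>\<bar> + 1"
  define C1 where "C1 = D * (2 + D + 1 / X)"
  have "X > 0" using x by (simp add: X_def)
  have "D \<ge> 1" by (simp add: D_def)
  have "C1 > 0" using \<open>X > 0\<close> \<open>D \<ge> 1\<close> unfolding C1_def by (intro mult_pos_pos add_pos_pos) auto
  show ?thesis unfolding \<xi>_def[symmetric]
  proof (intro exI[of _ "2 * C1 + 2 * X"] conjI allI impI)
    show "0 < 2 * C1 + 2 * X" using \<open>X > 0\<close> \<open>C1 > 0\<close> by simp
    fix p q v u :: int and l :: real and y0 :: "real^2"
    assume pq: "coprime p q" and vu: "coprime v u" "0 < v" "\<bar>lform \<xi> v u\<bar> \<le> 1"
    define S where "S = real_of_int (max \<bar>p\<bar> \<bar>q\<bar>)"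
    define e where "e = lform \<xi> v u"
    define V where "V = real_of_int v"
    define M where "M = V + \<bar>l\<bar> * V / \<bar>e\<bar> + 1 / \<bar>e\<bar>"
    have "e \<noteq> 0" using lform_nonzero[of \<xi> v u] x vu by (simp add: e_def \<xi>_def)
    have "V \<ge> 1" using vu by (simp add: V_def)
    have "\<bar>e\<bar> \<le> 1" using vu by (simp add: e_def)
    obtain r s where rs: "p * s - q * r = 1" "\<bar>r\<bar> \<le> max \<bar>p\<bar> \<bar>q\<bar>" "\<bar>s\<bar> \<le> max \<bar>p\<bar> \<bar>q\<bar>"
      using primitive_row_completion[OF pq] by metis
    have "coprime u v" using vu by (simp add: coprime_commute)
    then obtain u0 v0 where "u * v0 - v * u0 = 1" "\<bar>u0\<bar> \<le> max \<bar>u\<bar> \<bar>v\<bar>" "\<bar>v0\<bar> \<le> max \<bar>u\<bar> \<bar>v\<bar>"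
      using primitive_row_completion by metis
    note uv0 = this
    have u: "\<bar>of_int u\<bar> \<le> D * V"
    proof -
      have "of_int u = e - V * \<xi>" by (simp add: e_def V_def)
      then have "\<bar>of_int u\<bar> \<le> \<bar>e\<bar> + V * \<bar>\<xi>\<bar>" using \<open>V \<ge> 1\<close>
        by (metis abs_mult abs_of_nonneg abs_triangle_ineq4 order.trans zero_le_one)
      also have "\<dots> \<le> D * V" using \<open>\<bar>e\<bar> \<le> 1\<close> \<open>V \<ge> 1\<close> by (simp add: D_def algebra_simps)
      finally show ?thesis .
    qed
    have "V \<le> D * V" using \<open>D \<ge> 1\<close> \<open>V \<ge> 1\<close> by (simp add: mult_le_cancel_right1)
    have v: "\<bar>of_int v\<bar> \<le> D * V" using \<open>V \<le> D * V\<close> vu by (simp add: V_def)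
    have uv0': "\<bar>of_int u0\<bar> \<le> D * V" "\<bar>of_int v0\<bar> \<le> D * V"
      using uv0(2,3) u v by linarith+
    define e0 where "e0 = lform \<xi> v0 u0"
    have det0: "of_int v0 * e - V * e0 = 1"
    proof -
      have "of_int v0 * e - V * e0 = real_of_int (u * v0 - v * u0)"
        by (simp add: e_def e0_def V_def algebra_simps)
      then show ?thesis using uv0(1) by simp
    qed
    \<comment> \<open>Solved from \<open>det0\<close>: the completing row starts within about 1/V of
      0.\<close>
    have e0: "\<bar>e0\<bar> \<le> 1 / V + D * \<bar>e\<bar>"
    proof -
      have "V * e0 = of_int v0 * e - 1" using det0 by simp
      then have "V * \<bar>e0\<bar> = \<bar>of_int v0 * e - 1\<bar>" using \<open>V \<ge> 1\<close> by (metis abs_mult abs_of_nonneg order.trans zero_le_one)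
      also have "\<dots> \<le> \<bar>of_int v0\<bar> * \<bar>e\<bar> + 1"
        using abs_triangle_ineq4[of "of_int v0 * e" 1] by (simp add: abs_mult)
      also have "\<dots> \<le> (D * V) * \<bar>e\<bar> + 1" using uv0' by (intro add_mono mult_right_mono) auto
      finally show ?thesis using \<open>V \<ge> 1\<close> by (simp add: field_simps)
    qed
    \<comment> \<open>The real number of steps of size \<open>e\<close> that would hit the target
      exactly; \<open>n\<close> is one of two adjacent integers.\<close>
    define \<rho> where "\<rho> = (l / x $ 2 - e0) / e"
    \<comment> \<open>Product of the matrix with rows (p, r), (q, s) and the one with rows (v0 + n
      v, u0 + n u), (v, u).\<close>
    define G where "G = (\<lambda>n. mat2 (p * (v0 + n * v) + r * v) (p * (u0 + n * u) + r * u)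
                                 (q * (v0 + n * v) + s * v) (q * (u0 + n * u) + s * u))"
    have G1: "mat_act (G n) x $ 1 = x $ 2 * (of_int p * (e0 + of_int n * e) + of_int r * e)"
      and G2: "mat_act (G n) x $ 2 = x $ 2 * (of_int q * (e0 + of_int n * e) + of_int s * e)" for n
      unfolding mat_act_nth[OF x(1)]
      by (simp_all add: G_def e_def e0_def \<xi>_def algebra_simps)
    have "p \<noteq> 0 \<or> q \<noteq> 0" using pq by auto
    then have "mat_act (G \<lfloor>\<rho>\<rfloor>) x \<noteq> mat_act (G (\<lfloor>\<rho>\<rfloor> + 1)) x"
      using x(1) \<open>e \<noteq> 0\<close> by (auto simp: vec_eq_iff forall_2 G1 G2)
    then obtain n where n: "n = \<lfloor>\<rho>\<rfloor> \<or> n = \<lfloor>\<rho>\<rfloor> + 1" "mat_act (G n) x \<noteq> y0" by metis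
    have n_le: "\<bar>\<rho> - of_int n\<bar> \<le> 1" using n(1) by (elim disjE) (simp_all, linarith+)
    have "G n \<in> SL2Z"
    proof -
      have "(p * (v0 + n * v) + r * v) * (q * (u0 + n * u) + s * u) - (p * (u0 + n * u) + r * u) * (q * (v0 + n * v) + s * v)
        = (p * s - q * r) * (u * v0 - v * u0)" by (simp add: algebra_simps)
      then show ?thesis using rs uv0 by (simp add: SL2Z_iff G_def)
    qed
    have S: "\<bar>of_int p\<bar> \<le> S" "\<bar>of_int q\<bar> \<le> S" "\<bar>of_int r\<bar> \<le> S" "\<bar>of_int s\<bar> \<le> S"
      using rs unfolding S_def by linarith+
    have "1 / X \<le> 2 + D + 1 / X" using \<open>D \<ge> 1\<close> by simp
    then have "D * (1 / X) \<le> C1" unfolding C1_def using \<open>D \<ge> 1\<close> by (intro mult_left_mono) auto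
    \<comment> \<open>Multiplied by V these terms become those of the height: |l| V/|e| for reaching
      the target and 1/|e| for undoing the initial offset. For l = 0 only the cheap one
      remains.\<close>
    have "\<bar>\<rho>\<bar> \<le> \<bar>l\<bar> / (X * \<bar>e\<bar>) + 1 / (V * \<bar>e\<bar>) + D"
    proof -
      have "\<bar>\<rho>\<bar> = \<bar>l / x $ 2 - e0\<bar> / \<bar>e\<bar>" by (simp add: \<rho>_def)
      also have "\<dots> \<le> (\<bar>l\<bar> / X + (1 / V + D * \<bar>e\<bar>)) / \<bar>e\<bar>"
        using e0 abs_triangle_ineq4[of "l / x $ 2" e0] by (intro divide_right_mono) (auto simp: X_def)
      also have "\<dots> = \<bar>l\<bar> / (X * \<bar>e\<bar>) + 1 / (V * \<bar>e\<bar>) + D"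
        using \<open>e \<noteq> 0\<close> by (simp add: field_simps)
      finally show ?thesis .
    qed
    then have n_abs: "\<bar>of_int n\<bar> \<le> \<bar>l\<bar> / (X * \<bar>e\<bar>) + 1 / (V * \<bar>e\<bar>) + D + 1"
      using n_le by linarith
    have row1: "\<bar>of_int (a0 + n * a)\<bar> \<le> C1 * M"
      if "\<bar>of_int a0\<bar> \<le> D * V" "\<bar>of_int a\<bar> \<le> D * V" for a0 a :: int
    proof -
      have "\<bar>of_int (a0 + n * a)\<bar> \<le> \<bar>real_of_int a0\<bar> + \<bar>of_int n\<bar> * \<bar>of_int a\<bar>"
        by (simp flip: abs_mult)
      also have "\<dots> \<le> D * V + (\<bar>l\<bar> / (X * \<bar>e\<bar>) + 1 / (V * \<bar>e\<bar>) + D + 1) * (D * V)"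
        using that n_abs by (intro add_mono mult_mono) auto
      also have "\<dots> = D * ((2 + D) * V + 1 / X * (\<bar>l\<bar> * V / \<bar>e\<bar>) + 1 / \<bar>e\<bar>)"
        using \<open>X > 0\<close> \<open>V \<ge> 1\<close> \<open>e \<noteq> 0\<close> by (simp add: field_simps)
      also have "\<dots> \<le> D * ((2 + D + 1 / X) * V + (2 + D + 1 / X) * (\<bar>l\<bar> * V / \<bar>e\<bar>) + (2 + D + 1 / X) * (1 / \<bar>e\<bar>))"
      proof -
        define k where "k = 2 + D + 1 / X"
        have k: "2 + D \<le> k" "1 / X \<le> k" "1 \<le> k"
          using \<open>X > 0\<close> \<open>D \<ge> 1\<close> by (auto simp: k_def intro: add_increasing2)
        have "(2 + D) * V \<le> k * V" "1 / X * (\<bar>l\<bar> * V / \<bar>e\<bar>) \<le> k * (\<bar>l\<bar> * V / \<bar>e\<bar>)"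
          "1 * (1 / \<bar>e\<bar>) \<le> k * (1 / \<bar>e\<bar>)"
          using k \<open>V \<ge> 1\<close> by (intro mult_right_mono; simp)+
        then show ?thesis
          unfolding k_def[symmetric] using \<open>D \<ge> 1\<close> by (intro mult_left_mono) linarith+
      qed
      also have "\<dots> = C1 * M" by (simp add: C1_def M_def algebra_simps add_divide_distrib)
      finally show ?thesis .
    qed
    have row2: "D * V \<le> C1 * M"
    proof -
      have "D * 1 \<le> D * (2 + D + 1 / X)" using \<open>D \<ge> 1\<close> \<open>X > 0\<close>
        by (intro mult_left_mono) (auto intro: add_increasing2)
      moreover have "V \<le> M" unfolding M_def using \<open>V \<ge> 1\<close> by auto
      ultimately show ?thesis using \<open>V \<ge> 1\<close> \<open>C1 > 0\<close> by (intro mult_mono) (auto simp: C1_def)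
    qed
    have rows: "\<bar>of_int (v0 + n * v)\<bar> \<le> C1 * M" "\<bar>of_int (u0 + n * u)\<bar> \<le> C1 * M"
      "\<bar>of_int v\<bar> \<le> C1 * M" "\<bar>of_int u\<bar> \<le> C1 * M"
      using row1 uv0' u v row2 by (auto intro: order_trans)
    have "S \<ge> 0" "M \<ge> 0" using S \<open>V \<ge> 1\<close> by (auto simp: M_def)
    have h: "mat_height (G n) \<le> 2 * (S * (C1 * M))"
      unfolding mat_height_le_iff G_def mat2_nth
      using abs_lincomb_le[OF S(1) rows(1) S(3) rows(3)] abs_lincomb_le[OF S(1) rows(2) S(3) rows(4)]
        abs_lincomb_le[OF S(2) rows(1) S(4) rows(3)] abs_lincomb_le[OF S(2) rows(2) S(4) rows(4)]
      by simp
    define t where "t = e0 + of_int n * e - l / x $ 2"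
    have "t = (of_int n - \<rho>) * e" using \<open>e \<noteq> 0\<close> by (simp add: t_def \<rho>_def field_simps)
    then have "\<bar>t\<bar> = \<bar>\<rho> - of_int n\<bar> * \<bar>e\<bar>" by (simp add: abs_mult abs_minus_commute)
    also have "\<dots> \<le> 1 * \<bar>e\<bar>" using n_le by (intro mult_right_mono) auto
    finally have t: "\<bar>t\<bar> \<le> \<bar>e\<bar>" by simp
    have err: "infnorm (mat_act (G n) x - vector [l * of_int p, l * of_int q]) \<le> 2 * (S * (X * \<bar>e\<bar>))"
    proof -
      have 1: "(mat_act (G n) x - vector [l * of_int p, l * of_int q]) $ 1
          = of_int p * (x $ 2 * t) + of_int r * (x $ 2 * e)"
        using x(1) by (simp add: G1 t_def field_simps)
      have 2: "(mat_act (G n) x - vector [l * of_int p, l * of_int q]) $ 2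
          = of_int q * (x $ 2 * t) + of_int s * (x $ 2 * e)"
        using x(1) by (simp add: G2 t_def field_simps)
      have "\<bar>x $ 2 * t\<bar> \<le> X * \<bar>e\<bar>" "\<bar>x $ 2 * e\<bar> \<le> X * \<bar>e\<bar>"
        using t by (simp_all add: abs_mult X_def mult_left_mono)
      then show ?thesis
        unfolding infnorm_2' 1 2 using S by (intro max.boundedI abs_lincomb_le)
    qed
    have "2 * (S * (C1 * M)) \<le> (2 * C1 + 2 * X) * (S * M)"
      using \<open>S \<ge> 0\<close> \<open>M \<ge> 0\<close> \<open>X > 0\<close> by (simp add: algebra_simps)
    moreover have "2 * (S * (X * \<bar>e\<bar>)) \<le> (2 * C1 + 2 * X) * (S * \<bar>e\<bar>)"
      using \<open>S \<ge> 0\<close> \<open>C1 > 0\<close> by (simp add: algebra_simps)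
    ultimately show "\<exists>\<gamma>\<in>SL2Z. mat_act \<gamma> x \<noteq> y0
      \<and> mat_height \<gamma> \<le> (2 * C1 + 2 * X) * (of_int (max \<bar>p\<bar> \<bar>q\<bar>) *
          (of_int v + \<bar>l\<bar> * of_int v / \<bar>lform \<xi> v u\<bar> + 1 / \<bar>lform \<xi> v u\<bar>))
      \<and> infnorm (mat_act \<gamma> x - vector [l * of_int p, l * of_int q])
          \<le> (2 * C1 + 2 * X) * (of_int (max \<bar>p\<bar> \<bar>q\<bar>) * \<bar>lform \<xi> v u\<bar>)"
      using h err \<open>G n \<in> SL2Z\<close> n(2)
      unfolding S_def[symmetric] e_def[symmetric]
      unfolding V_def[symmetric]
      unfolding M_def[symmetric]
      by (intro bexI[of _ "G n"] conjI) linarith+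
  qed
qed

lemma exists_approx_fixed_direction:
  fixes x :: "real^2"
  assumes x: "x $ 2 \<noteq> 0" "slope x \<notin> \<rat>" and "coprime p q"
  obtains C where "C > 0"
    "\<And>v u y0. coprime v u \<Longrightarrow> 0 < v \<Longrightarrow> \<bar>lform (slope x) v u\<bar> \<le> 1 \<Longrightarrow>
      \<exists>\<gamma>\<in>SL2Z. mat_act \<gamma> x \<noteq> y0
      \<and> mat_height \<gamma> \<le> C * (of_int v + \<bar>l\<bar> * of_int v / \<bar>lform (slope x) v u\<bar> + 1 / \<bar>lform (slope x) v u\<bar>)
      \<and> infnorm (mat_act \<gamma> x - vector [l * of_int p, l * of_int q]) \<le> C * \<bar>lform (slope x) v u\<bar>"
proof -
  define S where "S = real_of_int (max \<bar>p\<bar> \<bar>q\<bar>)"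
  have "p \<noteq> 0 \<or> q \<noteq> 0" using assms by auto
  then have "S > 0" unfolding S_def by auto
  obtain C where C: "C > 0" "\<And>v u y0. coprime v u \<Longrightarrow> 0 < v \<Longrightarrow> \<bar>lform (slope x) v u\<bar> \<le> 1 \<Longrightarrow>
      \<exists>\<gamma>\<in>SL2Z. mat_act \<gamma> x \<noteq> y0
      \<and> mat_height \<gamma> \<le> C * (S * (of_int v + \<bar>l\<bar> * of_int v / \<bar>lform (slope x) v u\<bar> + 1 / \<bar>lform (slope x) v u\<bar>))
      \<and> infnorm (mat_act \<gamma> x - vector [l * of_int p, l * of_int q]) \<le> C * (S * \<bar>lform (slope x) v u\<bar>)"
    using exists_approx_of_primitive_multiple[OF x] \<open>coprime p q\<close> unfolding S_def by meson
  show ?thesis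
  proof (rule that[of "C * S"])
    show "C * S > 0" using C \<open>S > 0\<close> by simp
  qed (use C(2) in \<open>simp add: mult.assoc\<close>)
qed

lemma exists_small_lform:
  assumes "\<xi> \<notin> \<rat>"
  obtains v u where "coprime v u" "0 < v" "\<bar>lform \<xi> v u\<bar> \<le> 1" "R \<le> 1 / \<bar>lform \<xi> v u\<bar>"
    "of_int v \<le> 1 / \<bar>lform \<xi> v u\<bar>"
proof -
  define Q where "Q = 2 * max R 1"
  have "Q \<ge> 1" by (simp add: Q_def)
  obtain v u where vu: "coprime v u" "0 < v" "\<bar>lform \<xi> v u\<bar> \<le> 2 / Q" "of_int v * \<bar>lform \<xi> v u\<bar> \<le> 1"
    using Dirichlet_lform_real[OF \<open>Q \<ge> 1\<close>] by metis
  have e: "\<bar>lform \<xi> v u\<bar> > 0" using lform_nonzero[OF assms, of v u] vu by simp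
  have "2 / Q \<le> 1" by (simp add: Q_def)
  moreover have "of_int v \<le> 1 / \<bar>lform \<xi> v u\<bar>" using vu e by (simp add: field_simps)
  moreover have "R \<le> 1 / \<bar>lform \<xi> v u\<bar>"
  proof -
    have "R \<le> Q / 2" by (simp add: Q_def)
    also have "\<dots> \<le> 1 / \<bar>lform \<xi> v u\<bar>" using vu e \<open>Q \<ge> 1\<close> by (simp add: field_simps)
    finally show ?thesis .
  qed
  ultimately show ?thesis using vu by (intro that) auto
qed

section \<open>Lower bounds for the origin and for rational directions\<close>

text \<open>With multiplier 0 the direction is immaterial: height v + 1/e <= 2/e against error e, up
  to constants.\<close>

lemma approx_exp_zero_ge:
  fixes x :: "real^2"
  assumes x: "x $ 2 \<noteq> 0" "slope x \<notin> \<rat>"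
  shows "1 \<le> approx_exp x 0"
proof -
  define \<xi> where "\<xi> = slope x"
  obtain C where C: "C > 0"
    "\<And>v u y0. coprime v u \<Longrightarrow> 0 < v \<Longrightarrow> \<bar>lform \<xi> v u\<bar> \<le> 1 \<Longrightarrow>
      \<exists>\<gamma>\<in>SL2Z. mat_act \<gamma> x \<noteq> y0
      \<and> mat_height \<gamma> \<le> C * (of_int v + \<bar>0\<bar> * of_int v / \<bar>lform \<xi> v u\<bar> + 1 / \<bar>lform \<xi> v u\<bar>)
      \<and> infnorm (mat_act \<gamma> x - vector [0 * of_int 1, 0 * of_int 0]) \<le> C * \<bar>lform \<xi> v u\<bar>"
    unfolding \<xi>_def using exists_approx_fixed_direction[OF x, of 1 0 0] by (metis coprime_1_left)
  have [simp]: "vector [0, 0] = (0 :: real^2)" by (simp add: vec_eq_iff forall_2)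
  have "ereal (1 / 1) \<le> approx_exp x 0"
  proof (rule approx_exp_ge[of 1 1 "2 * C"])
    fix R :: real
    obtain v u where vu: "coprime v u" "0 < v" "\<bar>lform \<xi> v u\<bar> \<le> 1" "R \<le> 1 / \<bar>lform \<xi> v u\<bar>"
        "of_int v \<le> 1 / \<bar>lform \<xi> v u\<bar>"
      using exists_small_lform[of \<xi> R] x(2) unfolding \<xi>_def by metis
    define B where "B = 1 / \<bar>lform \<xi> v u\<bar>"
    have B: "B \<ge> R" "B > 0" "of_int v \<le> B" "\<bar>lform \<xi> v u\<bar> = 1 / B"
      using vu lform_nonzero[of \<xi> v u] x(2) by (auto simp: B_def \<xi>_def)
    obtain \<gamma> where \<gamma>: "\<gamma> \<in> SL2Z" "mat_act \<gamma> x \<noteq> 0" "mat_height \<gamma> \<le> C * (of_int v + B)"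
        "infnorm (mat_act \<gamma> x - 0) \<le> C * (1 / B)"
      using C(2)[OF vu(1-3), of 0] B by auto
    have "C * (of_int v + B) \<le> 2 * C * B powr 1" "C * (1 / B) \<le> 2 * C * B powr (- 1)"
      using B C(1) by (simp_all add: powr_minus field_simps)
    with \<gamma> B(1) show "\<exists>B\<ge>R. \<exists>\<gamma>\<in>SL2Z. mat_act \<gamma> x \<noteq> 0 \<and> mat_height \<gamma> \<le> 2 * C * B powr 1
        \<and> infnorm (mat_act \<gamma> x - 0) \<le> 2 * C * B powr (- 1)"
      by (intro exI[of _ B] conjI bexI[of _ \<gamma>]) auto
  qed (use C in auto)
  then show ?thesis by (simp add: one_ereal_def)
qed

text \<open>With B = 1/e the height is of order V B and the error of order 1/B; e <= V^(-w) gives V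
  <= B^(1/w), hence height at most of order B^(1 + 1/w).\<close>

lemma approx_exp_rational_ge:
  fixes x :: "real^2"
  assumes x: "x $ 2 \<noteq> 0" "slope x \<notin> \<rat>" and pq: "coprime p q"
    and w: "0 < w" "ereal w < irr_measure (slope x)"
  shows "ereal (w / (w + 1)) \<le> approx_exp x (vector [l * of_int p, l * of_int q])"
proof -
  define \<xi> where "\<xi> = slope x"
  define y :: "real^2" where "y = vector [l * of_int p, l * of_int q]"
  obtain C where C: "C > 0"
    "\<And>v u y0. coprime v u \<Longrightarrow> 0 < v \<Longrightarrow> \<bar>lform \<xi> v u\<bar> \<le> 1 \<Longrightarrow>
      \<exists>\<gamma>\<in>SL2Z. mat_act \<gamma> x \<noteq> y0
      \<and> mat_height \<gamma> \<le> C * (of_int v + \<bar>l\<bar> * of_int v / \<bar>lform \<xi> v u\<bar> + 1 / \<bar>lform \<xi> v u\<bar>)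
      \<and> infnorm (mat_act \<gamma> x - y) \<le> C * \<bar>lform \<xi> v u\<bar>"
    unfolding \<xi>_def y_def using exists_approx_fixed_direction[OF x pq, of l] by metis
  define K where "K = C * (2 + \<bar>l\<bar>)"
  have "C * 1 \<le> K" unfolding K_def using C(1) by (intro mult_left_mono) auto
  then have "K > 0" "C \<le> K" using C(1) by auto
  have "ereal (1 / (1 + 1 / w)) \<le> approx_exp x y"
  proof (rule approx_exp_ge[of "1 + 1 / w" 1 K])
    fix R :: real
    \<comment> \<open>Chosen so that V >= R' forces V^w >= R, and therefore B >= R.\<close>
    define R' where "R' = max 1 ((max R 1) powr (1 / w))"
    obtain v u where vu: "coprime v u" "0 < v" "R' \<le> of_int v" "\<bar>lform \<xi> v u\<bar> \<le> of_int v powr (- w)"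
      using less_irr_measure_imp[of \<xi> w R'] x w unfolding \<xi>_def by metis
    define V where "V = real_of_int v"
    have "1 \<le> V" "max R 1 powr (1 / w) \<le> V" using vu by (auto simp: R'_def V_def)
    have "R \<le> V powr w"
    proof -
      have "R \<le> (max R 1 powr (1 / w)) powr w" using w by (simp add: powr_powr)
      also have "\<dots> \<le> V powr w" using \<open>max R 1 powr (1 / w) \<le> V\<close> w by (intro powr_mono2) auto
      finally show ?thesis .
    qed
    \<comment> \<open>The inverse form value, not V^w: the form may be far below V^(-w), and height
      and error both follow its true size.\<close>
    define B where "B = 1 / \<bar>lform \<xi> v u\<bar>"
    have e: "\<bar>lform \<xi> v u\<bar> > 0" using vu lform_nonzero[of \<xi> v u] x(2) by (auto simp: \<xi>_def)
    have VB: "V powr w \<le> B"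
      using vu(4) e \<open>1 \<le> V\<close> by (simp add: B_def V_def[symmetric] powr_minus field_simps)
    have "1 \<le> V powr w" using \<open>1 \<le> V\<close> w by (intro ge_one_powr_ge_zero) auto
    then have B: "B \<ge> R" "B \<ge> 1" "\<bar>lform \<xi> v u\<bar> = 1 / B" 
      using VB \<open>R \<le> V powr w\<close> by (auto simp: B_def)
    have e1: "\<bar>lform \<xi> v u\<bar> \<le> 1" using B(2) unfolding B(3) by simp
    have "V = (V powr w) powr (1 / w)" using w \<open>1 \<le> V\<close> by (simp add: powr_powr)
    also have "\<dots> \<le> B powr (1 / w)" using VB w by (intro powr_mono2) auto
    finally have V: "V \<le> B powr (1 / w)" .
    obtain \<gamma> where \<gamma>: "\<gamma> \<in> SL2Z" "mat_act \<gamma> x \<noteq> y" "mat_height \<gamma> \<le> C * (V + \<bar>l\<bar> * V * B + B)"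
        "infnorm (mat_act \<gamma> x - y) \<le> C * (1 / B)"
      using C(2)[OF vu(1,2) e1, of y] B(3) unfolding V_def by auto
    have "V \<le> V * B" "B \<le> V * B"
      using \<open>1 \<le> V\<close> \<open>B \<ge> 1\<close> by (simp_all add: mult_le_cancel_left1 mult_le_cancel_right1)
    then have "C * (V + \<bar>l\<bar> * V * B + B) \<le> C * ((2 + \<bar>l\<bar>) * (V * B))"
      using C(1) by (intro mult_left_mono) (auto simp: algebra_simps)
    also have "\<dots> = K * (V * B)" by (simp add: K_def)
    also have "\<dots> \<le> K * (B powr (1 / w) * B)"
      using V \<open>K > 0\<close> \<open>B \<ge> 1\<close> by (intro mult_left_mono mult_right_mono) auto
    also have "\<dots> = K * B powr (1 + 1 / w)" using \<open>B \<ge> 1\<close> by (simp add: powr_add)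
    finally have "mat_height \<gamma> \<le> K * B powr (1 + 1 / w)" using \<gamma> by simp
    moreover have "C * (1 / B) \<le> K * B powr (- 1)"
      using \<open>C \<le> K\<close> \<open>B \<ge> 1\<close> by (simp add: powr_minus inverse_eq_divide divide_right_mono)
    ultimately show "\<exists>B\<ge>R. \<exists>\<gamma>\<in>SL2Z. mat_act \<gamma> x \<noteq> y \<and> mat_height \<gamma> \<le> K * B powr (1 + 1 / w)
        \<and> infnorm (mat_act \<gamma> x - y) \<le> K * B powr (- 1)"
      using \<gamma> B(1) by (intro exI[of _ B] conjI bexI[of _ \<gamma>]) auto
  qed (use w \<open>K > 0\<close> in \<open>auto intro: add_pos_pos\<close>)
  moreover have "1 / (1 + 1 / w) = w / (w + 1)" using w by (simp add: field_simps)
  ultimately show ?thesis by (simp add: y_def)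
qed

text \<open>For uniform statements a form must be neither too large nor too small for the given
  \<open>Q\<close>: Dirichlet bounds it above by 2/Q, the irrationality measure below by a multiple
  of v^(-w) >= Q^(-w).\<close>

lemma exists_lform_of_finite_irr_measure:
  assumes \<xi>: "\<xi> \<notin> \<rat>" and w: "irr_measure \<xi> < ereal w"
  obtains c where "c > 0"
    "\<And>Q. Q \<ge> 2 \<Longrightarrow> \<exists>v u. coprime v u \<and> 0 < v \<and> of_int v \<le> Q \<and> \<bar>lform \<xi> v u\<bar> \<le> 2 / Q
       \<and> of_int v * \<bar>lform \<xi> v u\<bar> \<le> 1 \<and> c * of_int v powr (- w) \<le> \<bar>lform \<xi> v u\<bar>
       \<and> 1 / \<bar>lform \<xi> v u\<bar> \<le> 1 / c * Q powr w"
proof -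
  have "1 < ereal w" using irr_measure_ge_1[OF \<xi>] w by (rule le_less_trans)
  then have "w > 0" by (simp add: one_ereal_def)
  obtain c where c: "c > 0" "\<And>v u. v \<noteq> 0 \<Longrightarrow> c * \<bar>of_int v\<bar> powr (- w) \<le> \<bar>lform \<xi> v u\<bar>"
    using irr_measure_less_imp[OF \<xi> w] by (elim exE conjE) blast
  have "\<exists>v u. coprime v u \<and> 0 < v \<and> of_int v \<le> Q \<and> \<bar>lform \<xi> v u\<bar> \<le> 2 / Q
       \<and> of_int v * \<bar>lform \<xi> v u\<bar> \<le> 1 \<and> c * of_int v powr (- w) \<le> \<bar>lform \<xi> v u\<bar>
       \<and> 1 / \<bar>lform \<xi> v u\<bar> \<le> 1 / c * Q powr w" if "Q \<ge> 2" for Q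
  proof -
    have "Q \<ge> 1" using that by simp
    obtain v u where vu: "coprime v u" "0 < v" "of_int v \<le> Q" "\<bar>lform \<xi> v u\<bar> \<le> 2 / Q"
        "of_int v * \<bar>lform \<xi> v u\<bar> \<le> 1"
      using Dirichlet_lform_real[OF \<open>Q \<ge> 1\<close>] by metis
    have 1: "c * of_int v powr (- w) \<le> \<bar>lform \<xi> v u\<bar>" using c(2)[of v u] vu by simp
    have "c * Q powr (- w) \<le> c * of_int v powr (- w)"
      using c(1) vu \<open>w > 0\<close> by (intro mult_left_mono powr_mono2') auto
    then have 2: "c * Q powr (- w) \<le> \<bar>lform \<xi> v u\<bar>" using 1 by simp
    have "0 < c * Q powr (- w)" using c(1) that by simp
    then have "1 / \<bar>lform \<xi> v u\<bar> \<le> 1 / (c * Q powr (- w))" using 2 by (intro frac_le) auto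
    also have "\<dots> = 1 / c * Q powr w" by (simp add: powr_minus field_simps)
    finally show ?thesis using vu 1 by blast
  qed
  with c(1) show ?thesis by (rule that)
qed

text \<open>Height of order 1/e, at most of order Q^w, against error of order 1/Q.\<close>

lemma unif_approx_exp_zero_ge:
  fixes x :: "real^2"
  assumes x: "x $ 2 \<noteq> 0" "slope x \<notin> \<rat>" and w: "irr_measure (slope x) < ereal w" "0 < w"
  shows "ereal (1 / w) \<le> unif_approx_exp x 0"
proof -
  define \<xi> where "\<xi> = slope x"
  obtain C where C: "C > 0"
    "\<And>v u y0. coprime v u \<Longrightarrow> 0 < v \<Longrightarrow> \<bar>lform \<xi> v u\<bar> \<le> 1 \<Longrightarrow>
      \<exists>\<gamma>\<in>SL2Z. mat_act \<gamma> x \<noteq> y0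
      \<and> mat_height \<gamma> \<le> C * (of_int v + \<bar>0\<bar> * of_int v / \<bar>lform \<xi> v u\<bar> + 1 / \<bar>lform \<xi> v u\<bar>)
      \<and> infnorm (mat_act \<gamma> x - vector [0 * of_int 1, 0 * of_int 0]) \<le> C * \<bar>lform \<xi> v u\<bar>"
    unfolding \<xi>_def using exists_approx_fixed_direction[OF x, of 1 0 0] by (metis coprime_1_left)
  have [simp]: "vector [0, 0] = (0 :: real^2)" by (simp add: vec_eq_iff forall_2)
  obtain c where c: "c > 0" 
    "\<And>Q. Q \<ge> 2 \<Longrightarrow> \<exists>v u. coprime v u \<and> 0 < v \<and> of_int v \<le> Q \<and> \<bar>lform \<xi> v u\<bar> \<le> 2 / Q
       \<and> of_int v * \<bar>lform \<xi> v u\<bar> \<le> 1 \<and> c * of_int v powr (- w) \<le> \<bar>lform \<xi> v u\<bar>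
       \<and> 1 / \<bar>lform \<xi> v u\<bar> \<le> 1 / c * Q powr w"
    using exists_lform_of_finite_irr_measure[of \<xi> w] x w unfolding \<xi>_def by blast
  define K where "K = max (2 * C) (2 * C / c)"
  show ?thesis
  proof (rule unif_approx_exp_ge[of w K])
    show "\<forall>\<^sub>F Q in at_top. \<exists>\<gamma>\<in>SL2Z. mat_height \<gamma> \<le> K * Q powr w
        \<and> infnorm (mat_act \<gamma> x - 0) \<le> K * Q powr (- 1)"
      using eventually_ge_at_top[of 2]
    proof eventually_elim
      case (elim Q)
      obtain v u where vu: "coprime v u" "0 < v" "of_int v \<le> Q" "\<bar>lform \<xi> v u\<bar> \<le> 2 / Q"
        "of_int v * \<bar>lform \<xi> v u\<bar> \<le> 1" "1 / \<bar>lform \<xi> v u\<bar> \<le> 1 / c * Q powr w"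
        using c(2)[OF elim] by blast
      have e: "\<bar>lform \<xi> v u\<bar> > 0" using vu lform_nonzero[of \<xi> v u] x(2) by (auto simp: \<xi>_def)
      have "2 / Q \<le> 1" using elim by simp
      then have e1: "\<bar>lform \<xi> v u\<bar> \<le> 1" using vu by linarith
      obtain \<gamma> where \<gamma>: "\<gamma> \<in> SL2Z" "mat_height \<gamma> \<le> C * (of_int v + 1 / \<bar>lform \<xi> v u\<bar>)"
        "infnorm (mat_act \<gamma> x - 0) \<le> C * \<bar>lform \<xi> v u\<bar>"
        using C(2)[OF vu(1,2) e1, of 0] by auto
      have "of_int v \<le> 1 / \<bar>lform \<xi> v u\<bar>" using vu(5) e by (simp add: field_simps)
      then have "C * (of_int v + 1 / \<bar>lform \<xi> v u\<bar>) \<le> C * (2 * (1 / c * Q powr w))"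
        using vu(6) C(1) by (intro mult_left_mono) auto
      also have "\<dots> = 2 * C / c * Q powr w" by simp
      also have "\<dots> \<le> K * Q powr w" unfolding K_def by (intro mult_right_mono) auto
      finally have 1: "mat_height \<gamma> \<le> K * Q powr w" using \<gamma> by simp
      have "C * \<bar>lform \<xi> v u\<bar> \<le> C * (2 / Q)" using C(1) vu by (intro mult_left_mono) auto
      also have "\<dots> = 2 * C * Q powr (- 1)" using elim by (simp add: powr_minus field_simps)
      also have "\<dots> \<le> K * Q powr (- 1)" unfolding K_def by (intro mult_right_mono) auto
      finally show ?case using 1 \<gamma> by (intro bexI[of _ \<gamma>]) auto
    qed
  qed (use w C(1) in \<open>auto simp: K_def\<close>)
qed

text \<open>The nonzero target multiplies the height by v <= Q, so Q^w becomes Q^(w+1) at the same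
  error 1/Q.\<close>

lemma unif_approx_exp_rational_ge:
  fixes x :: "real^2"
  assumes x: "x $ 2 \<noteq> 0" "slope x \<notin> \<rat>" and pq: "coprime p q"
    and w: "irr_measure (slope x) < ereal w" "0 < w"
  shows "ereal (1 / (w + 1)) \<le> unif_approx_exp x (vector [l * of_int p, l * of_int q])"
proof -
  define \<xi> where "\<xi> = slope x"
  define y :: "real^2" where "y = vector [l * of_int p, l * of_int q]"
  obtain C where C: "C > 0"
    "\<And>v u y0. coprime v u \<Longrightarrow> 0 < v \<Longrightarrow> \<bar>lform \<xi> v u\<bar> \<le> 1 \<Longrightarrow>
      \<exists>\<gamma>\<in>SL2Z. mat_act \<gamma> x \<noteq> y0
      \<and> mat_height \<gamma> \<le> C * (of_int v + \<bar>l\<bar> * of_int v / \<bar>lform \<xi> v u\<bar> + 1 / \<bar>lform \<xi> v u\<bar>)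
      \<and> infnorm (mat_act \<gamma> x - y) \<le> C * \<bar>lform \<xi> v u\<bar>"
    unfolding \<xi>_def y_def using exists_approx_fixed_direction[OF x pq, of l] by metis
  obtain c where c: "c > 0" 
    "\<And>Q. Q \<ge> 2 \<Longrightarrow> \<exists>v u. coprime v u \<and> 0 < v \<and> of_int v \<le> Q \<and> \<bar>lform \<xi> v u\<bar> \<le> 2 / Q
       \<and> of_int v * \<bar>lform \<xi> v u\<bar> \<le> 1 \<and> c * of_int v powr (- w) \<le> \<bar>lform \<xi> v u\<bar>
       \<and> 1 / \<bar>lform \<xi> v u\<bar> \<le> 1 / c * Q powr w"
    using exists_lform_of_finite_irr_measure[of \<xi> w] x w unfolding \<xi>_def by blast
  define K where "K = max (2 * C) ((2 + \<bar>l\<bar>) * C / c)"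
  show ?thesis unfolding y_def[symmetric]
  proof (rule unif_approx_exp_ge[of "w + 1" K])
    show "\<forall>\<^sub>F Q in at_top. \<exists>\<gamma>\<in>SL2Z. mat_height \<gamma> \<le> K * Q powr (w + 1)
        \<and> infnorm (mat_act \<gamma> x - y) \<le> K * Q powr (- 1)"
      using eventually_ge_at_top[of 2]
    proof eventually_elim
      case (elim Q)
      obtain v u where vu: "coprime v u" "0 < v" "of_int v \<le> Q" "\<bar>lform \<xi> v u\<bar> \<le> 2 / Q"
        "of_int v * \<bar>lform \<xi> v u\<bar> \<le> 1" "1 / \<bar>lform \<xi> v u\<bar> \<le> 1 / c * Q powr w"
        using c(2)[OF elim] by blast
      define V where "V = real_of_int v"
      define E where "E = 1 / \<bar>lform \<xi> v u\<bar>"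
      have e: "\<bar>lform \<xi> v u\<bar> > 0" using vu lform_nonzero[of \<xi> v u] x(2) by (auto simp: \<xi>_def)
      have "2 / Q \<le> 1" using elim by simp
      then have e1: "\<bar>lform \<xi> v u\<bar> \<le> 1" using vu by linarith
      obtain \<gamma> where \<gamma>: "\<gamma> \<in> SL2Z" "mat_height \<gamma> \<le> C * (V + \<bar>l\<bar> * V * E + E)"
        "infnorm (mat_act \<gamma> x - y) \<le> C * \<bar>lform \<xi> v u\<bar>"
        using C(2)[OF vu(1,2) e1, of 0] unfolding V_def E_def by auto
      have VE: "V \<ge> 1" "E \<ge> 1" "V \<le> Q" "E \<le> 1 / c * Q powr w"
        using vu e e1 by (auto simp: V_def E_def)
      then have "V \<le> V * E" "E \<le> V * E"
        by (simp_all add: mult_le_cancel_left1 mult_le_cancel_right1)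
      then have "C * (V + \<bar>l\<bar> * V * E + E) \<le> C * ((2 + \<bar>l\<bar>) * (V * E))"
        using C(1) by (intro mult_left_mono) (auto simp: algebra_simps)
      also have "\<dots> \<le> C * ((2 + \<bar>l\<bar>) * (Q * (1 / c * Q powr w)))"
        using VE C(1) elim by (intro mult_left_mono mult_mono) auto
      also have "\<dots> = (2 + \<bar>l\<bar>) * C / c * Q powr (w + 1)" using elim by (simp add: powr_add)
      also have "\<dots> \<le> K * Q powr (w + 1)" unfolding K_def by (intro mult_right_mono) auto
      finally have 1: "mat_height \<gamma> \<le> K * Q powr (w + 1)" using \<gamma> by simp
      have "C * \<bar>lform \<xi> v u\<bar> \<le> C * (2 / Q)" using C(1) vu by (intro mult_left_mono) auto
      also have "\<dots> = 2 * C * Q powr (- 1)" using elim by (simp add: powr_minus field_simps)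
      also have "\<dots> \<le> K * Q powr (- 1)" unfolding K_def by (intro mult_right_mono) auto
      finally show ?case using 1 \<gamma> by (intro bexI[of _ \<gamma>]) auto
    qed
  qed (use w C(1) in \<open>auto simp: K_def\<close>)
qed

section \<open>Upper bounds\<close>

text \<open>Eliminates xi between two forms. The right side is an integer: 1 for the rows of a
  unimodular matrix, and of size at least 1 for any two independent integer rows.\<close>

lemma cross_lform: "of_int a * lform \<xi> c d - of_int c * lform \<xi> a b = of_int (a * d - b * c)"
  by (simp add: algebra_simps)

lemma exists_large_height:
  assumes "infinite S"
  obtains \<gamma> where "\<gamma> \<in> S" "R < mat_height \<gamma>"
proof -
  have "\<not> S \<subseteq> {\<gamma>. mat_height \<gamma> \<le> R}"
    using finite_subset[OF _ finite_bounded_height] assms by metis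
  then obtain \<gamma> where "\<gamma> \<in> S" "\<not> mat_height \<gamma> \<le> R" by blast
  then show ?thesis using that by (simp add: not_le)
qed

text \<open>If both forms of a matrix of height H are of order H^(-m), the determinant identity
  gives 1 <= const * H^(1-m).\<close>

lemma approx_exp_zero_le:
  fixes x :: "real^2"
  assumes x: "x $ 2 \<noteq> 0"
  shows "approx_exp x 0 \<le> 1"
  unfolding approx_exp_def
proof (rule Sup_least)
  fix z assume "z \<in> {ereal m |m. infinite {\<gamma> \<in> SL2Z. infnorm (mat_act \<gamma> x - 0) \<le> mat_height \<gamma> powr - m}}"
  then obtain m where z: "z = ereal m"
    and inf: "infinite {\<gamma> \<in> SL2Z. infnorm (mat_act \<gamma> x - 0) \<le> mat_height \<gamma> powr - m}" (is "infinite ?S")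
    by blast
  define \<xi> where "\<xi> = slope x"
  define X where "X = \<bar>x $ 2\<bar>"
  have "X > 0" using x by (simp add: X_def)
  have "m \<le> 1"
  proof (rule powr_le_unbounded_imp_le[where C = "2 / X"])
    fix R :: real
    obtain \<gamma> where \<gamma>: "\<gamma> \<in> ?S" "R < mat_height \<gamma>"
      by (rule exists_large_height[OF inf, of R])
    define H where "H = mat_height \<gamma>"
    define e1 e2 where "e1 = lform \<xi> (\<gamma> $ 1 $ 1) (\<gamma> $ 1 $ 2)" "e2 = lform \<xi> (\<gamma> $ 2 $ 1) (\<gamma> $ 2 $ 2)"
    have "H \<ge> 1" using mat_height_ge_1[of \<gamma>] \<gamma> by (simp add: H_def)
    have "max (X * \<bar>e1\<bar>) (X * \<bar>e2\<bar>) \<le> H powr - m"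
      using \<gamma> by (simp add: infnorm_2' mat_act_nth[OF x] abs_mult e1_e2_def X_def \<xi>_def H_def)
    then have e: "\<bar>e1\<bar> \<le> H powr - m / X" "\<bar>e2\<bar> \<le> H powr - m / X"
      using \<open>X > 0\<close> by (simp_all add: field_simps)
    have "of_int (\<gamma> $ 1 $ 1) * e2 - of_int (\<gamma> $ 2 $ 1) * e1 = 1"
      using \<gamma> cross_lform[of "\<gamma> $ 1 $ 1" "\<gamma> $ 2 $ 1" \<xi> "\<gamma> $ 2 $ 2" "\<gamma> $ 1 $ 2"]
      by (simp add: e1_e2_def SL2Z_iff)
    moreover have "\<bar>of_int (\<gamma> $ 1 $ 1) * e2 + of_int (- \<gamma> $ 2 $ 1) * e1\<bar> \<le> 2 * (H * (H powr - m / X))"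
      using e abs_entry_le_height[of \<gamma>] unfolding H_def[symmetric] by (intro abs_lincomb_le) auto
    ultimately have "1 \<le> 2 * (H * (H powr - m / X))" by simp
    then have "H powr m \<le> 2 / X * H powr 1"
      using \<open>H \<ge> 1\<close> \<open>X > 0\<close> by (simp add: powr_minus field_simps)
    then show "\<exists>A\<ge>R. A powr m \<le> 2 / X * A powr 1"
      using \<gamma> by (intro exI[of _ H]) (auto simp: H_def)
  qed
  then show "z \<le> 1" using z by (simp add: one_ereal_def)
qed

text \<open>A very good approximation (v,u) blocks smaller forms: a row with entries at most T,
  independent of (v,u), has a form of size at least 1/(2V) while T is below V^w/2. Comparing with
  T^(-m) gives V^(w m) <= const * V.\<close>

lemma unif_approx_exp_zero_bound:
  fixes x :: "real^2"
  assumes x: "x $ 2 \<noteq> 0" "slope x \<notin> \<rat>"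
    and w: "0 < w" "ereal w < irr_measure (slope x)" and "0 < m"
    and ev: "\<forall>\<^sub>F T in at_top. \<exists>\<gamma>\<in>SL2Z. mat_height \<gamma> \<le> T \<and> infnorm (mat_act \<gamma> x - 0) \<le> T powr (- m)"
  shows "w * m \<le> 1"
proof -
  define \<xi> where "\<xi> = slope x"
  define X where "X = \<bar>x $ 2\<bar>"
  have "X > 0" using x by (simp add: X_def)
  obtain T0 where T0: "\<And>T. T \<ge> T0 \<Longrightarrow> \<exists>\<gamma>\<in>SL2Z. mat_height \<gamma> \<le> T \<and> infnorm (mat_act \<gamma> x - 0) \<le> T powr (- m)"
    using ev unfolding eventually_at_top_linorder by blast
  have "filterlim (\<lambda>V. V powr w / 2) at_top at_top" using w(1) by real_asymp
  then have "\<forall>\<^sub>F V in at_top. T0 \<le> V powr w / 2" by (simp add: filterlim_at_top)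
  then obtain V0 where V0: "\<And>V. V \<ge> V0 \<Longrightarrow> T0 \<le> V powr w / 2" by (auto simp: eventually_at_top_linorder)
  show ?thesis
  proof (rule powr_le_unbounded_imp_le[where C = "2 / X * 2 powr m"])
    fix R :: real
    obtain v u where vu: "0 < v" "max R V0 \<le> of_int v" "\<bar>lform \<xi> v u\<bar> \<le> of_int v powr (- w)"
      using less_irr_measure_imp[of \<xi> w "max R V0"] x w unfolding \<xi>_def by metis
    \<comment> \<open>The largest T, up to a constant, for which T |e| <= 1/2, so that the term with
      \<open>e\<close> takes at most half of the determinant.\<close>
    define V e T where "V = real_of_int v" and "e = lform \<xi> v u" and "T = V powr w / 2"
    have "V \<ge> 1" using vu by (simp add: V_def)
    have "T > 0" using \<open>V \<ge> 1\<close> by (simp add: T_def)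
    have "T0 \<le> T" using V0 vu by (simp add: T_def V_def)
    then obtain \<gamma> where \<gamma>: "\<gamma> \<in> SL2Z" "mat_height \<gamma> \<le> T" "infnorm (mat_act \<gamma> x - 0) \<le> T powr (- m)"
      using T0 by metis
    have Te: "T * \<bar>e\<bar> \<le> 1 / 2"
    proof -
      have "T * \<bar>e\<bar> \<le> T * V powr (- w)" using vu \<open>T > 0\<close> by (intro mult_left_mono) (auto simp: e_def V_def)
      also have "\<dots> = 1 / 2" using \<open>V \<ge> 1\<close> by (simp add: T_def powr_minus)
      finally show ?thesis .
    qed
    have row: "X / (2 * V) \<le> T powr (- m)"
      if "\<bar>of_int a\<bar> \<le> T" "X * \<bar>lform \<xi> a b\<bar> \<le> T powr (- m)" "a * u - b * v \<noteq> 0" for a b :: int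
    proof -
      have "of_int a * e - V * lform \<xi> a b = of_int (a * u - b * v)"
        unfolding e_def V_def by (rule cross_lform)
      moreover have "1 \<le> \<bar>of_int (a * u - b * v) :: real\<bar>" using that(3) by linarith
      ultimately have "1 \<le> \<bar>of_int a * e\<bar> + \<bar>V * lform \<xi> a b\<bar>" by linarith
      also have "\<dots> \<le> T * \<bar>e\<bar> + V * \<bar>lform \<xi> a b\<bar>"
        using that(1) \<open>V \<ge> 1\<close> by (auto simp: abs_mult intro!: mult_right_mono)
      finally have "1 / 2 \<le> V * \<bar>lform \<xi> a b\<bar>" using Te by linarith
      then have "X * (1 / 2) \<le> X * (V * \<bar>lform \<xi> a b\<bar>)" using \<open>X > 0\<close> by (intro mult_left_mono) auto
      also have "\<dots> = V * (X * \<bar>lform \<xi> a b\<bar>)" by simp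
      also have "\<dots> \<le> V * T powr (- m)" using that(2) \<open>V \<ge> 1\<close> by (intro mult_left_mono) auto
      finally show ?thesis using \<open>V \<ge> 1\<close> by (simp add: field_simps)
    qed
    \<comment> \<open>Rows of determinant 1 cannot both be proportional to (v,u).\<close>
    have "\<gamma> $ 1 $ 1 * u - \<gamma> $ 1 $ 2 * v \<noteq> 0 \<or> \<gamma> $ 2 $ 1 * u - \<gamma> $ 2 $ 2 * v \<noteq> 0"
    proof (rule ccontr)
      assume "\<not> ?thesis"
      then have *: "\<gamma> $ 1 $ 1 * u = \<gamma> $ 1 $ 2 * v" "\<gamma> $ 2 $ 1 * u = \<gamma> $ 2 $ 2 * v" by simp_all
      have "v * (\<gamma> $ 1 $ 1 * \<gamma> $ 2 $ 2 - \<gamma> $ 1 $ 2 * \<gamma> $ 2 $ 1)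
          = \<gamma> $ 1 $ 1 * (\<gamma> $ 2 $ 2 * v) - (\<gamma> $ 1 $ 2 * v) * \<gamma> $ 2 $ 1" by (simp add: algebra_simps)
      also have "\<dots> = 0" unfolding *[symmetric] by simp
      finally show False using \<gamma>(1) vu(1) by (simp add: SL2Z_iff)
    qed
    moreover have "max (X * \<bar>lform \<xi> (\<gamma> $ 1 $ 1) (\<gamma> $ 1 $ 2)\<bar>) (X * \<bar>lform \<xi> (\<gamma> $ 2 $ 1) (\<gamma> $ 2 $ 2)\<bar>) \<le> T powr - m"
      using \<gamma>(3) by (simp add: infnorm_2' mat_act_nth[OF x(1)] abs_mult X_def \<xi>_def)
    moreover have "\<bar>of_int (\<gamma> $ 1 $ 1)\<bar> \<le> T" "\<bar>of_int (\<gamma> $ 2 $ 1)\<bar> \<le> T"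
      using \<gamma>(2) by (simp_all add: mat_height_le_iff)
    ultimately have "X / (2 * V) \<le> T powr (- m)"
      using row[of "\<gamma> $ 1 $ 1" "\<gamma> $ 1 $ 2"] row[of "\<gamma> $ 2 $ 1" "\<gamma> $ 2 $ 2"] by auto
    also have "T powr (- m) = 2 powr m * V powr (- (w * m))"
      using \<open>V \<ge> 1\<close> by (simp add: T_def powr_divide powr_powr powr_minus field_simps)
    finally have "V powr (w * m) \<le> 2 / X * 2 powr m * V powr 1"
      using \<open>V \<ge> 1\<close> \<open>X > 0\<close> by (simp add: powr_minus field_simps)
    then show "\<exists>A\<ge>R. A powr (w * m) \<le> 2 / X * 2 powr m * A powr 1"
      using vu by (intro exI[of _ V]) (auto simp: V_def)
  qed
qed

text \<open>The rows of \<open>N\<inverse> ** \<gamma>\<close>, where \<open>N\<close> is a unimodular matrix with first column \<open>(p, q)\<close>.\<close>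

lemma exists_reduced_rows:
  fixes x :: "real^2"
  assumes x: "x $ 2 \<noteq> 0" and "coprime p q"
  obtains C where "C > 0" "\<And>\<gamma>. \<gamma> \<in> SL2Z \<Longrightarrow> \<exists>v1 u1 v2 u2. v1 * u2 - u1 * v2 = 1
    \<and> \<bar>of_int v1\<bar> \<le> C * mat_height \<gamma>
    \<and> \<bar>x $ 2 * lform (slope x) v1 u1 - l\<bar> \<le> C * infnorm (mat_act \<gamma> x - vector [l * of_int p, l * of_int q])
    \<and> \<bar>x $ 2 * lform (slope x) v2 u2\<bar> \<le> C * infnorm (mat_act \<gamma> x - vector [l * of_int p, l * of_int q])"
proof -
  define S where "S = real_of_int (max \<bar>p\<bar> \<bar>q\<bar>)"
  have "p \<noteq> 0 \<or> q \<noteq> 0" using assms by auto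
  then have "S > 0" unfolding S_def by auto
  obtain r s where rs: "p * s - q * r = 1" "\<bar>r\<bar> \<le> max \<bar>p\<bar> \<bar>q\<bar>" "\<bar>s\<bar> \<le> max \<bar>p\<bar> \<bar>q\<bar>"
    using primitive_row_completion[OF assms(2)] by metis
  have S: "\<bar>of_int p\<bar> \<le> S" "\<bar>- of_int q\<bar> \<le> S" "\<bar>- of_int r\<bar> \<le> S" "\<bar>of_int s\<bar> \<le> S"
    using rs unfolding S_def by linarith+
  show ?thesis
  proof (rule that[of "2 * S"])
    fix \<gamma> assume \<gamma>: "\<gamma> \<in> SL2Z"
    define d where "d = mat_act \<gamma> x - vector [l * of_int p, l * of_int q]"
    have d: "\<bar>d $ 1\<bar> \<le> infnorm d" "\<bar>d $ 2\<bar> \<le> infnorm d" by (simp_all add: infnorm_2')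
    define v1 u1 v2 u2 where "v1 = s * \<gamma> $ 1 $ 1 - r * \<gamma> $ 2 $ 1" and "u1 = s * \<gamma> $ 1 $ 2 - r * \<gamma> $ 2 $ 2"
      and "v2 = p * \<gamma> $ 2 $ 1 - q * \<gamma> $ 1 $ 1" and "u2 = p * \<gamma> $ 2 $ 2 - q * \<gamma> $ 1 $ 2"
    note defs = this
    have "v1 * u2 - u1 * v2 = (p * s - q * r) * (\<gamma> $ 1 $ 1 * \<gamma> $ 2 $ 2 - \<gamma> $ 1 $ 2 * \<gamma> $ 2 $ 1)"
      by (simp add: defs algebra_simps)
    then have 1: "v1 * u2 - u1 * v2 = 1" using \<gamma> rs(1) by (simp add: SL2Z_iff)
    have "\<bar>of_int s * of_int (\<gamma> $ 1 $ 1) + - of_int r * of_int (\<gamma> $ 2 $ 1)\<bar> \<le> 2 * (S * mat_height \<gamma>)"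
      by (intro abs_lincomb_le S abs_entry_le_height)
    then have 2: "\<bar>of_int v1\<bar> \<le> 2 * S * mat_height \<gamma>" by (simp add: defs)
    \<comment> \<open>The inverse matrix carries (l p, l q) to (l, 0), so the reduced forms are
      compared with l and with 0.\<close>
    have "l = l * of_int (p * s - q * r)" using rs by simp
    then have "x $ 2 * lform (slope x) v1 u1 - l = of_int s * d $ 1 + - of_int r * d $ 2"
      by (simp add: d_def mat_act_nth[OF x] defs algebra_simps)
    then have 3: "\<bar>x $ 2 * lform (slope x) v1 u1 - l\<bar> \<le> 2 * S * infnorm d"
      using abs_lincomb_le[OF S(4) d(1) S(3) d(2)] by simp
    have "x $ 2 * lform (slope x) v2 u2 = of_int p * d $ 2 + - of_int q * d $ 1"
      by (simp add: d_def mat_act_nth[OF x] defs algebra_simps)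
    then have 4: "\<bar>x $ 2 * lform (slope x) v2 u2\<bar> \<le> 2 * S * infnorm d"
      using abs_lincomb_le[OF S(1) d(2) S(2) d(1)] by simp
    from 1 2 3 4 show "\<exists>v1 u1 v2 u2. v1 * u2 - u1 * v2 = 1 \<and> \<bar>of_int v1\<bar> \<le> 2 * S * mat_height \<gamma>
      \<and> \<bar>x $ 2 * lform (slope x) v1 u1 - l\<bar> \<le> 2 * S * infnorm (mat_act \<gamma> x - vector [l * of_int p, l * of_int q])
      \<and> \<bar>x $ 2 * lform (slope x) v2 u2\<bar> \<le> 2 * S * infnorm (mat_act \<gamma> x - vector [l * of_int p, l * of_int q])"
      unfolding d_def by blast
  qed (use \<open>S > 0\<close> in simp)
qed

text \<open>The second reduced row is the wanted approximation to the slope. The first has its form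
  near l/x_2, bounded away from 0, so the determinant identity bounds |v2| by a multiple of 1 + H *
  H^(-m).\<close>

lemma infinite_approx_rational_imp:
  fixes x :: "real^2"
  assumes x: "x $ 2 \<noteq> 0" and pq: "coprime p q" and "l \<noteq> 0" "0 < m"
    and inf: "infinite {\<gamma> \<in> SL2Z. infnorm (mat_act \<gamma> x - vector [l * of_int p, l * of_int q])
        \<le> mat_height \<gamma> powr (- m)}"
  shows "\<exists>K>0. \<forall>R. \<exists>H v u. R \<le> H \<and> 1 \<le> H \<and> v \<noteq> 0
    \<and> \<bar>of_int v\<bar> \<le> K * (1 + H powr (1 - m)) \<and> \<bar>lform (slope x) v u\<bar> \<le> K * H powr (- m)"
proof -
  define \<xi> where "\<xi> = slope x"
  define X where "X = \<bar>x $ 2\<bar>"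
  have "X > 0" using x by (simp add: X_def)
  define y :: "real^2" where "y = vector [l * of_int p, l * of_int q]"
  obtain C where C: "C > 0" "\<And>\<gamma>. \<gamma> \<in> SL2Z \<Longrightarrow> \<exists>v1 u1 v2 u2. v1 * u2 - u1 * v2 = 1
    \<and> \<bar>of_int v1\<bar> \<le> C * mat_height \<gamma> \<and> \<bar>x $ 2 * lform \<xi> v1 u1 - l\<bar> \<le> C * infnorm (mat_act \<gamma> x - y)
    \<and> \<bar>x $ 2 * lform \<xi> v2 u2\<bar> \<le> C * infnorm (mat_act \<gamma> x - y)"
    using exists_reduced_rows[OF x pq, of l] unfolding y_def \<xi>_def by metis
  \<comment> \<open>Half of |l|/X, the limiting absolute value of the first reduced form.\<close>
  define L where "L = \<bar>l\<bar> / (2 * X)"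
  have "L > 0" using \<open>l \<noteq> 0\<close> \<open>X > 0\<close> by (simp add: L_def)
  define K where "K = max (C / X) ((1 + C * C / X) / L)"
  have "\<forall>\<^sub>F H in at_top. C * H powr (- m) < min (\<bar>l\<bar> / 2) X"
  proof -
    have "0 < min (\<bar>l\<bar> / 2) X" using \<open>l \<noteq> 0\<close> \<open>X > 0\<close> by simp
    with C(1) \<open>0 < m\<close> show ?thesis by real_asymp
  qed
  then obtain H0 where H0: "\<And>H. H \<ge> H0 \<Longrightarrow> C * H powr (- m) < min (\<bar>l\<bar> / 2) X"
    by (auto simp: eventually_at_top_linorder)
  show ?thesis
  proof (rule exI[of _ K], intro conjI allI)
    show "K > 0" using C(1) \<open>X > 0\<close> by (simp add: K_def less_max_iff_disj)
    fix R
    obtain \<gamma> where \<gamma>: "\<gamma> \<in> SL2Z" "infnorm (mat_act \<gamma> x - y) \<le> mat_height \<gamma> powr (- m)" "max R H0 < mat_height \<gamma>"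
      using exists_large_height[OF inf, of "max R H0"] unfolding y_def by blast
    define H where "H = mat_height \<gamma>"
    have H: "H \<ge> 1" "R \<le> H" "C * H powr (- m) < \<bar>l\<bar> / 2" "C * H powr (- m) < X"
      using mat_height_ge_1[OF \<gamma>(1)] \<gamma>(3) H0[of H] by (auto simp: H_def)
    obtain v1 u1 v2 u2 where r: "v1 * u2 - u1 * v2 = 1" "\<bar>of_int v1\<bar> \<le> C * H"
      "\<bar>x $ 2 * lform \<xi> v1 u1 - l\<bar> \<le> C * infnorm (mat_act \<gamma> x - y)"
      "\<bar>x $ 2 * lform \<xi> v2 u2\<bar> \<le> C * infnorm (mat_act \<gamma> x - y)"
      using C(2)[OF \<gamma>(1)] unfolding H_def by blast
    have "C * infnorm (mat_act \<gamma> x - y) \<le> C * H powr (- m)"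
      using \<gamma>(2) C(1) by (simp add: H_def)
    with r have r34: "\<bar>x $ 2 * lform \<xi> v1 u1 - l\<bar> \<le> C * H powr (- m)" "X * \<bar>lform \<xi> v2 u2\<bar> \<le> C * H powr (- m)"
      by (auto simp: X_def abs_mult)
    \<comment> \<open>Otherwise the determinant forces u2 = 1 or -1, a form of absolute value 1,
      which H is large enough to exclude.\<close>
    have "v2 \<noteq> 0"
    proof
      assume "v2 = 0"
      with r(1) have "\<bar>u2\<bar> = 1" by (simp add: zmult_eq_1_iff) auto
      then have "\<bar>real_of_int u2\<bar> = 1" by linarith
      with \<open>v2 = 0\<close> r34(2) H(4) show False by simp
    qed
    have "\<bar>l\<bar> / 2 \<le> \<bar>x $ 2 * lform \<xi> v1 u1\<bar>" using r34(1) H(3) by linarith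
    then have "\<bar>l\<bar> / 2 \<le> X * \<bar>lform \<xi> v1 u1\<bar>" by (simp only: abs_mult X_def)
    then have "L \<le> \<bar>lform \<xi> v1 u1\<bar>" using \<open>X > 0\<close> by (simp add: L_def pos_divide_le_eq mult_ac)
    have e2: "\<bar>lform \<xi> v2 u2\<bar> \<le> C / X * H powr (- m)" using r34(2) \<open>X > 0\<close> by (simp add: field_simps)
    have "of_int v1 * lform \<xi> v2 u2 - of_int v2 * lform \<xi> v1 u1 = 1"
      using r(1) cross_lform[of v1 v2 \<xi> u2 u1] by simp
    then have "\<bar>of_int v2 * lform \<xi> v1 u1\<bar> \<le> 1 + \<bar>of_int v1 * lform \<xi> v2 u2\<bar>" by linarith
    then have "\<bar>of_int v2\<bar> * \<bar>lform \<xi> v1 u1\<bar> \<le> 1 + \<bar>of_int v1\<bar> * \<bar>lform \<xi> v2 u2\<bar>" by (simp add: abs_mult)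
    also have "\<dots> \<le> 1 + (C * H) * (C / X * H powr (- m))"
      using r(2) e2 by (intro add_left_mono mult_mono) auto
    also have "\<dots> = 1 + C * C / X * H powr (1 - m)" using H(1) by (simp add: powr_diff powr_minus field_simps)
    also have "\<dots> \<le> (1 + C * C / X) * (1 + H powr (1 - m))"
      using C(1) \<open>X > 0\<close> by (simp add: algebra_simps)
    finally have "\<bar>of_int v2\<bar> * L \<le> (1 + C * C / X) * (1 + H powr (1 - m))"
      using mult_left_mono[OF \<open>L \<le> \<bar>lform \<xi> v1 u1\<bar>\<close>, of "\<bar>of_int v2\<bar>"] by linarith
    then have "\<bar>of_int v2\<bar> \<le> (1 + C * C / X) / L * (1 + H powr (1 - m))"
      using \<open>L > 0\<close> by (simp add: field_simps)
    also have "\<dots> \<le> K * (1 + H powr (1 - m))"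
      unfolding K_def by (intro mult_right_mono) (auto intro: add_nonneg_nonneg)
    finally have "\<bar>of_int v2\<bar> \<le> K * (1 + H powr (1 - m))" .
    moreover have "C / X * H powr (- m) \<le> K * H powr (- m)"
      unfolding K_def by (intro mult_right_mono) auto
    ultimately show "\<exists>H v u. R \<le> H \<and> 1 \<le> H \<and> v \<noteq> 0
      \<and> \<bar>of_int v\<bar> \<le> K * (1 + H powr (1 - m)) \<and> \<bar>lform (slope x) v u\<bar> \<le> K * H powr (- m)"
      using H(1,2) \<open>v2 \<noteq> 0\<close> e2 unfolding \<xi>_def by (intro exI[of _ H] exI[of _ v2] exI[of _ u2]) auto
  qed
qed

text \<open>The forms tend to 0, so the coefficients are unbounded; this is impossible if m >= 1,
  where they stay below 2K. For m < 1 the bound V <= 2K H^(1-m) rewrites H^(-m) as a power of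
  V.\<close>

lemma approx_exp_rational_bound:
  fixes x :: "real^2"
  assumes x: "x $ 2 \<noteq> 0" "slope x \<notin> \<rat>" and pq: "coprime p q" and "l \<noteq> 0" "0 < m"
    and inf: "infinite {\<gamma> \<in> SL2Z. infnorm (mat_act \<gamma> x - vector [l * of_int p, l * of_int q])
        \<le> mat_height \<gamma> powr (- m)}"
  shows "m < 1 \<and> ereal (m / (1 - m)) \<le> irr_measure (slope x)"
proof -
  define \<xi> where "\<xi> = slope x"
  obtain K where K: "K > 0" "\<forall>R. \<exists>H v u. R \<le> H \<and> 1 \<le> H \<and> v \<noteq> 0
    \<and> \<bar>of_int v\<bar> \<le> K * (1 + H powr (1 - m)) \<and> \<bar>lform \<xi> v u\<bar> \<le> K * H powr (- m)"
    using infinite_approx_rational_imp[OF x(1) pq assms(4-6), folded \<xi>_def] by blast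
  have large: "\<exists>H v u. 1 \<le> H \<and> R < \<bar>of_int v\<bar> \<and> \<bar>of_int v\<bar> \<le> K * (1 + H powr (1 - m))
      \<and> \<bar>lform \<xi> v u\<bar> \<le> K * H powr (- m)" for R :: real
  proof -
    obtain \<delta> where \<delta>: "\<delta> > 0" "\<forall>v u. v \<noteq> 0 \<longrightarrow> \<bar>of_int v\<bar> \<le> R \<longrightarrow> \<delta> \<le> \<bar>lform \<xi> v u\<bar>"
      using lform_bounded_away[of \<xi> R] x(2) unfolding \<xi>_def by blast
    have "\<forall>\<^sub>F H in at_top. K * H powr (- m) < \<delta>"
      using K(1) \<delta>(1) \<open>0 < m\<close> by real_asymp
    then obtain H0 where H0: "\<And>H. H \<ge> H0 \<Longrightarrow> K * H powr (- m) < \<delta>"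
      by (auto simp: eventually_at_top_linorder)
    obtain H v u where H: "H0 \<le> H" "1 \<le> H" "v \<noteq> 0" "\<bar>of_int v\<bar> \<le> K * (1 + H powr (1 - m))"
      "\<bar>lform \<xi> v u\<bar> \<le> K * H powr (- m)"
      using K(2) by blast
    have "\<not> \<delta> \<le> \<bar>lform \<xi> v u\<bar>" using H0[OF H(1)] H(5) by linarith
    then have "R < \<bar>of_int v\<bar>" using \<delta>(2) H(3) by (meson not_le)
    then show ?thesis using H by blast
  qed
  have "m < 1"
  proof (rule ccontr)
    assume "\<not> m < 1"
    obtain H v where H: "1 \<le> H" "K * 2 < \<bar>of_int v\<bar>" "\<bar>of_int v\<bar> \<le> K * (1 + H powr (1 - m))"
      using large[of "K * 2"] by blast
    have "H powr (1 - m) \<le> H powr 0" using H(1) \<open>\<not> m < 1\<close> by (intro powr_mono) auto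
    then have "K * (1 + H powr (1 - m)) \<le> K * 2" using K(1) H(1) by (intro mult_left_mono) auto
    with H show False by linarith
  qed
  \<comment> \<open>The exponent for which (H^(1-m))^(-k) = H^(-m).\<close>
  define k where "k = m / (1 - m)"
  have "k > 0" using \<open>m < 1\<close> \<open>0 < m\<close> by (simp add: k_def)
  have "ereal k \<le> irr_measure \<xi>"
  proof (rule irr_measure_ge[where C = "K * (1 / (2 * K)) powr (- k)"])
    fix R :: real
    obtain H v u where H: "1 \<le> H" "max R 1 < \<bar>of_int v\<bar>" "\<bar>of_int v\<bar> \<le> K * (1 + H powr (1 - m))"
      "\<bar>lform \<xi> v u\<bar> \<le> K * H powr (- m)"
      using large[of "max R 1"] by blast
    define V where "V = \<bar>real_of_int v\<bar>"
    have "1 \<le> H powr (1 - m)" using H(1) \<open>m < 1\<close> by (intro ge_one_powr_ge_zero) auto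
    then have "K * (1 + H powr (1 - m)) \<le> K * (2 * H powr (1 - m))" using K(1) by (intro mult_left_mono) auto
    then have "V \<le> K * (2 * H powr (1 - m))" using H(3) by (simp add: V_def)
    then have "V * (1 / (2 * K)) \<le> H powr (1 - m)" using K(1) by (simp add: field_simps)
    then have "(H powr (1 - m)) powr (- k) \<le> (V * (1 / (2 * K))) powr (- k)"
      using H(2) K(1) \<open>k > 0\<close> by (intro powr_mono2') (auto simp: V_def)
    also have "(H powr (1 - m)) powr (- k) = H powr (- m)"
      using \<open>m < 1\<close> by (simp add: powr_powr k_def)
    also have "(V * (1 / (2 * K))) powr (- k) = V powr (- k) * (1 / (2 * K)) powr (- k)"
      by (rule powr_mult)
    finally have "K * H powr (- m) \<le> K * (V powr (- k) * (1 / (2 * K)) powr (- k))"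
      using K(1) by (intro mult_left_mono) auto
    with H show "\<exists>v u. R \<le> \<bar>of_int v\<bar> \<and> \<bar>lform \<xi> v u\<bar> \<le> K * (1 / (2 * K)) powr (- k) * \<bar>of_int v\<bar> powr (- k)"
      by (intro exI[of _ v] exI[of _ u]) (auto simp: V_def mult_ac)
  qed
  with \<open>m < 1\<close> show ?thesis by (simp add: k_def \<xi>_def)
qed

text \<open>The argument for the origin with \<open>T\<close> larger by a factor of order V: T |e|
  is then only of order V, so entries bounded by T no longer suffice. Instead |v2| is bounded
  through the first reduced form, and (v2,u2) is compared with (v,u).\<close>

lemma unif_approx_exp_rational_bound:
  fixes x :: "real^2"
  assumes x: "x $ 2 \<noteq> 0" "slope x \<notin> \<rat>" and pq: "coprime p q" and "l \<noteq> 0"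
    and w: "0 < w" "ereal w < irr_measure (slope x)" and "0 < m"
    and ev: "\<forall>\<^sub>F T in at_top. \<exists>\<gamma>\<in>SL2Z. mat_height \<gamma> \<le> T
       \<and> infnorm (mat_act \<gamma> x - vector [l * of_int p, l * of_int q]) \<le> T powr (- m)"
  shows "(w + 1) * m \<le> 1"
proof -
  define \<xi> where "\<xi> = slope x"
  define X where "X = \<bar>x $ 2\<bar>"
  have "X > 0" using x by (simp add: X_def)
  define y :: "real^2" where "y = vector [l * of_int p, l * of_int q]"
  obtain C where C: "C > 0" "\<And>\<gamma>. \<gamma> \<in> SL2Z \<Longrightarrow> \<exists>v1 u1 v2 u2. v1 * u2 - u1 * v2 = 1
    \<and> \<bar>of_int v1\<bar> \<le> C * mat_height \<gamma> \<and> \<bar>x $ 2 * lform \<xi> v1 u1 - l\<bar> \<le> C * infnorm (mat_act \<gamma> x - y)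
    \<and> \<bar>x $ 2 * lform \<xi> v2 u2\<bar> \<le> C * infnorm (mat_act \<gamma> x - y)"
    using exists_reduced_rows[OF x(1) pq, of l] unfolding y_def \<xi>_def by metis
  define L where "L = \<bar>l\<bar> / (2 * X)"
  have "L > 0" using \<open>l \<noteq> 0\<close> \<open>X > 0\<close> by (simp add: L_def)
  \<comment> \<open>Gives C c = L/2, which turns the contribution of v2 e into at most V |e2|/2 plus
    a small term.\<close>
  define c where "c = L / (2 * C)"
  have "c > 0" using C(1) \<open>L > 0\<close> by (simp add: c_def)
  obtain T0 where T0: "\<And>T. T \<ge> T0 \<Longrightarrow> \<exists>\<gamma>\<in>SL2Z. mat_height \<gamma> \<le> T \<and> infnorm (mat_act \<gamma> x - y) \<le> T powr (- m)"
    using ev unfolding eventually_at_top_linorder y_def by blast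
  have "filterlim (\<lambda>V. c * V powr (w + 1)) at_top at_top" using w(1) \<open>c > 0\<close> by real_asymp
  then have 1: "\<forall>\<^sub>F V in at_top. T0 \<le> c * V powr (w + 1)" by (simp add: filterlim_at_top)
  have 2: "\<forall>\<^sub>F V in at_top. C * (c * V powr (w + 1)) powr (- m) < \<bar>l\<bar> / 2"
  proof -
    have "0 < \<bar>l\<bar> / 2" using \<open>l \<noteq> 0\<close> by simp
    with C(1) w(1) \<open>0 < m\<close> \<open>c > 0\<close> show ?thesis by real_asymp
  qed
  have 3: "\<forall>\<^sub>F V in at_top. V powr (- w) / L < 1 / 2"
    using w(1) \<open>L > 0\<close> by real_asymp
  have 4: "\<forall>\<^sub>F V in at_top. 2 / L < V"
    by (rule eventually_gt_at_top)
  have "\<forall>\<^sub>F V in at_top. T0 \<le> c * V powr (w + 1) \<and> C * (c * V powr (w + 1)) powr (- m) < \<bar>l\<bar> / 2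
      \<and> V powr (- w) / L < 1 / 2 \<and> 2 / L < V"
    using 1 2 3 4 by eventually_elim simp
  then obtain V0 where V0: "\<And>V. V \<ge> V0 \<Longrightarrow> T0 \<le> c * V powr (w + 1) \<and> C * (c * V powr (w + 1)) powr (- m) < \<bar>l\<bar> / 2
      \<and> V powr (- w) / L < 1 / 2 \<and> 2 / L < V"
    unfolding eventually_at_top_linorder by blast
  show ?thesis
  proof (rule powr_le_unbounded_imp_le[where C = "3 * C / X * c powr (- m)"])
    fix R :: real
    obtain v u where vu: "coprime v u" "0 < v" "max R V0 \<le> of_int v" "\<bar>lform \<xi> v u\<bar> \<le> of_int v powr (- w)"
      using less_irr_measure_imp[of \<xi> w "max R V0"] x w unfolding \<xi>_def by metis
    define V e T where "V = real_of_int v" and "e = lform \<xi> v u" and "T = c * V powr (w + 1)"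
    have "V \<ge> 1" using vu by (simp add: V_def)
    have "T > 0" using \<open>V \<ge> 1\<close> \<open>c > 0\<close> by (simp add: T_def)
    have V: "T0 \<le> T" "C * T powr (- m) < \<bar>l\<bar> / 2" "V powr (- w) / L < 1 / 2" "2 / L < V"
      using V0[of V] vu by (simp_all add: T_def V_def)
    obtain \<gamma> where \<gamma>: "\<gamma> \<in> SL2Z" "mat_height \<gamma> \<le> T" "infnorm (mat_act \<gamma> x - y) \<le> T powr (- m)"
      using T0[OF V(1)] by blast
    have "\<bar>e\<bar> \<le> V powr (- w)" using vu by (auto simp: e_def V_def)
    have Te: "T * \<bar>e\<bar> \<le> c * V"
    proof -
      have "T * \<bar>e\<bar> \<le> T * V powr (- w)" using \<open>\<bar>e\<bar> \<le> V powr (- w)\<close> \<open>T > 0\<close> by (intro mult_left_mono) auto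
      also have "\<dots> = c * V" using \<open>V \<ge> 1\<close> by (simp add: T_def powr_minus powr_add)
      finally show ?thesis .
    qed
    obtain v1 u1 v2 u2 where r: "v1 * u2 - u1 * v2 = 1" "\<bar>of_int v1\<bar> \<le> C * mat_height \<gamma>"
      "\<bar>x $ 2 * lform \<xi> v1 u1 - l\<bar> \<le> C * infnorm (mat_act \<gamma> x - y)"
      "\<bar>x $ 2 * lform \<xi> v2 u2\<bar> \<le> C * infnorm (mat_act \<gamma> x - y)"
      using C(2)[OF \<gamma>(1)] by blast
    define e1 e2 where "e1 = lform \<xi> v1 u1" and "e2 = lform \<xi> v2 u2"
    have "C * infnorm (mat_act \<gamma> x - y) \<le> C * T powr (- m)" "C * mat_height \<gamma> \<le> C * T"
      using \<gamma> C(1) by simp_all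
    with r have r': "\<bar>x $ 2 * e1 - l\<bar> \<le> C * T powr (- m)" "X * \<bar>e2\<bar> \<le> C * T powr (- m)" "\<bar>of_int v1\<bar> \<le> C * T"
      by (auto simp: X_def abs_mult e1_def e2_def)
    have "\<bar>l\<bar> / 2 \<le> \<bar>x $ 2 * e1\<bar>" using r'(1) V(2) by linarith
    then have "L \<le> \<bar>e1\<bar>" using \<open>X > 0\<close> by (simp add: L_def abs_mult X_def[symmetric] field_simps)
    have "of_int v1 * e2 - of_int v2 * e1 = 1"
      using r(1) cross_lform[of v1 v2 \<xi> u2 u1] by (simp add: e1_def e2_def)
    then have "\<bar>of_int v2 * e1\<bar> \<le> 1 + \<bar>of_int v1 * e2\<bar>" by linarith
    then have "\<bar>of_int v2\<bar> * \<bar>e1\<bar> \<le> 1 + \<bar>of_int v1\<bar> * \<bar>e2\<bar>" by (simp add: abs_mult)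
    moreover have "\<bar>of_int v2\<bar> * L \<le> \<bar>of_int v2\<bar> * \<bar>e1\<bar>" using \<open>L \<le> \<bar>e1\<bar>\<close> by (intro mult_left_mono) auto
    moreover have "\<bar>of_int v1\<bar> * \<bar>e2\<bar> \<le> C * T * \<bar>e2\<bar>" using r'(3) by (intro mult_right_mono) auto
    ultimately have v2: "\<bar>of_int v2\<bar> * L \<le> 1 + C * T * \<bar>e2\<bar>" by linarith
    have D: "of_int v2 * e - V * e2 = of_int (v2 * u - u2 * v)"
      unfolding e_def V_def e2_def by (rule cross_lform)
    have Cc: "C * c = L / 2" using C(1) by (simp add: c_def)
    \<comment> \<open>Both rows are primitive, so proportionality means equality up to sign. Then V
      L <= 1 + C T |e| <= 1 + V L/2, against V > 2/L.\<close>
    have "v2 * u - u2 * v \<noteq> 0"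
    proof
      assume *: "v2 * u - u2 * v = 0"
      then have "v dvd v2 * u" by simp
      then have "v dvd v2" using vu(1) by (simp add: coprime_dvd_mult_left_iff)
      then obtain k where k: "v2 = v * k" by (elim dvdE)
      with * vu(2) have k': "u2 = u * k" by (simp add: algebra_simps)
      have "k * (v1 * u - u1 * v) = 1" using r(1) unfolding k k' by (simp add: algebra_simps)
      then have "\<bar>k\<bar> = 1" by (metis zmult_eq_1_iff abs_1 abs_minus_cancel)
      have "e2 = of_int k * e" by (simp add: e2_def e_def k k' algebra_simps)
      then have "\<bar>e2\<bar> = of_int \<bar>k\<bar> * \<bar>e\<bar>" by (simp add: abs_mult)
      then have "\<bar>e2\<bar> = \<bar>e\<bar>" using \<open>\<bar>k\<bar> = 1\<close> by simp
      have "\<bar>real_of_int v2\<bar> = V * of_int \<bar>k\<bar>" using vu(2) by (simp add: k V_def abs_mult)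
      then have "\<bar>real_of_int v2\<bar> = V" using \<open>\<bar>k\<bar> = 1\<close> by simp
      then have "V * L \<le> 1 + C * (T * \<bar>e\<bar>)" using v2 \<open>\<bar>e2\<bar> = \<bar>e\<bar>\<close> by (simp add: mult.assoc)
      also have "\<dots> \<le> 1 + C * (c * V)" using Te C(1) by simp
      also have "\<dots> = 1 + L / 2 * V" using Cc by (simp add: mult.assoc[symmetric])
      finally have "V * L \<le> 2" by (simp add: algebra_simps)
      then show False using V(4) \<open>L > 0\<close> by (simp add: field_simps)
    qed
    then have "1 \<le> \<bar>of_int (v2 * u - u2 * v) :: real\<bar>" by linarith
    with D have "1 \<le> \<bar>of_int v2 * e\<bar> + \<bar>V * e2\<bar>" by linarith
    then have a: "1 \<le> \<bar>of_int v2\<bar> * \<bar>e\<bar> + V * \<bar>e2\<bar>" using \<open>V \<ge> 1\<close> by (simp add: abs_mult)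
    have "\<bar>of_int v2\<bar> \<le> (1 + C * T * \<bar>e2\<bar>) / L" using v2 \<open>L > 0\<close> by (simp add: field_simps)
    then have "\<bar>of_int v2\<bar> * \<bar>e\<bar> \<le> (1 + C * T * \<bar>e2\<bar>) / L * \<bar>e\<bar>" by (intro mult_right_mono) auto
    also have "\<dots> = \<bar>e\<bar> / L + C * (T * \<bar>e\<bar>) * \<bar>e2\<bar> / L" using \<open>L > 0\<close> by (simp add: field_simps)
    also have "\<dots> \<le> V powr (- w) / L + C * (c * V) * \<bar>e2\<bar> / L"
      using \<open>\<bar>e\<bar> \<le> V powr (- w)\<close> Te C(1) \<open>L > 0\<close>
      by (intro add_mono divide_right_mono mult_right_mono mult_left_mono) auto
    also have "C * (c * V) * \<bar>e2\<bar> / L = (C * c) * V * \<bar>e2\<bar> / L" by simp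
    also have "\<dots> = V * \<bar>e2\<bar> / 2" unfolding Cc using \<open>L > 0\<close> by simp
    \<comment> \<open>Of the total 1, less than 1/2 comes from |e|/L, half of V |e2| from the
      remainder of v2 e, and V |e2| from the other product.\<close>
    finally have "1 / 2 \<le> 3 / 2 * (V * \<bar>e2\<bar>)" using a V(3) by linarith
    then have "X * (1 / 2) \<le> X * (3 / 2 * (V * \<bar>e2\<bar>))" using \<open>X > 0\<close> by (intro mult_left_mono) auto
    also have "\<dots> = 3 / 2 * V * (X * \<bar>e2\<bar>)" by simp
    also have "\<dots> \<le> 3 / 2 * V * (C * T powr (- m))" using r'(2) \<open>V \<ge> 1\<close> by (intro mult_left_mono) auto
    also have "T powr (- m) = c powr (- m) * V powr (- ((w + 1) * m))"
      using \<open>V \<ge> 1\<close> \<open>c > 0\<close> by (simp add: T_def powr_mult powr_powr)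
    finally have *: "1 \<le> 3 * C / X * c powr (- m) * V * V powr (- ((w + 1) * m))"
      using \<open>X > 0\<close> by (simp add: field_simps)
    define A where "A = V powr ((w + 1) * m)"
    have "A > 0" using \<open>V \<ge> 1\<close> by (simp add: A_def)
    have "1 \<le> 3 * C / X * c powr (- m) * V / A"
      using * by (simp add: A_def powr_minus_divide[of V])
    then have "A \<le> 3 * C / X * c powr (- m) * V" by (simp only: pos_le_divide_eq[OF \<open>A > 0\<close>] mult_1)
    then have "V powr ((w + 1) * m) \<le> 3 * C / X * c powr (- m) * V powr 1"
      using \<open>V \<ge> 1\<close> by (simp add: A_def)
    then show "\<exists>A\<ge>R. A powr ((w + 1) * m) \<le> 3 * C / X * c powr (- m) * A powr 1"
      using vu by (intro exI[of _ V]) (auto simp: V_def)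
  qed
qed

section \<open>Points with irrational slope\<close>

text \<open>Primitive rows of the quality that Dirichlet's theorem supplies, normalised to a
  positive leading coefficient; a set containing enough of them to play the role of the
  convergents.\<close>

definition good_forms :: "real \<Rightarrow> (int \<times> int) set" where
  "good_forms \<xi> = {(v, u). coprime v u \<and> 0 < v \<and> of_int v * \<bar>lform \<xi> v u\<bar> \<le> 1}"

abbreviation inv_lform :: "real \<Rightarrow> int \<times> int \<Rightarrow> real" where
  "inv_lform \<xi> z \<equiv> 1 / \<bar>lform \<xi> (fst z) (snd z)\<bar>"

lemma good_formsD:
  assumes "\<xi> \<notin> \<rat>" "z \<in> good_forms \<xi>"
  shows "coprime (fst z) (snd z)" "1 \<le> fst z" "of_int (fst z) \<le> inv_lform \<xi> z" "1 \<le> inv_lform \<xi> z"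
    "\<bar>lform \<xi> (fst z) (snd z)\<bar> \<le> 1"
proof -
  define e where "e = \<bar>lform \<xi> (fst z) (snd z)\<bar>"
  have z: "coprime (fst z) (snd z)" "0 < fst z" "of_int (fst z) * e \<le> 1"
    using assms(2) by (auto simp: good_forms_def e_def split: prod.splits)
  have "0 < e" using lform_nonzero[OF assms(1), of "fst z" "snd z"] z(2) by (simp add: e_def)
  show "coprime (fst z) (snd z)" "1 \<le> fst z" using z by simp_all
  have 1: "of_int (fst z) \<le> 1 / e" using z(3) \<open>0 < e\<close> by (simp add: field_simps)
  moreover have "1 \<le> real_of_int (fst z)" using z(2) by simp
  ultimately have 2: "1 \<le> 1 / e" by linarith
  then have "e \<le> 1" using \<open>0 < e\<close> by (simp add: field_simps)
  with 1 2 show "of_int (fst z) \<le> inv_lform \<xi> z" "1 \<le> inv_lform \<xi> z" "\<bar>lform \<xi> (fst z) (snd z)\<bar> \<le> 1"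
    by (simp_all only: e_def)
qed

text \<open>Stands in for the next convergent, whose denominator is comparable to the inverse of the
  current form: Dirichlet at the integer above \<open>E\<close>, which is at most 2E because E >=
  1.\<close>

lemma exists_better_form:
  assumes "\<xi> \<notin> \<rat>" "1 \<le> E"
  shows "\<exists>z\<in>good_forms \<xi>. of_int (fst z) \<le> 2 * E \<and> E < inv_lform \<xi> z"
proof -
  define N where "N = nat \<lceil>E\<rceil>"
  have "1 \<le> \<lceil>E\<rceil>" using assms(2) by linarith
  then have "real N = of_int \<lceil>E\<rceil>" "N > 0" by (simp_all add: N_def)
  then have N: "N > 0" "E \<le> real N" "real N \<le> 2 * E" using assms(2) by linarith+
  obtain v u where vu: "coprime v u" "0 < v" "v \<le> int N" "\<bar>lform \<xi> v u\<bar> < 1 / N"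
    using Dirichlet_lform[OF N(1)] by metis
  have e: "0 < \<bar>lform \<xi> v u\<bar>" using lform_nonzero[OF assms(1), of v u] vu by simp
  have "of_int v \<le> real N" using vu by linarith
  then have "of_int v * \<bar>lform \<xi> v u\<bar> \<le> real N * (1 / N)"
    using vu by (intro mult_mono) auto
  then have "(v, u) \<in> good_forms \<xi>" using vu N by (simp add: good_forms_def)
  moreover have "real N < 1 / \<bar>lform \<xi> v u\<bar>" using vu(4) e N(1) by (simp add: field_simps)
  ultimately show ?thesis
    using N \<open>of_int v \<le> real N\<close> by (intro bexI[of _ "(v, u)"]) auto
qed

text \<open>Bounded coefficients leave finitely many good forms, so a maximum is attained.\<close>

lemma exists_best_form:
  fixes M :: real
  assumes "\<xi> \<notin> \<rat>" "S \<subseteq> good_forms \<xi>" "S \<noteq> {}" "\<And>z. z \<in> S \<Longrightarrow> of_int (fst z) \<le> M"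
  shows "\<exists>z\<in>S. \<forall>z'\<in>S. inv_lform \<xi> z' \<le> inv_lform \<xi> z"
proof -
  have "finite S"
  proof (rule finite_subset[OF _ finite_bounded_lform[of M \<xi> 1]], rule subsetI)
    fix z assume "z \<in> S"
    with assms good_formsD[OF assms(1), of z] show "z \<in> {(v, u). \<bar>of_int v\<bar> \<le> M \<and> \<bar>lform \<xi> v u\<bar> \<le> 1}"
      by (auto split: prod.splits)
  qed
  then have fin: "finite (inv_lform \<xi> ` S)" by simp
  have "Max (inv_lform \<xi> ` S) \<in> inv_lform \<xi> ` S" using fin assms(3) by (intro Max_in) auto
  then obtain z where "z \<in> S" "inv_lform \<xi> z = Max (inv_lform \<xi> ` S)" by auto
  then show ?thesis using Max_ge[OF fin] by (intro bexI[of _ z]) auto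
qed

text \<open>
  With \<open>v\<close>, \<open>q\<close> the leading coefficients and \<open>E\<close>, \<open>F\<close> the inverse values of the two forms, the height
  is of order \<open>B = (v + q) * E\<close> and the error of order \<open>q / E + 1 / (q * F)\<close>; the two inequalities
  say that both error terms are at most of order \<open>B\<close> to the power \<open>-1/3\<close>. Maximising \<open>E\<close> for a
  fixed \<open>b\<close> subject to the second one either gives the first one or exposes a large gap in the
  approximations to \<open>\<xi>\<close>; past that gap, maximising \<open>F\<close> subject to the first one gives the second.
  The constant 32 absorbs the factors of two lost in Dirichlet's theorem.
\<close>

lemma exists_balanced_forms:
  fixes R :: real
  assumes \<xi>: "\<xi> \<notin> \<rat>" and \<eta>: "\<eta> \<notin> \<rat>"
  shows "\<exists>a\<in>good_forms \<xi>. \<exists>b\<in>good_forms \<eta>. R \<le> of_int (fst b)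
    \<and> of_int (fst b) ^ 3 * (of_int (fst a) + of_int (fst b)) \<le> 32 * inv_lform \<xi> a ^ 2
    \<and> (of_int (fst a) + of_int (fst b)) * inv_lform \<xi> a \<le> 32 * (of_int (fst b) * inv_lform \<eta> b) ^ 3"
proof -
  define E where "E = inv_lform \<xi>"
  define F where "F = inv_lform \<eta>"
  define V :: "int \<times> int \<Rightarrow> real" where "V = (\<lambda>z. of_int (fst z))"
  note E = good_formsD[OF \<xi>] and F = good_formsD[OF \<eta>]
  have VE: "1 \<le> V z" "V z \<le> E z" "1 \<le> E z" if "z \<in> good_forms \<xi>" for z
    using E[OF that] by (simp_all add: V_def E_def)
  have VF: "1 \<le> V z" "V z \<le> F z" "1 \<le> F z" if "z \<in> good_forms \<eta>" for z
    using F[OF that] by (simp_all add: V_def F_def)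
  obtain a0 where a0: "a0 \<in> good_forms \<xi>"
    using exists_better_form[OF \<xi>, of 1] by auto
  obtain \<delta> where \<delta>: "\<delta> > 0" "\<forall>v u. v \<noteq> 0 \<longrightarrow> \<bar>of_int v\<bar> \<le> R \<longrightarrow> \<delta> \<le> \<bar>lform \<eta> v u\<bar>"
    using lform_bounded_away[OF \<eta>, of R] by blast
  \<comment> \<open>F > N serves two ends: 1/\<delta> forces a leading coefficient of at least R,
    and the product puts \<open>a0\<close> into \<open>S1\<close>, which is thus nonempty.\<close>
  define N where "N = max 1 (max (1 / \<delta>) ((V a0 + 1) * E a0))"
  have N: "1 \<le> N" "1 / \<delta> \<le> N" "(V a0 + 1) * E a0 \<le> N" by (simp_all add: N_def)
  obtain b1 where "b1 \<in> good_forms \<eta>" "N < F b1"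
    using exists_better_form[OF \<eta> N(1)] unfolding F_def by blast
  \<comment> \<open>The least leading coefficient beyond the threshold: a later replacement of
    \<open>b\<close> with larger \<open>F\<close> then cannot have a smaller coefficient than
    q.\<close>
  then obtain b where b: "b \<in> good_forms \<eta>" "N < F b"
    and least: "\<And>b'. b' \<in> good_forms \<eta> \<Longrightarrow> N < F b' \<Longrightarrow> nat (fst b) \<le> nat (fst b')"
    using ex_has_least_nat[of "\<lambda>z. z \<in> good_forms \<eta> \<and> N < F z" b1 "\<lambda>z. nat (fst z)"] by blast
  have V_least: "V b \<le> V b'" if "b' \<in> good_forms \<eta>" "N < F b'" for b'
    using least[OF that] F(2)[OF b(1)] F(2)[OF that(1)] by (simp add: V_def)
  have large: "R \<le> V z" if "z \<in> good_forms \<eta>" "N < F z" for z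
  proof (rule ccontr)
    assume "\<not> R \<le> V z"
    then have "\<delta> \<le> \<bar>lform \<eta> (fst z) (snd z)\<bar>" using \<delta>(2) F(2)[OF that(1)] by (simp add: V_def)
    then have "F z \<le> 1 / \<delta>" unfolding F_def using \<delta>(1) by (intro divide_left_mono mult_pos_pos) auto
    with N(2) that(2) show False by simp
  qed
  define q where "q = V b"
  have q: "1 \<le> q" "q \<le> F b" "1 \<le> F b" using VF[OF b(1)] by (simp_all add: q_def)
  have q3: "q \<le> q ^ 3" using q(1) by (simp add: self_le_power)
  \<comment> \<open>The second inequality with \<open>b\<close> fixed; a larger E helps the first
    inequality.\<close>
  define S1 where "S1 = {z \<in> good_forms \<xi>. (V z + q) * E z \<le> 32 * (q * F b) ^ 3}"
  have "a0 \<in> S1"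
  proof -
    have "V a0 + q \<le> (V a0 + 1) * q"
      using VE(1)[OF a0] q(1) by (simp add: algebra_simps)
    then have "(V a0 + q) * E a0 \<le> (V a0 + 1) * q * E a0"
      using VE(3)[OF a0] by (intro mult_right_mono) auto
    also have "\<dots> = q * ((V a0 + 1) * E a0)" by simp
    also have "\<dots> \<le> q * F b" using N(3) b(2) q(1) by (intro mult_left_mono) auto
    also have "\<dots> \<le> (q * F b) ^ 3"
      using mult_mono[OF q(1) q(3)] q by (intro self_le_power) auto
    also have "\<dots> \<le> 32 * (q * F b) ^ 3" using q by simp
    finally show ?thesis using a0 by (simp add: S1_def)
  qed
  moreover have "V z \<le> 32 * (q * F b) ^ 3" if "z \<in> S1" for z
  proof -
    have "V z * 1 \<le> (V z + q) * E z" using VE[of z] that q by (intro mult_mono) (auto simp: S1_def)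
    with that show ?thesis by (simp add: S1_def)
  qed
  ultimately obtain a1 where a1: "a1 \<in> S1" "\<And>z. z \<in> S1 \<Longrightarrow> E z \<le> E a1"
    using exists_best_form[OF \<xi>, of S1 "32 * (q * F b) ^ 3"] unfolding E_def V_def S1_def by blast
  have a1': "a1 \<in> good_forms \<xi>" "(V a1 + q) * E a1 \<le> 32 * (q * F b) ^ 3" using a1 by (auto simp: S1_def)
  show ?thesis
  proof (cases "q ^ 3 * (V a1 + q) \<le> 32 * E a1 ^ 2")
    case True
    then show ?thesis
      using a1' b large[OF b] unfolding q_def E_def F_def V_def by blast
  next
    case False
    \<comment> \<open>The form just past the maximum. It violates the second inequality although its
      leading coefficient is at most 2 E a1.\<close>
    obtain a where a: "a \<in> good_forms \<xi>" "V a \<le> 2 * E a1" "E a1 < E a"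
      using exists_better_form[OF \<xi> VE(3)[OF a1'(1)]] unfolding E_def V_def by blast
    have "a \<notin> S1" using a1(2)[of a] a(3) by auto
    then have big: "32 * (q * F b) ^ 3 < (V a + q) * E a" using a(1) by (simp add: S1_def)
    \<comment> \<open>Otherwise q^3, q and V a1 are all at most E a1, and the first inequality would
      hold for a1.\<close>
    have "E a1 \<le> q ^ 3"
    proof (rule ccontr)
      assume "\<not> E a1 \<le> q ^ 3"
      then have "q ^ 3 \<le> E a1" "q \<le> E a1" using q3 by simp_all
      then have "q ^ 3 * (V a1 + q) \<le> E a1 * (E a1 + E a1)"
        using VE[OF a1'(1)] q by (intro mult_mono add_mono) auto
      also have "\<dots> \<le> 32 * E a1 ^ 2" by (simp add: power2_eq_square)
      finally show False using False by simp
    qed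
    then have Va: "V a \<le> 2 * q ^ 3" using a(2) by simp
    \<comment> \<open>This is the gap: the coefficient of \<open>a\<close> is at most 2 q^3 while
      its inverse form is at least 3 F^3.\<close>
    have Ea: "3 * F b ^ 3 \<le> E a"
    proof -
      have "(V a + q) * E a \<le> (3 * q ^ 3) * E a"
        using Va q3 VE[OF a(1)] by (intro mult_right_mono) auto
      with big have "q ^ 3 * (32 * F b ^ 3) \<le> q ^ 3 * (3 * E a)" by (simp add: power_mult_distrib algebra_simps)
      then have "32 * F b ^ 3 \<le> 3 * E a" by (rule mult_left_le_imp_le) (use q in auto)
      moreover have "0 \<le> F b ^ 3" using q by simp
      ultimately show ?thesis by linarith
    qed
    \<comment> \<open>The roles are exchanged: the first inequality with \<open>a\<close> fixed. The
      gap and q <= F b show that \<open>b\<close> satisfies it.\<close>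
    define S2 where "S2 = {z \<in> good_forms \<eta>. V z ^ 3 * (V a + V z) \<le> 32 * E a ^ 2}"
    have "b \<in> S2"
    proof -
      have "q ^ 3 * (V a + q) \<le> q ^ 3 * (3 * q ^ 3)"
        using Va q3 q by (intro mult_left_mono) auto
      also have "\<dots> \<le> F b ^ 3 * (3 * F b ^ 3)" using q by (intro mult_mono power_mono) auto
      also have "\<dots> \<le> E a * E a"
        using Ea q VE(3)[OF a(1)] by (intro mult_mono) (auto intro: order_trans[rotated])
      also have "\<dots> \<le> 32 * E a ^ 2" by (simp add: power2_eq_square)
      finally show ?thesis using b(1) by (simp add: S2_def q_def)
    qed
    moreover have "V z \<le> 32 * E a ^ 2" if "z \<in> S2" for z
    proof -
      have z: "1 \<le> V z" using that VF by (simp add: S2_def)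
      then have "V z \<le> V z ^ 3" by (simp add: self_le_power)
      then have "V z * 1 \<le> V z ^ 3 * (V a + V z)" using VE[OF a(1)] z by (intro mult_mono) auto
      with that show ?thesis by (simp add: S2_def)
    qed
    ultimately obtain b2 where b2: "b2 \<in> S2" "\<And>z. z \<in> S2 \<Longrightarrow> F z \<le> F b2"
      using exists_best_form[OF \<eta>, of S2 "32 * E a ^ 2"] unfolding F_def V_def S2_def by blast
    have b2': "b2 \<in> good_forms \<eta>" "V b2 ^ 3 * (V a + V b2) \<le> 32 * E a ^ 2" using b2 by (auto simp: S2_def)
    have "N < F b2" using b2(2)[OF \<open>b \<in> S2\<close>] b(2) by simp
    have "q \<le> V b2" using V_least[OF b2'(1) \<open>N < F b2\<close>] by (simp add: q_def)
    \<comment> \<open>Maximality again: the form past \<open>b2\<close> violates the first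
      inequality, which bounds E a in terms of F b2.\<close>
    obtain b3 where b3: "b3 \<in> good_forms \<eta>" "V b3 \<le> 2 * F b2" "F b2 < F b3"
      using exists_better_form[OF \<eta> VF(3)[OF b2'(1)]] unfolding F_def V_def by blast
    have "b3 \<notin> S2" using b2(2)[of b3] b3(3) by auto
    then have "32 * E a ^ 2 < V b3 ^ 3 * (V a + V b3)" using b3(1) by (simp add: S2_def)
    also have "\<dots> \<le> (2 * F b2) ^ 3 * (V a + 2 * F b2)"
      using b3(2) VF[OF b3(1)] VE[OF a(1)] by (intro mult_mono power_mono add_mono) auto
    finally have big2: "4 * E a ^ 2 < F b2 ^ 3 * (V a + 2 * F b2)" by (simp add: power_mult_distrib)
    have EF: "3 * E a \<le> 32 * F b2 ^ 3"
    proof (rule ccontr)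
      assume *: "\<not> ?thesis"
      have "F b2 \<le> F b2 ^ 3" using VF[OF b2'(1)] by (simp add: self_le_power)
      then have "F b2 \<le> E a" "F b2 ^ 3 \<le> E a" using * VE[OF a(1)] by linarith+
      then have "F b2 ^ 3 * (V a + 2 * F b2) \<le> E a * (E a + 2 * E a)"
        using VE[OF a(1)] VF[OF b2'(1)] by (intro mult_mono add_mono) auto
      also have "\<dots> \<le> 4 * E a ^ 2" by (simp add: power2_eq_square)
      finally show False using big2 by simp
    qed
    have qq: "q ^ 3 \<le> V b2 ^ 3" using \<open>q \<le> V b2\<close> q by (intro power_mono) auto
    have "V b2 \<le> V b2 ^ 3" using VF[OF b2'(1)] by (simp add: self_le_power)
    \<comment> \<open>Here minimality of \<open>b\<close> enters: V a <= 2 q^3 <= 2 V b2^3.\<close>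
    then have "(V a + V b2) * E a \<le> (3 * V b2 ^ 3) * E a"
      using Va qq VE[OF a(1)] by (intro mult_right_mono) auto
    also have "\<dots> = V b2 ^ 3 * (3 * E a)" by simp
    also have "\<dots> \<le> V b2 ^ 3 * (32 * F b2 ^ 3)"
      using EF VF[OF b2'(1)] by (intro mult_left_mono) auto
    also have "\<dots> = 32 * (V b2 * F b2) ^ 3" by (simp add: power_mult_distrib)
    finally have "(V a + V b2) * E a \<le> 32 * (V b2 * F b2) ^ 3" .
    then show ?thesis
      using a(1) b2' large[OF b2'(1) \<open>N < F b2\<close>] unfolding E_def F_def V_def by blast
  qed
qed

section \<open>Approximating a point of irrational slope\<close>

text \<open>The target is moved to the multiple of (-p, q) having the same second coordinate as y.
  The shift costs |y_2| f/q, and the rest is the estimate for primitive multiples, uniform in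
  direction.\<close>

lemma exists_approx_irrational_direction:
  fixes x y :: "real^2"
  assumes x: "x $ 2 \<noteq> 0" "slope x \<notin> \<rat>" and y: "y $ 2 \<noteq> 0"
  shows "\<exists>C>0. \<forall>v u q p y0. coprime v u \<longrightarrow> 0 < v \<longrightarrow> of_int v * \<bar>lform (slope x) v u\<bar> \<le> 1 \<longrightarrow>
    coprime q p \<longrightarrow> 0 < q \<longrightarrow> \<bar>lform (slope y) q p\<bar> \<le> 1 \<longrightarrow>
    (\<exists>\<gamma>\<in>SL2Z. mat_act \<gamma> x \<noteq> y0
      \<and> mat_height \<gamma> \<le> C * ((of_int v + of_int q) * (1 / \<bar>lform (slope x) v u\<bar>))
      \<and> infnorm (mat_act \<gamma> x - y)
          \<le> C * (of_int q * \<bar>lform (slope x) v u\<bar> + \<bar>lform (slope y) q p\<bar> / of_int q))"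
proof -
  define \<xi> where "\<xi> = slope x"
  define \<eta> where "\<eta> = slope y"
  obtain C where C: "C > 0" "\<forall>p q v u l y0. coprime p q \<longrightarrow> coprime v u \<longrightarrow> 0 < v \<longrightarrow> \<bar>lform \<xi> v u\<bar> \<le> 1 \<longrightarrow>
    (\<exists>\<gamma>\<in>SL2Z. mat_act \<gamma> x \<noteq> y0
      \<and> mat_height \<gamma> \<le> C * (of_int (max \<bar>p\<bar> \<bar>q\<bar>) * (of_int v + \<bar>l\<bar> * of_int v / \<bar>lform \<xi> v u\<bar> + 1 / \<bar>lform \<xi> v u\<bar>))
      \<and> infnorm (mat_act \<gamma> x - vector [l * of_int p, l * of_int q])
          \<le> C * (of_int (max \<bar>p\<bar> \<bar>q\<bar>) * \<bar>lform \<xi> v u\<bar>))"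
    using exists_approx_of_primitive_multiple[OF x] unfolding \<xi>_def by blast
  define Y where "Y = \<bar>y $ 2\<bar>"
  define D where "D = \<bar>\<eta>\<bar> + 1"
  define K where "K = C * D * (2 + Y) + Y"
  have "D \<ge> 1" "Y > 0" using y by (simp_all add: D_def Y_def)
  have CD: "C * D > 0" using C(1) \<open>D \<ge> 1\<close> by simp
  have "C * D * 1 \<le> C * D * (2 + Y)" using CD \<open>Y > 0\<close> by (intro mult_left_mono) auto
  then have K: "C * D \<le> K" "C * D * (2 + Y) \<le> K" "Y \<le> K" "K > 0" using \<open>Y > 0\<close> CD by (auto simp: K_def)
  show ?thesis unfolding \<xi>_def[symmetric] \<eta>_def[symmetric]
  proof (rule exI[of _ K], intro conjI allI impI)
    show "K > 0" by fact
    fix v u q p :: int and y0 :: "real^2"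
    assume vu: "coprime v u" "0 < v" "of_int v * \<bar>lform \<xi> v u\<bar> \<le> 1"
      and qp: "coprime q p" "0 < q" "\<bar>lform \<eta> q p\<bar> \<le> 1"
    define e f V Q where "e = \<bar>lform \<xi> v u\<bar>" and "f = \<bar>lform \<eta> q p\<bar>" and "V = real_of_int v" and "Q = real_of_int q"
    \<comment> \<open>Makes the second coordinate exact; being of size 1/Q, it offsets the factor Q
      from the direction.\<close>
    define l where "l = y $ 2 / Q"
    define S where "S = real_of_int (max \<bar>- p\<bar> \<bar>q\<bar>)"
    have "V \<ge> 1" "Q \<ge> 1" using vu qp by (simp_all add: V_def Q_def)
    have "e > 0" using lform_nonzero[of \<xi> v u] x vu by (simp add: e_def \<xi>_def)
    have "V * e \<le> 1" using vu by (simp add: V_def e_def)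
    then have "V \<le> 1 / e" using \<open>e > 0\<close> by (simp add: field_simps)
    then have "1 \<le> 1 / e" using \<open>V \<ge> 1\<close> by linarith
    then have e1: "e \<le> 1" using \<open>e > 0\<close> by (simp add: field_simps)
    have S: "0 \<le> S" "S \<le> D * Q"
    proof -
      have "real_of_int p = lform \<eta> q p - Q * \<eta>" by (simp add: Q_def)
      then have "\<bar>real_of_int p\<bar> \<le> \<bar>lform \<eta> q p\<bar> + \<bar>Q * \<eta>\<bar>" by linarith
      also have "\<dots> \<le> 1 + Q * \<bar>\<eta>\<bar>" using qp(3) \<open>Q \<ge> 1\<close> by (simp add: abs_mult)
      also have "\<dots> \<le> D * Q" using \<open>Q \<ge> 1\<close> by (simp add: D_def algebra_simps)
      finally have "\<bar>real_of_int p\<bar> \<le> D * Q" .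
      moreover have "Q \<le> D * Q" using \<open>D \<ge> 1\<close> \<open>Q \<ge> 1\<close> by (simp add: mult_le_cancel_right1)
      ultimately show "S \<le> D * Q" using qp(2) by (simp add: S_def of_int_max Q_def)
      show "0 \<le> S" by (simp add: S_def)
    qed
    have cop: "coprime (- p) q" using qp(1) by (simp add: coprime_commute)
    obtain \<gamma> where \<gamma>: "\<gamma> \<in> SL2Z" "mat_act \<gamma> x \<noteq> y0" "mat_height \<gamma> \<le> C * (S * (V + \<bar>l\<bar> * V / e + 1 / e))"
      "infnorm (mat_act \<gamma> x - vector [l * of_int (- p), l * of_int q]) \<le> C * (S * e)"
      using C(2)[rule_format, OF cop vu(1,2) e1[unfolded e_def], of y0 l] unfolding S_def V_def e_def by blast
    have h: "mat_height \<gamma> \<le> K * ((V + Q) * (1 / e))"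
    proof -
      have "0 \<le> V + \<bar>l\<bar> * V / e + 1 / e" using \<open>V \<ge> 1\<close> \<open>e > 0\<close> by simp
      then have "C * (S * (V + \<bar>l\<bar> * V / e + 1 / e)) \<le> C * (D * Q * (V + \<bar>l\<bar> * V / e + 1 / e))"
        using S C(1) by (intro mult_left_mono mult_right_mono) auto
      also have "\<dots> = C * D * (Q * V + Y * (V * (1 / e)) + Q * (1 / e))"
        using \<open>Q \<ge> 1\<close> by (simp add: l_def Y_def field_simps)
      also have "\<dots> \<le> C * D * ((2 + Y) * ((V + Q) * (1 / e)))"
      proof (intro mult_left_mono)
        \<comment> \<open>The product of the two coefficients is harmless since V <= 1/e.\<close>
        have "Q * V \<le> Q * (1 / e)" using \<open>V \<le> 1 / e\<close> \<open>Q \<ge> 1\<close> by (intro mult_left_mono) auto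
        moreover have "0 \<le> Y * (Q * (1 / e))" "0 \<le> V * (1 / e)" using \<open>Y > 0\<close> \<open>Q \<ge> 1\<close> \<open>V \<ge> 1\<close> \<open>e > 0\<close> by simp_all
        moreover have "(2 + Y) * ((V + Q) * (1 / e)) = 2 * (V * (1 / e)) + 2 * (Q * (1 / e)) + Y * (V * (1 / e)) + Y * (Q * (1 / e))"
          by (simp add: algebra_simps add_divide_distrib)
        ultimately show "Q * V + Y * (V * (1 / e)) + Q * (1 / e) \<le> (2 + Y) * ((V + Q) * (1 / e))" by linarith
      qed (use CD in simp)
      also have "\<dots> = C * D * (2 + Y) * ((V + Q) * (1 / e))" by simp
      also have "\<dots> \<le> K * ((V + Q) * (1 / e))"
        using K \<open>V \<ge> 1\<close> \<open>Q \<ge> 1\<close> \<open>e > 0\<close> by (intro mult_right_mono) auto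
      finally show ?thesis using \<gamma>(3) by simp
    qed
    have err: "infnorm (mat_act \<gamma> x - y) \<le> K * (Q * e + f / Q)"
    proof -
      define y' :: "real^2" where "y' = vector [l * of_int (- p), l * of_int q]"
      have 1: "(y' - y) $ 2 = 0" using \<open>Q \<ge> 1\<close> by (simp add: y'_def l_def Q_def)
      have "y $ 1 = y $ 2 * \<eta>" using y by (simp add: \<eta>_def slope_def)
      then have "(y' - y) $ 1 = - (y $ 2 * lform \<eta> q p / Q)"
        using \<open>Q \<ge> 1\<close> by (simp add: y'_def l_def Q_def field_simps)
      then have "\<bar>(y' - y) $ 1\<bar> = Y * (f / Q)" using \<open>Q \<ge> 1\<close> by (simp add: Y_def f_def abs_mult)
      then have 2: "infnorm (y' - y) = Y * (f / Q)" using 1 \<open>Y > 0\<close> \<open>Q \<ge> 1\<close> by (simp add: infnorm_2' f_def)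
      have "infnorm (mat_act \<gamma> x - y) \<le> infnorm (mat_act \<gamma> x - y') + infnorm (y' - y)"
        using infnorm_triangle[of "mat_act \<gamma> x - y'" "y' - y"] by simp
      also have "\<dots> \<le> C * (S * e) + Y * (f / Q)" using \<gamma>(4) 2 by (simp add: y'_def)
      also have "\<dots> \<le> C * (D * Q * e) + Y * (f / Q)"
        using S C(1) \<open>e > 0\<close> by (intro add_right_mono mult_left_mono mult_right_mono) auto
      also have "\<dots> = C * D * (Q * e) + Y * (f / Q)" by simp
      also have "\<dots> \<le> K * (Q * e) + K * (f / Q)"
        using K \<open>Q \<ge> 1\<close> \<open>e > 0\<close> by (intro add_mono mult_right_mono) (auto simp: f_def)
      finally show ?thesis by (simp add: algebra_simps)
    qed
    show "\<exists>\<gamma>\<in>SL2Z. mat_act \<gamma> x \<noteq> y0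
      \<and> mat_height \<gamma> \<le> K * ((of_int v + of_int q) * (1 / \<bar>lform \<xi> v u\<bar>))
      \<and> infnorm (mat_act \<gamma> x - y) \<le> K * (of_int q * \<bar>lform \<xi> v u\<bar> + \<bar>lform \<eta> q p\<bar> / of_int q)"
      using \<gamma> h err unfolding V_def Q_def e_def f_def by blast
  qed
qed

text \<open>Taking cube roots, with 4^3 = 64 leaving room above 32.\<close>

lemma le_powr_third:
  fixes t B :: real
  assumes "0 < B" "t ^ 3 * B \<le> 32"
  shows "t \<le> 4 * B powr (- (1 / 3))"
proof (rule ccontr)
  assume "\<not> ?thesis"
  then have "(4 * B powr (- (1 / 3))) ^ 3 < t ^ 3"
    by (intro power_strict_mono) auto
  moreover have "(B powr (- (1 / 3))) ^ 3 = 1 / B"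
  proof -
    have "(B powr (- (1 / 3))) ^ 3 = (B powr (- (1 / 3))) powr 3"
      by (rule powr_numeral[symmetric]) (use assms(1) in simp)
    also have "\<dots> = B powr (- 1)" unfolding powr_powr by simp
    finally show ?thesis using assms(1) by (simp add: powr_minus_divide)
  qed
  ultimately have "64 / B < t ^ 3" by (simp add: power_mult_distrib)
  then have "64 < t ^ 3 * B" using assms(1) by (simp add: field_simps)
  with assms(2) show False by simp
qed

text \<open>With B = (V + Q) E the two balance conditions say that Q/E and 1/(Q F), the two parts of
  the error, have cubes at most 32/B.\<close>

lemma approx_exp_irrational_ge:
  fixes x y :: "real^2"
  assumes x: "x $ 2 \<noteq> 0" "slope x \<notin> \<rat>" and y: "y $ 2 \<noteq> 0" "slope y \<notin> \<rat>"
  shows "ereal (1 / 3) \<le> approx_exp x y"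
proof -
  define \<xi> where "\<xi> = slope x"
  define \<eta> where "\<eta> = slope y"
  have irr: "\<xi> \<notin> \<rat>" "\<eta> \<notin> \<rat>" using x y by (simp_all add: \<xi>_def \<eta>_def)
  obtain C where C: "C > 0" "\<forall>v u q p y0. coprime v u \<longrightarrow> 0 < v \<longrightarrow> of_int v * \<bar>lform \<xi> v u\<bar> \<le> 1 \<longrightarrow>
    coprime q p \<longrightarrow> 0 < q \<longrightarrow> \<bar>lform \<eta> q p\<bar> \<le> 1 \<longrightarrow>
    (\<exists>\<gamma>\<in>SL2Z. mat_act \<gamma> x \<noteq> y0
      \<and> mat_height \<gamma> \<le> C * ((of_int v + of_int q) * (1 / \<bar>lform \<xi> v u\<bar>))
      \<and> infnorm (mat_act \<gamma> x - y) \<le> C * (of_int q * \<bar>lform \<xi> v u\<bar> + \<bar>lform \<eta> q p\<bar> / of_int q))"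
    using exists_approx_irrational_direction[OF x y(1)] unfolding \<xi>_def \<eta>_def by blast
  have "ereal (1 / 3 / 1) \<le> approx_exp x y"
  proof (rule approx_exp_ge[of 1 "1 / 3" "8 * C"])
    fix R :: real
    obtain a b where ab: "a \<in> good_forms \<xi>" "b \<in> good_forms \<eta>" "R \<le> of_int (fst b)"
      "of_int (fst b) ^ 3 * (of_int (fst a) + of_int (fst b)) \<le> 32 * inv_lform \<xi> a ^ 2"
      "(of_int (fst a) + of_int (fst b)) * inv_lform \<xi> a \<le> 32 * (of_int (fst b) * inv_lform \<eta> b) ^ 3"
      using exists_balanced_forms[OF irr, of R] by blast
    define V Q E F where "V = real_of_int (fst a)" and "Q = real_of_int (fst b)"
      and "E = inv_lform \<xi> a" and "F = inv_lform \<eta> b"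
    define B where "B = (V + Q) * E"
    note A = good_formsD[OF irr(1) ab(1)] and B' = good_formsD[OF irr(2) ab(2)]
    have VQ: "1 \<le> V" "1 \<le> Q" "1 \<le> E" "1 \<le> F"
      using A(2,4) B'(2,4) by (simp_all add: V_def Q_def E_def F_def)
    have "Q * 1 \<le> (V + Q) * E" using VQ by (intro mult_mono) auto
    then have B: "R \<le> B" "1 \<le> B" using ab(3) VQ by (auto simp: B_def Q_def)
    have 1: "Q ^ 3 * (V + Q) \<le> 32 * E ^ 2" and 2: "B \<le> 32 * (Q * F) ^ 3"
      using ab(4,5) by (simp_all only: V_def Q_def E_def F_def B_def)
    have "(Q / E) ^ 3 * B = Q ^ 3 * (V + Q) / E ^ 2"
      using VQ by (simp add: B_def power2_eq_square power3_eq_cube field_simps)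
    also have "\<dots> \<le> 32" using 1 VQ by (simp add: pos_divide_le_eq)
    finally have q1: "Q / E \<le> 4 * B powr (- (1 / 3))" using B by (intro le_powr_third) auto
    have "(1 / (Q * F)) ^ 3 * B \<le> 32" using 2 VQ by (simp add: power_divide pos_divide_le_eq)
    then have q2: "1 / (Q * F) \<le> 4 * B powr (- (1 / 3))" using B by (intro le_powr_third) auto
    have v: "of_int (fst a) * \<bar>lform \<xi> (fst a) (snd a)\<bar> \<le> 1" "0 < fst a" "0 < fst b"
      using ab(1) A(2) B'(2) by (auto simp: good_forms_def split: prod.splits)
    have EF: "\<bar>lform \<xi> (fst a) (snd a)\<bar> = 1 / E" "\<bar>lform \<eta> (fst b) (snd b)\<bar> = 1 / F" by (simp_all add: E_def F_def)
    obtain \<gamma> where \<gamma>: "\<gamma> \<in> SL2Z" "mat_act \<gamma> x \<noteq> y" "mat_height \<gamma> \<le> C * B"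
      "infnorm (mat_act \<gamma> x - y) \<le> C * (Q * (1 / E) + (1 / F) / Q)"
      using C(2)[rule_format, OF A(1) v(2,1) B'(1) v(3) B'(5), of y]
      unfolding EF unfolding B_def V_def Q_def by auto
    have "C * (Q * (1 / E) + (1 / F) / Q) = C * (Q / E + 1 / (Q * F))" by (simp add: field_simps)
    also have "\<dots> \<le> C * (8 * B powr (- (1 / 3)))" using q1 q2 C(1) by (intro mult_left_mono) linarith+
    finally have "infnorm (mat_act \<gamma> x - y) \<le> 8 * C * B powr (- (1 / 3))" using \<gamma>(4) by simp
    moreover have "mat_height \<gamma> \<le> 8 * C * B powr 1"
    proof -
      have "C * B \<le> 8 * (C * B)" using C(1) B(2) by simp
      moreover have "8 * C * B powr 1 = 8 * (C * B)" using B(2) by simp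
      ultimately show ?thesis using \<gamma>(3) by linarith
    qed
    ultimately show "\<exists>B\<ge>R. \<exists>\<gamma>\<in>SL2Z. mat_act \<gamma> x \<noteq> y \<and> mat_height \<gamma> \<le> 8 * C * B powr 1
        \<and> infnorm (mat_act \<gamma> x - y) \<le> 8 * C * B powr (- (1 / 3))"
      using \<gamma> B by blast
  qed (use C in auto)
  then show ?thesis by simp
qed

text \<open>
  The hypothesis on \<open>t\<close> is satisfied by \<open>t = 0\<close>, and by \<open>t = 1 / z\<close> whenever \<open>z\<close> exceeds
  the irrationality measure of \<open>slope y\<close>.
\<close>

lemma unif_approx_exp_irrational_ge:
  fixes x y :: "real^2"
  assumes x: "x $ 2 \<noteq> 0" "slope x \<notin> \<rat>" and y: "y $ 2 \<noteq> 0" "slope y \<notin> \<rat>"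
    and w: "irr_measure (slope x) < ereal w" "0 < w" and t: "0 \<le> t" "0 < d"
    and d: "\<And>P. 2 \<le> P \<Longrightarrow> \<exists>q p. coprime q p \<and> 0 < q \<and> of_int q \<le> P
      \<and> \<bar>lform (slope y) q p\<bar> \<le> 2 / P \<and> d * P powr t \<le> of_int q"
  shows "ereal ((1 + t) / (2 + t) / (w + 1)) \<le> unif_approx_exp x y"
proof -
  define \<xi> where "\<xi> = slope x"
  define \<eta> where "\<eta> = slope y"
  obtain C where C: "C > 0" "\<forall>v u q p y0. coprime v u \<longrightarrow> 0 < v \<longrightarrow> of_int v * \<bar>lform \<xi> v u\<bar> \<le> 1 \<longrightarrow>
    coprime q p \<longrightarrow> 0 < q \<longrightarrow> \<bar>lform \<eta> q p\<bar> \<le> 1 \<longrightarrow>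
    (\<exists>\<gamma>\<in>SL2Z. mat_act \<gamma> x \<noteq> y0
      \<and> mat_height \<gamma> \<le> C * ((of_int v + of_int q) * (1 / \<bar>lform \<xi> v u\<bar>))
      \<and> infnorm (mat_act \<gamma> x - y) \<le> C * (of_int q * \<bar>lform \<xi> v u\<bar> + \<bar>lform \<eta> q p\<bar> / of_int q))"
    using exists_approx_irrational_direction[OF x y(1)] unfolding \<xi>_def \<eta>_def by blast
  obtain c where c: "c > 0"
    "\<And>Q. Q \<ge> 2 \<Longrightarrow> \<exists>v u. coprime v u \<and> 0 < v \<and> of_int v \<le> Q \<and> \<bar>lform \<xi> v u\<bar> \<le> 2 / Q
       \<and> of_int v * \<bar>lform \<xi> v u\<bar> \<le> 1 \<and> c * of_int v powr (- w) \<le> \<bar>lform \<xi> v u\<bar>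
       \<and> 1 / \<bar>lform \<xi> v u\<bar> \<le> 1 / c * Q powr w"
    using exists_lform_of_finite_irr_measure[of \<xi> w] x w unfolding \<xi>_def by blast
  define s where "s = (1 + t) / (2 + t)"
  define K where "K = max (2 * C / c) (C * (2 + 2 / d))"
  have "filterlim (\<lambda>Q. Q powr (1 / (2 + t))) at_top at_top"
  proof -
    have "0 < 1 / (2 + t)" using t(1) by simp
    then show ?thesis by real_asymp
  qed
  then have P2: "\<forall>\<^sub>F Q in at_top. 2 \<le> Q powr (1 / (2 + t))" by (simp add: filterlim_at_top)
  have "ereal (s / (w + 1)) \<le> unif_approx_exp x y"
  proof (rule unif_approx_exp_ge[of "w + 1" K])
    show "\<forall>\<^sub>F Q in at_top. \<exists>\<gamma>\<in>SL2Z. mat_height \<gamma> \<le> K * Q powr (w + 1)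
        \<and> infnorm (mat_act \<gamma> x - y) \<le> K * Q powr (- s)"
      using P2 eventually_ge_at_top[of 2]
    proof eventually_elim
      case (elim Q)
      \<comment> \<open>Equalises the two error terms: P/Q and P^(-(1+t)) are both Q^(-s). Since P
        <= Q, the height keeps its order Q^(w+1).\<close>
      define P where "P = Q powr (1 / (2 + t))"
      have "P \<ge> 2" using elim by (simp add: P_def)
      have "P \<le> Q powr 1" unfolding P_def using elim t(1) by (intro powr_mono) (auto simp: field_simps)
      then have "P \<le> Q" using elim by simp
      obtain v u where vu: "coprime v u" "0 < v" "of_int v \<le> Q" "\<bar>lform \<xi> v u\<bar> \<le> 2 / Q"
        "of_int v * \<bar>lform \<xi> v u\<bar> \<le> 1" "1 / \<bar>lform \<xi> v u\<bar> \<le> 1 / c * Q powr w"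
        using c(2)[OF elim(2)] by blast
      obtain q p where qp: "coprime q p" "0 < q" "of_int q \<le> P" "\<bar>lform \<eta> q p\<bar> \<le> 2 / P" "d * P powr t \<le> of_int q"
        using d[OF \<open>P \<ge> 2\<close>] unfolding \<eta>_def by blast
      have "2 / P \<le> 1" using \<open>P \<ge> 2\<close> by simp
      then have f1: "\<bar>lform \<eta> q p\<bar> \<le> 1" using qp(4) by linarith
      obtain \<gamma> where \<gamma>: "\<gamma> \<in> SL2Z" "mat_height \<gamma> \<le> C * ((of_int v + of_int q) * (1 / \<bar>lform \<xi> v u\<bar>))"
        "infnorm (mat_act \<gamma> x - y) \<le> C * (of_int q * \<bar>lform \<xi> v u\<bar> + \<bar>lform \<eta> q p\<bar> / of_int q)"
        using C(2)[rule_format, OF vu(1,2,5) qp(1,2) f1] by blast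
      have "(of_int v + of_int q) * (1 / \<bar>lform \<xi> v u\<bar>) \<le> (Q + Q) * (1 / c * Q powr w)"
        using vu qp \<open>P \<le> Q\<close> elim by (intro mult_mono add_mono) auto
      then have "mat_height \<gamma> \<le> C * ((Q + Q) * (1 / c * Q powr w))"
        using \<gamma>(2) C(1) by (meson mult_le_cancel_left_pos order_trans)
      also have "\<dots> = 2 * C / c * Q powr (w + 1)" using elim by (simp add: powr_add)
      also have "\<dots> \<le> K * Q powr (w + 1)" unfolding K_def by (intro mult_right_mono) auto
      finally have h: "mat_height \<gamma> \<le> K * Q powr (w + 1)" .
      have e1: "1 / (2 + t) - 1 = - s" using t(1) by (simp add: s_def field_simps)
      have "P / Q = Q powr (1 / (2 + t) - 1)" using elim by (simp add: P_def powr_diff)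
      then have PQ: "P / Q = Q powr (- s)" by (simp only: e1)
      have "1 / (2 + t) * - (1 + t) = - s" using t(1) by (simp add: s_def field_simps)
      then have Pt: "P powr (- (1 + t)) = Q powr (- s)" unfolding P_def powr_powr by (simp only:)
      have "of_int q * \<bar>lform \<xi> v u\<bar> \<le> P * (2 / Q)" using qp(3) vu(4) \<open>P \<ge> 2\<close> by (intro mult_mono) auto
      also have "\<dots> = 2 * (P / Q)" by simp
      finally have 1: "of_int q * \<bar>lform \<xi> v u\<bar> \<le> 2 * Q powr (- s)" unfolding PQ .
      have "\<bar>lform \<eta> q p\<bar> / of_int q \<le> (2 / P) / (d * P powr t)"
        using qp t(2) \<open>P \<ge> 2\<close> by (intro frac_le) auto
      also have "\<dots> = 2 / d * P powr (- (1 + t))"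
        unfolding powr_minus_divide using \<open>P \<ge> 2\<close> by (simp add: powr_add)
      finally have 2: "\<bar>lform \<eta> q p\<bar> / of_int q \<le> 2 / d * Q powr (- s)" unfolding Pt .
      have "of_int q * \<bar>lform \<xi> v u\<bar> + \<bar>lform \<eta> q p\<bar> / of_int q \<le> (2 + 2 / d) * Q powr (- s)"
        using 1 2 by (simp add: distrib_right)
      then have "C * (of_int q * \<bar>lform \<xi> v u\<bar> + \<bar>lform \<eta> q p\<bar> / of_int q) \<le> C * ((2 + 2 / d) * Q powr (- s))"
        using C(1) by (intro mult_left_mono) auto
      also have "\<dots> = C * (2 + 2 / d) * Q powr (- s)" by simp
      also have "\<dots> \<le> K * Q powr (- s)" unfolding K_def by (intro mult_right_mono) auto
      finally have "infnorm (mat_act \<gamma> x - y) \<le> K * Q powr (- s)" using \<gamma>(3) by simp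
      with h \<gamma>(1) show ?case by blast
    qed
  qed (use w C(1) c(1) in \<open>auto simp: K_def less_max_iff_disj\<close>)
  then show ?thesis by (simp add: s_def)
qed

section \<open>Values of the exponents\<close>

text \<open>The identity matrix alone gives exponent 0; this settles the lower bounds when the
  measure of the slope of \<open>x\<close> is infinite.\<close>

lemma unif_approx_exp_nonneg: "0 \<le> unif_approx_exp x y"
proof -
  define I where "I = mat2 1 0 0 1"
  define C where "C = max (mat_height I) (infnorm (mat_act I x - y))"
  have I: "I \<in> SL2Z" by (simp add: I_def SL2Z_iff)
  have C: "0 < C" using mat_height_ge_1[OF I] by (auto simp: C_def)
  have "ereal (0 / 1) \<le> unif_approx_exp x y"
  proof (rule unif_approx_exp_ge[of 1 C])
    show "\<forall>\<^sub>F Q in at_top. \<exists>\<gamma>\<in>SL2Z. mat_height \<gamma> \<le> C * Q powr 1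
        \<and> infnorm (mat_act \<gamma> x - y) \<le> C * Q powr - 0"
      using eventually_ge_at_top[of 1]
    proof eventually_elim
      case (elim Q)
      have "C * 1 \<le> C * Q" using C elim by (intro mult_left_mono) auto
      then show ?case using I elim by (intro bexI[of _ I]) (auto simp: C_def)
    qed
  qed (use C in auto)
  then show ?thesis by (simp add: zero_ereal_def)
qed

lemma ereal_ge_1_cases:
  assumes "1 \<le> (\<omega> :: ereal)"
  obtains "\<omega> = \<infinity>" | r where "\<omega> = ereal r" "1 \<le> r"
  using assms by (cases \<omega>) (auto simp: one_ereal_def)

text \<open>Both bounds hold for all real w on one side of the measure; letting w approach it, or
  grow without bound if it is infinite, gives equality.\<close>

lemma unif_approx_exp_zero:
  fixes x :: "real^2"
  assumes x: "x $ 2 \<noteq> 0" "slope x \<notin> \<rat>"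
  shows "unif_approx_exp x 0 = 1 / irr_measure (slope x)"
proof (rule antisym)
  define \<omega> where "\<omega> = irr_measure (slope x)"
  have "1 \<le> \<omega>" unfolding \<omega>_def by (rule irr_measure_ge_1[OF x(2)])
  show "unif_approx_exp x 0 \<le> 1 / irr_measure (slope x)"
    unfolding unif_approx_exp_def \<omega>_def[symmetric]
  proof (rule Sup_least)
    fix z assume "z \<in> {ereal m |m. \<forall>\<^sub>F T in at_top. \<exists>\<gamma>\<in>SL2Z. mat_height \<gamma> \<le> T \<and> infnorm (mat_act \<gamma> x - 0) \<le> T powr - m}"
    then obtain m where z: "z = ereal m" and m: "\<forall>\<^sub>F T in at_top. \<exists>\<gamma>\<in>SL2Z. mat_height \<gamma> \<le> T \<and> infnorm (mat_act \<gamma> x - 0) \<le> T powr - m"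
      by blast
    have le: "w * m \<le> 1" if "0 < w" "ereal w < \<omega>" "0 < m" for w
      using unif_approx_exp_zero_bound[OF x _ _ _ m] that by (simp add: \<omega>_def)
    show "z \<le> 1 / \<omega>"
      using \<open>1 \<le> \<omega>\<close>
    proof (cases rule: ereal_ge_1_cases)
      case 1
      have "m \<le> 0"
      proof (rule ccontr)
        assume "\<not> m \<le> 0"
        with le[of "2 / m"] 1 show False by simp
      qed
      then show ?thesis using 1 z by (simp add: zero_ereal_def)
    next
      case (2 r)
      have "m \<le> 1 / r"
      proof (rule ccontr)
        assume *: "\<not> m \<le> 1 / r"
        have "0 < 1 / r" using 2 by simp
        with * have "m > 0" by linarith
        then have "1 / m < r" using * 2 by (simp add: field_simps)
        then obtain w where w: "1 / m < w" "w < r" using dense by blast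
        have "0 < 1 / m" using \<open>m > 0\<close> by simp
        then have "w > 0" using w by linarith
        then have "w * m \<le> 1" using le w \<open>m > 0\<close> 2 by simp
        then show False using w(1) \<open>m > 0\<close> by (simp add: field_simps)
      qed
      then show ?thesis using 2 z by (simp add: one_ereal_def)
    qed
  qed
  have "1 / \<omega> \<le> unif_approx_exp x 0"
    using \<open>1 \<le> \<omega>\<close>
  proof (cases rule: ereal_ge_1_cases)
    case 1
    then show ?thesis using unif_approx_exp_nonneg by simp
  next
    case (2 r)
    have "ereal (1 / r) \<le> unif_approx_exp x 0"
    proof (rule ereal_le_densely[of 0])
      fix m assume m: "0 < m" "m < 1 / r"
      have "r < 1 / m" using m 2 by (simp add: field_simps)
      then show "ereal m \<le> unif_approx_exp x 0"
        using unif_approx_exp_zero_ge[OF x, of "1 / m"] 2 m by (simp add: \<omega>_def)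
    qed (use 2 in simp)
    then show ?thesis using 2 by (simp add: one_ereal_def)
  qed
  then show "1 / irr_measure (slope x) \<le> unif_approx_exp x 0"
    by (simp only: \<omega>_def)
qed

lemma quot_succ_ge_half:
  assumes "1 \<le> \<omega>"
  shows "1 / 2 \<le> quot_succ \<omega>"
  using assms
proof (cases rule: ereal_ge_1_cases)
  case 1
  have "(1 / 2 :: ereal) = ereal (1 / 2)" by (simp add: one_ereal_def)
  with 1 show ?thesis by (simp add: quot_succ_def one_ereal_def)
next
  case (2 r)
  have "(1 / 2 :: ereal) = ereal (1 / 2)" by (simp add: one_ereal_def)
  moreover have "quot_succ \<omega> = ereal (r / (r + 1))" using 2 by (simp add: quot_succ_def one_ereal_def)
  moreover have "1 / 2 \<le> r / (r + 1)" using 2 by (simp add: field_simps)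
  ultimately show ?thesis by simp
qed

text \<open>The maps m -> m/(1-m) and w -> w/(w+1) are inverse to each other, which matches the
  upper bound with the lower one. Nonpositive m lie below 1/2 anyway.\<close>

lemma approx_exp_rational:
  fixes x :: "real^2"
  assumes x: "x $ 2 \<noteq> 0" "slope x \<notin> \<rat>" and pq: "coprime p q" and l: "l \<noteq> 0"
  shows "approx_exp x (vector [l * of_int p, l * of_int q]) = quot_succ (irr_measure (slope x))"
proof (rule antisym)
  define \<omega> where "\<omega> = irr_measure (slope x)"
  define y :: "real^2" where "y = vector [l * of_int p, l * of_int q]"
  have "1 \<le> \<omega>" unfolding \<omega>_def by (rule irr_measure_ge_1[OF x(2)])
  have q: "quot_succ \<omega> = (if \<omega> = \<infinity> then ereal 1 else ereal (real_of_ereal \<omega> / (real_of_ereal \<omega> + 1)))"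
    using \<open>1 \<le> \<omega>\<close> by (cases rule: ereal_ge_1_cases) (auto simp: quot_succ_def one_ereal_def)
  show "approx_exp x (vector [l * of_int p, l * of_int q]) \<le> quot_succ (irr_measure (slope x))"
    unfolding approx_exp_def \<omega>_def[symmetric]
  proof (rule Sup_least)
    fix z assume "z \<in> {ereal m |m. infinite {\<gamma> \<in> SL2Z. infnorm (mat_act \<gamma> x - vector [l * of_int p, l * of_int q]) \<le> mat_height \<gamma> powr - m}}"
    then obtain m where z: "z = ereal m" and m: "infinite {\<gamma> \<in> SL2Z. infnorm (mat_act \<gamma> x - vector [l * of_int p, l * of_int q]) \<le> mat_height \<gamma> powr - m}"
      by blast
    show "z \<le> quot_succ \<omega>"
    proof (cases "0 < m")
      case True
      have m1: "m < 1" "ereal (m / (1 - m)) \<le> \<omega>"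
        using approx_exp_rational_bound[OF x pq l True m] by (simp_all add: \<omega>_def)
      from \<open>1 \<le> \<omega>\<close> show ?thesis
      proof (cases rule: ereal_ge_1_cases)
        case 1
        then show ?thesis using m1 unfolding z q by simp
      next
        case (2 r)
        then have "m \<le> r / (r + 1)" using m1 by (simp add: field_simps)
        then show ?thesis using 2 unfolding z q by simp
      qed
    next
      case False
      then have "z \<le> 0" by (simp add: z zero_ereal_def)
      also have "(0 :: ereal) \<le> 1 / 2" by simp
      also have "\<dots> \<le> quot_succ \<omega>" using \<open>1 \<le> \<omega>\<close> by (rule quot_succ_ge_half)
      finally show ?thesis .
    qed
  qed
  have ge: "ereal m \<le> approx_exp x y" if m: "0 < m" "m < 1" "ereal (m / (1 - m)) < \<omega>" for m
  proof -
    have "m / (1 - m) / (m / (1 - m) + 1) = m" using m by (simp add: field_simps)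
    with approx_exp_rational_ge[OF x pq, of "m / (1 - m)" l] m show ?thesis
      by (simp add: \<omega>_def y_def)
  qed
  have "quot_succ \<omega> \<le> approx_exp x y"
    using \<open>1 \<le> \<omega>\<close>
  proof (cases rule: ereal_ge_1_cases)
    case 1
    have "ereal 1 \<le> approx_exp x y"
      by (rule ereal_le_densely[of 0]) (use ge 1 in auto)
    then show ?thesis using 1 unfolding q by simp
  next
    case (2 r)
    have "ereal (r / (r + 1)) \<le> approx_exp x y"
    proof (rule ereal_le_densely[of 0])
      fix m assume m: "0 < m" "m < r / (r + 1)"
      have "r / (r + 1) < 1" using 2 by (simp add: field_simps)
      then have "m < 1" using m by linarith
      moreover have "m / (1 - m) < r" using m \<open>m < 1\<close> 2 by (simp add: field_simps)
      ultimately show "ereal m \<le> approx_exp x y" using ge m 2 by simp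
    qed (use 2 in simp)
    then show ?thesis using 2 unfolding q by simp
  qed
  then show "quot_succ (irr_measure (slope x)) \<le> approx_exp x (vector [l * of_int p, l * of_int q])"
    by (simp only: \<omega>_def y_def)
qed

lemma unif_approx_exp_rational:
  fixes x :: "real^2"
  assumes x: "x $ 2 \<noteq> 0" "slope x \<notin> \<rat>" and pq: "coprime p q" and l: "l \<noteq> 0"
  shows "unif_approx_exp x (vector [l * of_int p, l * of_int q]) = 1 / (irr_measure (slope x) + 1)"
proof (rule antisym)
  define \<omega> where "\<omega> = irr_measure (slope x)"
  define y :: "real^2" where "y = vector [l * of_int p, l * of_int q]"
  have "1 \<le> \<omega>" unfolding \<omega>_def by (rule irr_measure_ge_1[OF x(2)])
  show "unif_approx_exp x (vector [l * of_int p, l * of_int q]) \<le> 1 / (irr_measure (slope x) + 1)"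
    unfolding unif_approx_exp_def \<omega>_def[symmetric]
  proof (rule Sup_least)
    fix z assume "z \<in> {ereal m |m. \<forall>\<^sub>F T in at_top. \<exists>\<gamma>\<in>SL2Z. mat_height \<gamma> \<le> T
      \<and> infnorm (mat_act \<gamma> x - vector [l * of_int p, l * of_int q]) \<le> T powr - m}"
    then obtain m where z: "z = ereal m" and m: "\<forall>\<^sub>F T in at_top. \<exists>\<gamma>\<in>SL2Z. mat_height \<gamma> \<le> T
      \<and> infnorm (mat_act \<gamma> x - vector [l * of_int p, l * of_int q]) \<le> T powr - m"
      by blast
    have le: "(w + 1) * m \<le> 1" if "0 < w" "ereal w < \<omega>" "0 < m" for w
      using unif_approx_exp_rational_bound[OF x pq l _ _ _ m] that by (simp add: \<omega>_def)
    show "z \<le> 1 / (\<omega> + 1)"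
      using \<open>1 \<le> \<omega>\<close>
    proof (cases rule: ereal_ge_1_cases)
      case 1
      have "m \<le> 0"
      proof (rule ccontr)
        assume "\<not> m \<le> 0"
        \<comment> \<open>For w = 1/m the product (w + 1) m is 1 + m > 1.\<close>
        with le[of "1 / m"] 1 show False by (simp add: distrib_right)
      qed
      then show ?thesis using 1 z by (simp add: zero_ereal_def)
    next
      case (2 r)
      have "m \<le> 1 / (r + 1)"
      proof (rule ccontr)
        assume *: "\<not> m \<le> 1 / (r + 1)"
        have "0 < 1 / (r + 1)" using 2 by simp
        with * have "m > 0" by linarith
        then have "1 / m < r + 1" using * 2 by (simp add: field_simps)
        \<comment> \<open>The maximum with 0 ensures that the chosen w is positive, also when m >
          1.\<close>
        then have "max 0 (1 / m - 1) < r" using 2 by simp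
        then obtain w where w: "max 0 (1 / m - 1) < w" "w < r" using dense by blast
        then have "(w + 1) * m \<le> 1" using le \<open>m > 0\<close> 2 by simp
        moreover have "1 / m < w + 1" using w by simp
        ultimately show False using \<open>m > 0\<close> by (simp add: field_simps)
      qed
      then show ?thesis using 2 z by (simp add: one_ereal_def)
    qed
  qed
  have "1 / (\<omega> + 1) \<le> unif_approx_exp x y"
    using \<open>1 \<le> \<omega>\<close>
  proof (cases rule: ereal_ge_1_cases)
    case 1
    then show ?thesis using unif_approx_exp_nonneg by simp
  next
    case (2 r)
    have "ereal (1 / (r + 1)) \<le> unif_approx_exp x y"
    proof (rule ereal_le_densely[of 0])
      fix m assume m: "0 < m" "m < 1 / (r + 1)"
      have "r < 1 / m - 1" using m 2 by (simp add: field_simps)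
      moreover have "1 / (r + 1) < 1" using 2 by (simp add: field_simps)
      then have "m < 1" using m by linarith
      ultimately show "ereal m \<le> unif_approx_exp x y"
        using unif_approx_exp_rational_ge[OF x pq, of "1 / m - 1" l] 2 m by (simp add: \<omega>_def y_def)
    qed (use 2 in simp)
    then show ?thesis using 2 by (simp add: one_ereal_def)
  qed
  then show "1 / (irr_measure (slope x) + 1) \<le> unif_approx_exp x (vector [l * of_int p, l * of_int q])"
    by (simp only: \<omega>_def y_def)
qed

text \<open>Unites the two cases of rational slope and vanishing second coordinate: y lies on a line
  through a primitive integer vector, (1, 0) in the latter.\<close>

lemma rational_direction:
  fixes y :: "real^2"
  assumes "y \<noteq> 0" "(y $ 2 \<noteq> 0 \<and> slope y \<in> \<rat>) \<or> y $ 2 = 0"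
  obtains p q l where "coprime p q" "l \<noteq> 0" "y = vector [l * of_int p, l * of_int q]"
proof (cases "y $ 2 = 0")
  case True
  then have "y $ 1 \<noteq> 0" using assms(1) by (auto simp: vec_eq_iff forall_2)
  with True show ?thesis
    by (intro that[of 1 0 "y $ 1"]) (auto simp: vec_eq_iff forall_2)
next
  case False
  then have "slope y \<in> \<rat>" using assms(2) by simp
  then obtain a b where ab: "slope y = of_int a / of_int b" "0 < b" "coprime a b"
    by (meson Rats_cases')
  have "y $ 1 = slope y * y $ 2" using False by (simp add: slope_def)
  with ab False show ?thesis
    by (intro that[of a b "y $ 2 / of_int b"]) (auto simp: vec_eq_iff forall_2)
qed

text \<open>A form at most 2/P but at least c q^(-z) forces q >= (c P/2)^(1/z). A large q lowers the
  error f/q.\<close>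

lemma exists_lform_with_large_coefficient:
  assumes \<eta>: "\<eta> \<notin> \<rat>" and z: "irr_measure \<eta> < ereal z" "0 < z"
  obtains d where "d > 0" "\<And>P. 2 \<le> P \<Longrightarrow> \<exists>q p. coprime q p \<and> 0 < q \<and> of_int q \<le> P
    \<and> \<bar>lform \<eta> q p\<bar> \<le> 2 / P \<and> d * P powr (1 / z) \<le> of_int q"
proof -
  obtain c where c: "c > 0"
    "\<And>Q. Q \<ge> 2 \<Longrightarrow> \<exists>v u. coprime v u \<and> 0 < v \<and> of_int v \<le> Q \<and> \<bar>lform \<eta> v u\<bar> \<le> 2 / Q
       \<and> of_int v * \<bar>lform \<eta> v u\<bar> \<le> 1 \<and> c * of_int v powr (- z) \<le> \<bar>lform \<eta> v u\<bar>
       \<and> 1 / \<bar>lform \<eta> v u\<bar> \<le> 1 / c * Q powr z"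
    using exists_lform_of_finite_irr_measure[OF \<eta> z(1)] by blast
  show ?thesis
  proof (rule that[of "(c / 2) powr (1 / z)"])
    show "0 < (c / 2) powr (1 / z)" using c(1) by simp
    fix P :: real assume P: "2 \<le> P"
    obtain q p where qp: "coprime q p" "0 < q" "of_int q \<le> P" "\<bar>lform \<eta> q p\<bar> \<le> 2 / P"
      "c * of_int q powr (- z) \<le> \<bar>lform \<eta> q p\<bar>"
      using c(2)[OF P] by blast
    have q: "1 \<le> real_of_int q" using qp(2) by simp
    have "c * of_int q powr (- z) \<le> 2 / P" using qp by linarith
    then have "c / 2 * P \<le> of_int q powr z" using P q by (simp add: powr_minus field_simps)
    then have "(c / 2 * P) powr (1 / z) \<le> (of_int q powr z) powr (1 / z)"
      using P c(1) z(2) by (intro powr_mono2) auto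
    then have "(c / 2) powr (1 / z) * P powr (1 / z) \<le> of_int q"
      using q z(2) by (simp only: powr_powr powr_mult) simp
    with qp show "\<exists>q p. coprime q p \<and> 0 < q \<and> of_int q \<le> P
      \<and> \<bar>lform \<eta> q p\<bar> \<le> 2 / P \<and> (c / 2) powr (1 / z) * P powr (1 / z) \<le> of_int q"
      by blast
  qed
qed

lemma succ_quot_double_bounds:
  assumes "1 \<le> \<omega>"
  obtains g where "succ_quot_double \<omega> = ereal g" "1 / 2 \<le> g" 
  using assms
proof (cases rule: ereal_ge_1_cases)
  case 1
  then show ?thesis by (intro that[of "1 / 2"]) (simp_all add: succ_quot_double_def one_ereal_def)
next
  case (2 r)
  have "2 * ereal r + 1 = ereal (2 * r + 1)" by (simp add: one_ereal_def)
  then have "succ_quot_double \<omega> = ereal ((r + 1) / (2 * r + 1))"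
    using 2 by (simp add: succ_quot_double_def one_ereal_def)
  moreover have "1 / 2 \<le> (r + 1) / (2 * r + 1)" using 2 by (simp add: field_simps)
  ultimately show ?thesis by (rule that)
qed

text \<open>The construction gives ((1+t)/(2+t))/(w+1) for w above the measure of the slope of
  \<open>x\<close>; the denominator 2 \<omega> of the claim arises from \<omega> + 1 <= 2
  \<omega>.\<close>

lemma unif_approx_exp_irrational:
  fixes x y :: "real^2"
  assumes x: "x $ 2 \<noteq> 0" "slope x \<notin> \<rat>" and y: "y $ 2 \<noteq> 0" "slope y \<notin> \<rat>"
  shows "succ_quot_double (irr_measure (slope y)) / (2 * irr_measure (slope x)) \<le> unif_approx_exp x y"
proof -
  have \<omega>y: "1 \<le> irr_measure (slope y)" by (rule irr_measure_ge_1[OF y(2)])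
  have "1 \<le> irr_measure (slope x)" by (rule irr_measure_ge_1[OF x(2)])
  then show ?thesis
  proof (cases rule: ereal_ge_1_cases)
    case 1
    obtain g where "succ_quot_double (irr_measure (slope y)) = ereal g"
      using succ_quot_double_bounds[OF \<omega>y] by metis
    then show ?thesis using 1 unif_approx_exp_nonneg by simp
  next
    case (2 s)
    have main: "ereal m \<le> unif_approx_exp x y"
      if t: "0 \<le> t" "0 < d" and m: "0 < m" "m < (1 + t) / (2 + t) / (2 * s)"
        and d: "\<And>P. 2 \<le> P \<Longrightarrow> \<exists>q p. coprime q p \<and> 0 < q \<and> of_int q \<le> P
          \<and> \<bar>lform (slope y) q p\<bar> \<le> 2 / P \<and> d * P powr t \<le> of_int q" for m t d
    proof -
      define g where "g = (1 + t) / (2 + t)"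
      \<comment> \<open>Chosen so that g/(w+1) = m; since g/m > 2s and s >= 1, it exceeds 2s - 1 >=
        s.\<close>
      define w where "w = g / m - 1"
      have "g > 0" using t by (simp add: g_def)
      have "m < g / (2 * s)" using m(2) by (simp only: g_def)
      then have "2 * s < g / m" using m(1) 2 by (simp add: field_simps)
      then have w: "s < w" "0 < w" using 2(2) by (simp_all add: w_def)
      have "ereal (g / (w + 1)) \<le> unif_approx_exp x y"
        unfolding g_def by (rule unif_approx_exp_irrational_ge[OF x y _ _ t d]) (use w 2 in simp_all)
      moreover have "g / (w + 1) = m" using \<open>g > 0\<close> m by (simp add: w_def)
      ultimately show ?thesis by simp
    qed
    from \<omega>y show ?thesis
    proof (cases rule: ereal_ge_1_cases)
      case 1
      have "ereal (1 / 2 / (2 * s)) \<le> unif_approx_exp x y"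
      proof (rule ereal_le_densely[of 0])
        fix m assume m: "0 < m" "m < 1 / 2 / (2 * s)"
        show "ereal m \<le> unif_approx_exp x y"
        \<comment> \<open>An infinite measure gives no lower bound on q beyond q >= 1, hence t = 0
          and d = 1.\<close>
        proof (rule main[of 0 1])
          fix P :: real assume P: "2 \<le> P"
          then have "1 \<le> P" by simp
          obtain q p where "coprime q p" "0 < q" "of_int q \<le> P" "\<bar>lform (slope y) q p\<bar> \<le> 2 / P"
            using Dirichlet_lform_real[OF \<open>1 \<le> P\<close>] by metis
          then show "\<exists>q p. coprime q p \<and> 0 < q \<and> of_int q \<le> P
              \<and> \<bar>lform (slope y) q p\<bar> \<le> 2 / P \<and> 1 * P powr 0 \<le> of_int q"
            using P by (intro exI[of _ q] exI[of _ p]) auto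
        qed (use m in auto)
      qed (use 2 in simp)
      then show ?thesis using 1 2 by (simp add: succ_quot_double_def one_ereal_def)
    next
      case (2 r)
      have "ereal ((r + 1) / (2 * r + 1) / (2 * s)) \<le> unif_approx_exp x y"
      proof (rule ereal_le_densely[of 0])
        show "0 < (r + 1) / (2 * r + 1) / (2 * s)" using 2 \<open>1 \<le> s\<close> by simp
        fix m assume m: "0 < m" "m < (r + 1) / (2 * r + 1) / (2 * s)"
        \<comment> \<open>The coefficient bound needs z strictly above the measure r; continuity at
          r keeps m below the resulting value.\<close>
        have "((\<lambda>z. (z + 1) / (2 * z + 1) / (2 * s)) \<longlongrightarrow> (r + 1) / (2 * r + 1) / (2 * s)) (at_right r)"
          using 2 \<open>1 \<le> s\<close> by (intro tendsto_intros) auto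
        then have "\<forall>\<^sub>F z in at_right r. m < (z + 1) / (2 * z + 1) / (2 * s)"
          using m(2) by (rule order_tendstoD)
        moreover have "\<forall>\<^sub>F z in at_right r. r < z"
          by (simp add: eventually_at_filter)
        ultimately have "\<forall>\<^sub>F z in at_right r. m < (z + 1) / (2 * z + 1) / (2 * s) \<and> r < z"
          by eventually_elim simp
        then obtain z where z: "m < (z + 1) / (2 * z + 1) / (2 * s)" "r < z"
          using eventually_happens' trivial_limit_at_right_real by blast
        have z': "irr_measure (slope y) < ereal z" "0 < z" using z 2 by simp_all
        obtain d where d: "d > 0" "\<And>P. 2 \<le> P \<Longrightarrow> \<exists>q p. coprime q p \<and> 0 < q \<and> of_int q \<le> P
          \<and> \<bar>lform (slope y) q p\<bar> \<le> 2 / P \<and> d * P powr (1 / z) \<le> of_int q"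
          using exists_lform_with_large_coefficient[OF y(2) z'] by blast
        \<comment> \<open>With t = 1/z the factor (1+t)/(2+t) becomes (z+1)/(2z+1), the quotient in
          the theorem.\<close>
        have "1 + 1 / z = (z + 1) / z" "2 + 1 / z = (2 * z + 1) / z"
          using z'(2) by (simp_all add: field_simps)
        then have "(z + 1) / (2 * z + 1) = (1 + 1 / z) / (2 + 1 / z)" using z'(2) by simp
        with z(1) have "m < (1 + 1 / z) / (2 + 1 / z) / (2 * s)" by simp
        then show "ereal m \<le> unif_approx_exp x y"
          using main[of "1 / z" d m] d m(1) z'(2) by simp
      qed
      moreover have "2 * ereal r + 1 = ereal (2 * r + 1)" by (simp add: one_ereal_def)
      ultimately show ?thesis using 2 \<open>irr_measure (slope x) = ereal s\<close> \<open>1 \<le> s\<close>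
        by (simp add: succ_quot_double_def one_ereal_def)
    qed
  qed
qed

lemma succ_quot_double_div_ge:
  assumes "1 \<le> \<omega>" "1 \<le> \<omega>'"
  shows "1 / (4 * \<omega>) \<le> succ_quot_double \<omega>' / (2 * \<omega>)"
proof -
  obtain g where g: "succ_quot_double \<omega>' = ereal g" "1 / 2 \<le> g"
    using succ_quot_double_bounds[OF assms(2)] by metis
  from assms(1) show ?thesis
  proof (cases rule: ereal_ge_1_cases)
    case 1
    then show ?thesis using g by simp
  next
    case (2 s)
    have "1 / (4 * s) \<le> g / (2 * s)" using g 2 by (simp add: field_simps)
    then show ?thesis using g 2 by (simp add: one_ereal_def)
  qed
qed

theorem theorem2:
  fixes x :: "real^2"
  assumes "x $ 2 \<noteq> 0" and "slope x \<notin> \<rat>"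
  shows
    "(approx_exp x 0 = 1 \<and> unif_approx_exp x 0 = 1 / irr_measure (slope x))
   \<and> (\<forall>y :: real^2. y \<noteq> 0 \<longrightarrow> (y $ 2 \<noteq> 0 \<and> slope y \<in> \<rat>) \<or> y $ 2 = 0 \<longrightarrow>
        approx_exp x y = quot_succ (irr_measure (slope x))
      \<and> quot_succ (irr_measure (slope x)) \<ge> 1 / 2
      \<and> unif_approx_exp x y = 1 / (irr_measure (slope x) + 1))
   \<and> (\<forall>y :: real^2. y $ 2 \<noteq> 0 \<longrightarrow> slope y \<notin> \<rat> \<longrightarrow>
        approx_exp x y \<ge> 1 / 3
      \<and> unif_approx_exp x y
          \<ge> succ_quot_double (irr_measure (slope y)) / (2 * irr_measure (slope x))
      \<and> succ_quot_double (irr_measure (slope y)) / (2 * irr_measure (slope x))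
          \<ge> 1 / (4 * irr_measure (slope x)))"
proof (intro conjI allI impI)
  show "approx_exp x 0 = 1"
    using approx_exp_zero_le[OF assms(1)] approx_exp_zero_ge[OF assms] by (rule antisym)
  show "unif_approx_exp x 0 = 1 / irr_measure (slope x)"
    by (rule unif_approx_exp_zero[OF assms])
next
  fix y :: "real^2"
  assume "y \<noteq> 0" "(y $ 2 \<noteq> 0 \<and> slope y \<in> \<rat>) \<or> y $ 2 = 0"
  then obtain p q l where pq: "coprime p q" "l \<noteq> 0" and y: "y = vector [l * of_int p, l * of_int q]"
    by (rule rational_direction)
  show "approx_exp x y = quot_succ (irr_measure (slope x))"
    unfolding y by (rule approx_exp_rational[OF assms pq])
  show "unif_approx_exp x y = 1 / (irr_measure (slope x) + 1)"
    unfolding y by (rule unif_approx_exp_rational[OF assms pq])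
  show "quot_succ (irr_measure (slope x)) \<ge> 1 / 2"
    by (rule quot_succ_ge_half[OF irr_measure_ge_1[OF assms(2)]])
next
  fix y :: "real^2"
  assume y: "y $ 2 \<noteq> 0" "slope y \<notin> \<rat>"
  have "ereal (1 / 3) = 1 / 3" by (simp add: one_ereal_def)
  then show "approx_exp x y \<ge> 1 / 3"
    using approx_exp_irrational_ge[OF assms y] by simp
  show "unif_approx_exp x y \<ge> succ_quot_double (irr_measure (slope y)) / (2 * irr_measure (slope x))"
    by (rule unif_approx_exp_irrational[OF assms y])
  show "succ_quot_double (irr_measure (slope y)) / (2 * irr_measure (slope x)) \<ge> 1 / (4 * irr_measure (slope x))"
    by (rule succ_quot_double_div_ge[OF irr_measure_ge_1[OF assms(2)] irr_measure_ge_1[OF y(2)]])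
qed

end
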